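(* For $i=1,2$, let $\mu_i\in L^\infty([0,T];\mathscr P_1(\mathbb R^{2d}))$ be such that $\mu_i=f_i\,\mathscr L^{2d}$, where $f_i\in L^\infty([0,T];L^1(\mathbb R^{2d}))$ is a Lagrangian weak $\phi$-solution of the generalized Vlasov--Poisson system relative to $(F_i,E_i)$, $E_i=E_{f_i}$, with initial datum $f_0^i\in L^1(\mathbb R^{2d})$, where $F_i\in L^\infty([0,T];C(\mathbb R^{2d};\mathbb R^d))$ satisfies $$\operatorname*{ess\,sup}_{t\in[0,T]}|F_i(t,x,v)-F_i(t,y,w)|\le L\,[|x-y|+|v-w|]\quad\text{for all }x,y,v,w\in\mathbb R^d$$ for some $L\in[1,+\infty)$, and $\operatorname{div}_xF_i=0$. Write $\mu_0^i=f_0^i\,\mathscr L^{2d}$. Assume that $\phi$ is concave and that $\Phi$ satisfies $\int_{0^+}\frac{dt}{\sqrt{\Phi(t)}}=+\infty$. If $$2L\,\mathsf W_1(\mu_0^1,\mu_0^2)+\|F_1-F_2\|_{L^\infty}<\delta$$ for some $\delta>0$, then for all $t\in[0,T]$ $$\begin{aligned}\mathsf W_1(\mu_1(t,\cdot),\mu_2(t,\cdot))&\le\Psi_{\delta,2L}^{-1}\big(\Psi_{\delta,2L}(\mathsf W_1(\mu_0^1,\mu_0^2))+e^{Lt}-1\big)\\&\quad+e^{Lt}\Big(\delta+\sqrt{4L\,\Phi\big(\Psi_{\delta,2L}^{-1}\big(\Psi_{\delta,2L}(\mathsf W_1(\mu_0^1,\mu_0^2))+e^{Lt}-1\big)\big)}\Big).\end{aligned}$$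 In particular, if $f_0^1=f_0^2$ and $F_1=F_2$, then $f_1=f_2$.
   Context: Fix $T\in(0,+\infty)$ and a dimension $d$; $\mathscr L^{2d}$ is Lebesgue measure. Let $\phi\in C([0,+\infty);[0,+\infty))$ with $\phi(t)>0$ for $t>0$, $\Phi(t)=\int_0^t\phi(s)\,ds$, and, for $\delta,c>0$, $$\Psi_{\delta,c}(t)=\int_0^t\frac{ds}{\delta+\sqrt{2c\,\Phi(s)}},\quad t\ge0,$$ a strictly increasing $C^1$ function with inverse $\Psi_{\delta,c}^{-1}$. $F\in L^\infty([0,T];C(\mathbb R^{2d};\mathbb R^d))$ means: $F(t,x,v)$ is measurable in $t$, continuous in $(x,v)$, and essentially bounded in $t$ locally in $(x,v)$ (so $F(t,x,v)=v$ is allowed). Let $K\colon\mathbb R^{2d}\to\mathbb R^d$ be a fixed measurable antisymmetric kernel: $K(x,y)=-K(y,x)$ for a.e. $x,y\in\mathbb R^d$. The generalized Vlasov--Poisson system relative to $F$ is $$\partial_tf+F\cdot\nabla_xf+E_f\cdot\nabla_vf=0\ \text{ in }(0,T)\times\mathbb R^{2d},\qquad f(0,\cdot)=f_0,$$ with $\rho_f(t,x)=\int_{\mathbb R^d}f(t,x,v)\,dv$ and $E_f(t,x)=\int_{\mathbb R^d}K(x,y)\rho_f(t,y)\,dy$. Weak $\phi$-solution with datum $f_0\in L^1(\mathbb R^{2d})$: $f\in L^\infty([0,T];L^1(\mathbb R^{2d}))$ such that (a) $(t,x)\mapsto\int_{\mathbb R^d}|K(x,z)|\,|\rho_f(t,z)|\,dz$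 belongs to $L^\infty([0,T]\times\mathbb R^d)$; (b) $\operatorname{ess\,sup}_{t\in[0,T]}\int_{\mathbb R^d}|K(x,z)-K(y,z)|\,|\rho_f(t,z)|\,dz\le\phi(|x-y|)$ for all $x,y\in\mathbb R^d$; (c) $\int_0^T\int_{\mathbb R^{2d}}(\partial_t\psi+F\cdot\nabla_x\psi+E_f\cdot\nabla_v\psi)f\,dx\,dv\,dt=-\int_{\mathbb R^{2d}}\psi(0,\cdot)f_0\,dx\,dv$ for all $\psi\in C^\infty_c([0,T)\times\mathbb R^{2d})$. It is Lagrangian if moreover $f(t,\cdot)=\Gamma(t,\cdot)_\#f_0$ (push-forward of the measure $f_0\mathscr L^{2d}$) for all $t\in[0,T]$, where $\Gamma(t,x,v)=(X(t),V(t))$ is any flow of $\dot X=F(t,X,V)$, $\dot V=E_f(t,X)$, $(X,V)(0)=(x,v)$. $\mathscr P_1(\mathbb R^{2d})$ is the set of Borel probability measures on $\mathbb R^{2d}$ with finite first moment, and $\mathsf W_1$ is the $1$-Wasserstein distance for the Euclidean distance. *)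

theory Defs
  imports "HOL-Probability.Probability"
begin

text \<open>
  The space \<open>\<real>\<^sup>d\<close> is an arbitrary Euclidean space \<open>'a\<close>; phase space \<open>\<real>\<^sup>2\<^sup>d\<close> is \<open>'a \<times> 'a\<close>, whose
  library norm is the Euclidean one. Functions of time are defined on \<open>real\<close> and only their
  restriction to \<open>{0..T}\<close> matters. Note that the library's \<open>esssup\<close> is infinite for
  non-measurable functions, so that a finite essential supremum includes measurability.
\<close>

section \<open>The functions \<open>\<Phi>\<close> and \<open>\<Psi>\<close>\<close>

definition Phi :: "(real \<Rightarrow> real) \<Rightarrow> real \<Rightarrow> real" where
  "Phi \<phi> t = integral {0..t} \<phi>"

definition Psi :: "(real \<Rightarrow> real) \<Rightarrow> real \<Rightarrow> real \<Rightarrow> real \<Rightarrow> real" where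
  "Psi \<phi> \<delta> c t = integral {0..t} (\<lambda>s. 1 / (\<delta> + sqrt (2 * c * Phi \<phi> s)))"

definition Psi_inv :: "(real \<Rightarrow> real) \<Rightarrow> real \<Rightarrow> real \<Rightarrow> real \<Rightarrow> real" where
  "Psi_inv \<phi> \<delta> c = the_inv_into {0..} (Psi \<phi> \<delta> c)"

text \<open>Divergence at \<open>0+\<close> of the integral of \<open>1 / sqrt \<Phi>\<close>.\<close>

definition osgood_sqrt :: "(real \<Rightarrow> real) \<Rightarrow> bool" where
  "osgood_sqrt \<phi> \<longleftrightarrow>
     (\<forall>\<epsilon>>0. (\<integral>\<^sup>+t\<in>{0<..\<epsilon>}. ennreal (1 / sqrt (Phi \<phi> t)) \<partial>lebesgue) = \<infinity>)"

section \<open>Test functions\<close>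

primrec Ck :: "nat \<Rightarrow> ('b::euclidean_space \<Rightarrow> real) \<Rightarrow> bool" where
  "Ck 0 \<psi> \<longleftrightarrow> continuous_on UNIV \<psi>"
| "Ck (Suc k) \<psi> \<longleftrightarrow> \<psi> differentiable_on UNIV \<and>
     (\<forall>b\<in>Basis. Ck k (\<lambda>p. frechet_derivative \<psi> (at p) b))"

text \<open>
  \<open>C\<^sub>c\<^sup>\<infinity>(U)\<close>. For \<open>[0,T) \<times> \<real>\<^sup>2\<^sup>d\<close>, which is not open, we take \<open>U = {..<T} \<times> UNIV\<close>: the test functions
  are then the restrictions to nonnegative times of the elements of \<open>C\<^sub>c\<^sup>\<infinity>(U)\<close>.
\<close>

definition test_fun :: "'b::euclidean_space set \<Rightarrow> ('b \<Rightarrow> real) \<Rightarrow> bool" where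
  "test_fun U \<psi> \<longleftrightarrow> (\<forall>k. Ck k \<psi>) \<and> compact (closure {p. \<psi> p \<noteq> 0}) \<and> closure {p. \<psi> p \<noteq> 0} \<subseteq> U"

section \<open>Function spaces in time\<close>

text \<open>\<open>F \<in> L\<^sup>\<infinity>([0,T]; C(\<real>\<^sup>2\<^sup>d; \<real>\<^sup>d))\<close> in the local sense; \<open>F t z\<close> need not be bounded in \<open>z\<close>.\<close>

definition Linf_C :: "real \<Rightarrow> (real \<Rightarrow> 'a \<times> 'a \<Rightarrow> 'a::euclidean_space) \<Rightarrow> bool" where
  "Linf_C T F \<longleftrightarrow>
     (\<forall>z. (\<lambda>t. F t z) \<in> borel_measurable (lebesgue_on {0..T})) \<and>
     (AE t in lebesgue_on {0..T}. continuous_on UNIV (F t)) \<and>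
     (\<forall>S. compact S \<longrightarrow> (\<exists>C. AE t in lebesgue_on {0..T}. \<forall>z\<in>S. norm (F t z) \<le> C))"

text \<open>The global (possibly infinite) \<open>L\<^sup>\<infinity>\<close> norm on \<open>[0,T] \<times> \<real>\<^sup>2\<^sup>d\<close>.\<close>

definition Linf_norm :: "real \<Rightarrow> (real \<Rightarrow> 'a \<times> 'a \<Rightarrow> 'a::euclidean_space) \<Rightarrow> ennreal" where
  "Linf_norm T G = esssup (lebesgue_on ({0..T} \<times> UNIV)) (\<lambda>(t, z). ennreal (norm (G t z)))"

definition Linf_L1 :: "real \<Rightarrow> (real \<Rightarrow> 'b::euclidean_space \<Rightarrow> real) \<Rightarrow> bool" where
  "Linf_L1 T f \<longleftrightarrow>
     (\<lambda>(t, z). f t z) \<in> borel_measurable (lebesgue_on ({0..T} \<times> UNIV)) \<and>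
     (\<forall>t\<in>{0..T}. integrable lebesgue (f t)) \<and>
     esssup (lebesgue_on {0..T}) (\<lambda>t. \<integral>\<^sup>+z. ennreal \<bar>f t z\<bar> \<partial>lebesgue) < \<infinity>"

section \<open>Probability measures and the Wasserstein distance\<close>

definition P1 :: "'b::euclidean_space measure set" where
  "P1 = {\<mu> \<in> space (prob_algebra borel). (\<integral>\<^sup>+z. ennreal (norm z) \<partial>\<mu>) < \<infinity>}"

definition Linf_P1 :: "real \<Rightarrow> (real \<Rightarrow> 'b::euclidean_space measure) \<Rightarrow> bool" where
  "Linf_P1 T \<mu> \<longleftrightarrow>
     \<mu> \<in> lebesgue_on {0..T} \<rightarrow>\<^sub>M prob_algebra borel \<and>
     (\<forall>t\<in>{0..T}. \<mu> t \<in> P1) \<and>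
     esssup (lebesgue_on {0..T}) (\<lambda>t. \<integral>\<^sup>+z. ennreal (norm z) \<partial>\<mu> t) < \<infinity>"

text \<open>
  The Borel measure \<open>\<mu>\<close> is \<open>f\<close> times Lebesgue measure. As \<open>f\<close> is only Lebesgue measurable and a priori
  signed, this is not \<open>\<mu> = density lborel f\<close>; nonnegativity of \<open>f\<close> a.e. follows.
\<close>

definition has_leb_density :: "'b::euclidean_space measure \<Rightarrow> ('b \<Rightarrow> real) \<Rightarrow> bool" where
  "has_leb_density \<mu> f \<longleftrightarrow> finite_measure \<mu> \<and> sets \<mu> = sets borel \<and> integrable lebesgue f \<and>
     (\<forall>A\<in>sets borel. measure \<mu> A = (LINT z:A|lebesgue. f z))"

definition couplings :: "'b::euclidean_space measure \<Rightarrow> 'b measure \<Rightarrow> ('b \<times> 'b) measure set" where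
  "couplings \<mu> \<nu> = {\<pi>. sets \<pi> = sets borel \<and> distr \<pi> borel fst = \<mu> \<and> distr \<pi> borel snd = \<nu>}"

text \<open>The infimum is finite for \<open>\<mu>, \<nu> \<in> P1\<close>, the only case in which \<open>W1\<close> is meaningful.\<close>

definition W1 :: "'b::euclidean_space measure \<Rightarrow> 'b measure \<Rightarrow> real" where
  "W1 \<mu> \<nu> = enn2real (INF \<pi>\<in>couplings \<mu> \<nu>. \<integral>\<^sup>+(z, w). ennreal (dist z w) \<partial>\<pi>)"

section \<open>The generalized Vlasov--Poisson system\<close>

text \<open>
  Measurability of all sections \<open>K x\<close> makes the integrals defining the field meaningful at every
  \<open>x\<close>; it is automatic for Borel kernels.
\<close>

definition antisym_kernel :: "('a \<Rightarrow> 'a \<Rightarrow> 'a::euclidean_space) \<Rightarrow> bool" where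
  "antisym_kernel K \<longleftrightarrow>
     (\<lambda>(x, y). K x y) \<in> borel_measurable lebesgue \<and>
     (\<forall>x. K x \<in> borel_measurable lebesgue) \<and>
     (AE (x, y) in lebesgue. K x y = - K y x)"

definition rho :: "(real \<Rightarrow> 'a \<times> 'a \<Rightarrow> real) \<Rightarrow> real \<Rightarrow> 'a::euclidean_space \<Rightarrow> real" where
  "rho f t x = (LINT v|lebesgue. f t (x, v))"

definition field ::
  "('a \<Rightarrow> 'a \<Rightarrow> 'a) \<Rightarrow> (real \<Rightarrow> 'a \<times> 'a \<Rightarrow> real) \<Rightarrow> real \<Rightarrow> 'a \<Rightarrow> 'a::euclidean_space" where
  "field K f t x = (LINT y|lebesgue. rho f t y *\<^sub>R K x y)"

text \<open>
  In the weak formulation, the derivative of \<open>\<psi>\<close> at \<open>(t,x,v)\<close> in direction \<open>(1, F, E)\<close> is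
  \<open>\<partial>\<^sub>t\<psi> + F \<cdot> \<nabla>\<^sub>x\<psi> + E \<cdot> \<nabla>\<^sub>v\<psi>\<close>.
\<close>

definition weak_phi_solution ::
  "real \<Rightarrow> ('a \<Rightarrow> 'a \<Rightarrow> 'a) \<Rightarrow> (real \<Rightarrow> real) \<Rightarrow> (real \<Rightarrow> 'a \<times> 'a \<Rightarrow> 'a) \<Rightarrow>
   ('a \<times> 'a \<Rightarrow> real) \<Rightarrow> (real \<Rightarrow> 'a \<times> 'a::euclidean_space \<Rightarrow> real) \<Rightarrow> bool" where
  "weak_phi_solution T K \<phi> F f0 f \<longleftrightarrow>
     integrable lebesgue f0 \<and>
     Linf_L1 T f \<and>
     esssup (lebesgue_on ({0..T} \<times> UNIV))
       (\<lambda>(t, x). \<integral>\<^sup>+z. ennreal (norm (K x z) * \<bar>rho f t z\<bar>) \<partial>lebesgue) < \<infinity> \<and>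
     (\<forall>x y. esssup (lebesgue_on {0..T})
       (\<lambda>t. \<integral>\<^sup>+z. ennreal (norm (K x z - K y z) * \<bar>rho f t z\<bar>) \<partial>lebesgue)
         \<le> ennreal (\<phi> (norm (x - y)))) \<and>
     (\<forall>\<psi>. test_fun ({..<T} \<times> UNIV) \<psi> \<longrightarrow>
       (LINT t:{0..T}|lebesgue. LINT z|lebesgue.
          frechet_derivative \<psi> (at (t, z)) (1, F t z, field K f t (fst z)) * f t z)
       = - (LINT z|lebesgue. \<psi> (0, z) * f0 z))"

text \<open>Solutions of the ODE are Caratheodory solutions, i.e. solutions of the integral equation.\<close>

definition is_flow ::
  "real \<Rightarrow> (real \<Rightarrow> 'a \<times> 'a \<Rightarrow> 'a) \<Rightarrow> (real \<Rightarrow> 'a \<Rightarrow> 'a) \<Rightarrow>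
   (real \<Rightarrow> 'a \<times> 'a \<Rightarrow> 'a \<times> 'a::euclidean_space) \<Rightarrow> bool" where
  "is_flow T F E \<Gamma> \<longleftrightarrow> (\<forall>z.
     set_integrable lebesgue {0..T} (\<lambda>s. (F s (\<Gamma> s z), E s (fst (\<Gamma> s z)))) \<and>
     (\<forall>t\<in>{0..T}. \<Gamma> t z = z + (LINT s:{0..t}|lebesgue. (F s (\<Gamma> s z), E s (fst (\<Gamma> s z))))))"

text \<open>Push-forward of the (possibly signed) measure \<open>f0\<close> times Lebesgue, tested on Borel sets.\<close>

definition pushes_forward :: "('b \<Rightarrow> 'b) \<Rightarrow> ('b \<Rightarrow> real) \<Rightarrow> ('b::euclidean_space \<Rightarrow> real) \<Rightarrow> bool" where
  "pushes_forward G f0 g \<longleftrightarrow> G \<in> lebesgue \<rightarrow>\<^sub>M borel \<and>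
     (\<forall>A\<in>sets borel. (LINT z:A|lebesgue. g z) = (LINT z:G -` A|lebesgue. f0 z))"

text \<open>
  A flow is required to exist; when flows are unique, as for Lipschitz \<open>F\<close> and concave \<open>\<phi>\<close> with
  \<open>osgood_sqrt \<phi>\<close>, the push-forward along some flow is the push-forward along any flow.
\<close>

definition lagrangian_weak_phi_solution ::
  "real \<Rightarrow> ('a \<Rightarrow> 'a \<Rightarrow> 'a) \<Rightarrow> (real \<Rightarrow> real) \<Rightarrow> (real \<Rightarrow> 'a \<times> 'a \<Rightarrow> 'a) \<Rightarrow>
   ('a \<times> 'a \<Rightarrow> real) \<Rightarrow> (real \<Rightarrow> 'a \<times> 'a::euclidean_space \<Rightarrow> real) \<Rightarrow> bool" where
  "lagrangian_weak_phi_solution T K \<phi> F f0 f \<longleftrightarrow>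
     weak_phi_solution T K \<phi> F f0 f \<and>
     (\<exists>\<Gamma>. is_flow T F (field K f) \<Gamma> \<and> (\<forall>t\<in>{0..T}. pushes_forward (\<Gamma> t) f0 (f t)))"

section \<open>Hypotheses on the vector field\<close>

definition ess_lipschitz :: "real \<Rightarrow> real \<Rightarrow> (real \<Rightarrow> 'a \<times> 'a \<Rightarrow> 'a::euclidean_space) \<Rightarrow> bool" where
  "ess_lipschitz T L F \<longleftrightarrow> (\<forall>x v y w.
     esssup (lebesgue_on {0..T}) (\<lambda>t. ennreal (norm (F t (x, v) - F t (y, w))))
       \<le> ennreal (L * (norm (x - y) + norm (v - w))))"

text \<open>\<open>div\<^sub>x F = 0\<close> in the sense of distributions on \<open>(0,T) \<times> \<real>\<^sup>2\<^sup>d\<close>.\<close>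

definition divx_free :: "real \<Rightarrow> (real \<Rightarrow> 'a \<times> 'a \<Rightarrow> 'a::euclidean_space) \<Rightarrow> bool" where
  "divx_free T F \<longleftrightarrow> (\<forall>\<psi>. test_fun ({0<..<T} \<times> UNIV) \<psi> \<longrightarrow>
     (LINT t:{0..T}|lebesgue. LINT z|lebesgue.
        frechet_derivative \<psi> (at (t, z)) (0, F t z, 0)) = 0)"

end

theory Submission
  imports Defs
begin

text \<open>
  Fix a coupling \<open>\<pi>\<close> of the initial measures and transport it by the two flows. Let \<open>q\<^sub>x\<close> and \<open>q\<^sub>v\<close> be the
  integrals over \<open>\<pi>\<close> of the distances between positions and between velocities. The Lipschitz bound gives
  \<open>q\<^sub>x' \<le> L (q\<^sub>x + q\<^sub>v) + \<parallel>F\<^sub>1 - F\<^sub>2\<parallel>\<close>. In \<open>E\<^sub>1(X\<^sub>1) - E\<^sub>2(X\<^sub>2) = (E\<^sub>1(X\<^sub>1) - E\<^sub>1(X\<^sub>2)) + (E\<^sub>1 - E\<^sub>2)(X\<^sub>2)\<close> the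
  first term is controlled by the modulus \<open>\<phi>\<close>; the second one becomes, by antisymmetry of the kernel and Fubini, an
  integral of differences \<open>K(X\<^sub>1, y) - K(X\<^sub>2, y)\<close> against the law of \<open>X\<^sub>2\<close>, and is controlled by \<open>\<phi>\<close> again. Jensen's
  inequality yields \<open>q\<^sub>v' \<le> 2 \<phi>(q\<^sub>x)\<close>, and this second order differential inequality is integrated by an energy
  argument.

  The exceptional null set of times in the modulus of continuity of the fields depends on the pair of points, and
  trajectories could a priori stay in exceptional points. This is excluded since \<open>K(x, \<cdot>)\<close> satisfies the bound at
  almost every time for almost every \<open>x\<close>, while the position marginals are absolutely continuous.
\<close>

section \<open>Concave moduli and the comparison inequality\<close>

text \<open>Three points shape the argument. \<open>W1\<close> is an infimum, approached by
  couplings of cost at most c for c slightly above it; the strict inequality in the hypothesis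
  leaves room for such a c. As c bounds both initial means, L (q_x + q_v) plus the norm of F1 - F2
  starts below 2 L c plus that norm, hence below \<delta>: this is the origin of the factor 2 L, and
  \<delta> acts as a bound on the initial speed of the comparison function. A coupling may be
  singular with respect to Lebesgue measure on the product, as the diagonal one is. Exceptional sets
  are therefore placed in single factors, where the marginals are absolutely continuous, and data
  that are only Lebesgue measurable are replaced by Borel versions before they are composed with
  flows. For uniqueness the comparison function itself is squeezed: with zero cost and equal fields
  \<delta> is a free positive number, and for fixed \<epsilon> the value of \<open>Psi\<close> at
  \<epsilon> tends to infinity as \<delta> tends to 0, while its value on the comparison function
  stays below exp(L t) - 1.\<close>

lemma concave_bounds:
  fixes \<phi> :: "real \<Rightarrow> real"
  assumes c: "concave_on {0..} \<phi>" and nn: "\<And>t. t \<ge> 0 \<Longrightarrow> \<phi> t \<ge> 0"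
  shows concave_nonneg_mono: "0 \<le> s \<Longrightarrow> s \<le> t \<Longrightarrow> \<phi> s \<le> \<phi> t"
    and concave_nonneg_linear_bound: "t \<ge> 0 \<Longrightarrow> \<phi> t \<le> \<phi> 1 * (1 + t)"
proof -
  have conc: "(1 - u) * \<phi> x + u * \<phi> y \<le> \<phi> ((1 - u) * x + u * y)"
    if "0 \<le> u" "u \<le> 1" "x \<ge> 0" "y \<ge> 0" for u x y
    using concave_onD[OF c, of u x y] that by simp
  show mono: "\<phi> s \<le> \<phi> t" if st: "0 \<le> s" "s \<le> t" for s t
  proof (rule ccontr)
    assume "\<not> ?thesis"
    then have lt: "\<phi> t < \<phi> s" by simp
    then have "s < t" using st by (cases "s = t") auto
    define d where "d = \<phi> s - \<phi> t"
    \<comment> \<open>Going \<open>n\<close> steps of length t - s multiplies the drop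
      \<open>d\<close> by at least \<open>n\<close>; this choice makes the total drop
      \<open>\<phi> s + d\<close>, which would force a negative value at \<open>y\<close>.\<close>
    define n where "n = \<phi> s / d + 1"
    have d: "d > 0" using lt by (simp add: d_def)
    have n: "n \<ge> 1" using d nn[of s] st by (simp add: n_def)
    define y where "y = s + n * (t - s)"
    have y: "y \<ge> 0" using st n by (simp add: y_def)
    have "(1 - 1/n) * s + (1/n) * y = t" using n by (simp add: y_def field_simps)
    then have "(1 - 1/n) * \<phi> s + (1/n) * \<phi> y \<le> \<phi> t"
      using conc[of "1/n" s y] n st y by simp
    then have "n * ((1 - 1/n) * \<phi> s + (1/n) * \<phi> y) \<le> n * \<phi> t"
      using n by (intro mult_left_mono) auto
    moreover have "n * ((1 - 1/n) * \<phi> s + (1/n) * \<phi> y) = n * \<phi> s - \<phi> s + \<phi> y"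
      using n by (simp add: field_simps)
    ultimately have "n * d \<le> \<phi> s - \<phi> y" by (simp add: d_def algebra_simps)
    moreover have "n * d = \<phi> s + d" using d by (simp add: n_def field_simps)
    ultimately show False using d nn[OF y] by simp
  qed
  show "\<phi> t \<le> \<phi> 1 * (1 + t)" if "t \<ge> 0" for t
  proof (cases "t \<le> 1")
    case True
    have "\<phi> t \<le> \<phi> 1" using mono[of t 1] that True by simp
    also have "\<dots> \<le> \<phi> 1 * (1 + t)" using nn[of 1] that by (simp add: algebra_simps)
    finally show ?thesis .
  next
    case False
    \<comment> \<open>The point 1 is a convex combination of 0 and t with weight 1/t on t, so
      concavity bounds the value at t by t times the value at 1.\<close>
    have "(1 - 1/t) * \<phi> 0 + (1/t) * \<phi> t \<le> \<phi> 1"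
      using conc[of "1/t" 0 t] False by simp
    moreover have "(1 - 1/t) * \<phi> 0 \<ge> 0" using nn[of 0] False by simp
    ultimately have "(1/t) * \<phi> t \<le> \<phi> 1" by linarith
    then have "\<phi> t \<le> \<phi> 1 * t" using False by (simp add: field_simps)
    then show ?thesis using nn[of 1] by (simp add: algebra_simps)
  qed
qed

locale concave_modulus =
  fixes \<phi> :: "real \<Rightarrow> real"
  assumes cont: "continuous_on {0..} \<phi>"
    and nonneg: "\<And>t. t \<ge> 0 \<Longrightarrow> \<phi> t \<ge> 0"
    and pos: "\<And>t. t > 0 \<Longrightarrow> \<phi> t > 0"
    and conc: "concave_on {0..} \<phi>"
begin

lemma mono: "0 \<le> s \<Longrightarrow> s \<le> t \<Longrightarrow> \<phi> s \<le> \<phi> t"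
  by (rule concave_nonneg_mono[OF conc]) (auto intro: nonneg)

lemma linear_bound: "0 \<le> t \<Longrightarrow> \<phi> t \<le> \<phi> 1 * (1 + t)"
  by (rule concave_nonneg_linear_bound[OF conc]) (auto intro: nonneg)

lemma cont_sub: "S \<subseteq> {0..} \<Longrightarrow> continuous_on S \<phi>"
  using cont continuous_on_subset by blast

lemma integrable_sub: "0 \<le> a \<Longrightarrow> \<phi> integrable_on {a..b}"
  by (intro integrable_continuous_real cont_sub) auto

lemma Phi_0 [simp]: "Phi \<phi> 0 = 0"
  by (simp add: Phi_def)

lemma Phi_mono: "0 \<le> s \<Longrightarrow> s \<le> t \<Longrightarrow> Phi \<phi> s \<le> Phi \<phi> t"
  unfolding Phi_def by (intro integral_subset_le integrable_sub) (auto intro: nonneg)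

lemma Phi_nonneg: "0 \<le> t \<Longrightarrow> 0 \<le> Phi \<phi> t"
  using Phi_mono[of 0 t] by simp

lemma Phi_deriv:
  assumes "0 \<le> t" "t \<le> b"
  shows "(Phi \<phi> has_real_derivative \<phi> t) (at t within {0..b})"
  unfolding Phi_def using assms
  by (intro integral_has_real_derivative cont_sub) auto

lemma Phi_cont: "continuous_on {0..b} (Phi \<phi>)"
  using Phi_deriv by (intro DERIV_continuous_on) auto

text \<open>\<open>\<phi>\<close> may vanish at 0, so the lower bound is taken on the right half
  [t/2, t], where monotonicity keeps \<open>\<phi>\<close> above \<phi>(t/2) > 0.\<close>

lemma Phi_pos: "0 < t \<Longrightarrow> 0 < Phi \<phi> t"
proof -
  assume t: "0 < t"
  have "integral {t/2..t} (\<lambda>_. \<phi> (t/2)) \<le> integral {t/2..t} \<phi>"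
    using t by (intro integral_le integrable_sub) (auto intro: mono)
  also have "\<dots> \<le> Phi \<phi> t"
    unfolding Phi_def using t by (intro integral_subset_le integrable_sub) (auto intro: nonneg)
  finally have "t / 2 * \<phi> (t / 2) \<le> Phi \<phi> t" using t by simp
  moreover have "0 < t / 2 * \<phi> (t / 2)" using t pos[of "t/2"] by simp
  ultimately show ?thesis by linarith
qed

text \<open>Linear growth of \<open>\<phi>\<close> integrates to quadratic growth, so the square
  root in \<open>psi\<close> grows at most linearly; \<open>Psi_unbounded\<close> rests on
  this.\<close>

lemma Phi_quadratic: "0 \<le> t \<Longrightarrow> Phi \<phi> t \<le> \<phi> 1 * (1 + t)\<^sup>2"
proof -
  assume t: "0 \<le> t"
  have "Phi \<phi> t \<le> integral {0..t} (\<lambda>_. \<phi> 1 * (1 + t))"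
    unfolding Phi_def
  proof (intro integral_le integrable_sub)
    fix x assume "x \<in> {0..t}"
    then have "\<phi> x \<le> \<phi> 1 * (1 + x)" by (intro linear_bound) auto
    also have "\<dots> \<le> \<phi> 1 * (1 + t)" using \<open>x \<in> {0..t}\<close> nonneg[of 1] by (intro mult_left_mono) auto
    finally show "\<phi> x \<le> \<phi> 1 * (1 + t)" .
  qed auto
  also have "\<dots> = \<phi> 1 * (t * (1 + t))" using t by simp
  also have "\<dots> \<le> \<phi> 1 * (1 + t)\<^sup>2"
    using nonneg[of 1] t by (intro mult_left_mono) (auto simp: power2_eq_square algebra_simps)
  finally show ?thesis .
qed

end

locale Psi_modulus = concave_modulus +
  fixes \<delta> c :: real
  assumes \<delta>: "\<delta> > 0" and c: "c > 0"
begin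

definition psi :: "real \<Rightarrow> real" where
  "psi s = 1 / (\<delta> + sqrt (2 * c * Phi \<phi> s))"

lemma psi_pos: "0 \<le> s \<Longrightarrow> psi s > 0"
  unfolding psi_def using \<delta> c Phi_nonneg[of s] by (simp add: add_pos_nonneg)

lemma psi_cont: "continuous_on {0..b} psi"
proof -
  have "\<delta> + sqrt (2 * c * Phi \<phi> s) \<noteq> 0" if "0 \<le> s" for s
    using psi_pos[OF that] unfolding psi_def by auto
  then show ?thesis unfolding psi_def by (intro continuous_intros Phi_cont) auto
qed

lemma Psi_eq: "Psi \<phi> \<delta> c t = integral {0..t} psi"
  by (simp add: Psi_def psi_def[abs_def])

lemma Psi_0 [simp]: "Psi \<phi> \<delta> c 0 = 0"
  by (simp add: Psi_eq)

lemma Psi_deriv: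
  assumes "0 \<le> t" "t \<le> b"
  shows "(Psi \<phi> \<delta> c has_real_derivative psi t) (at t within {0..b})"
  unfolding Psi_eq[abs_def] using assms by (intro integral_has_real_derivative psi_cont) auto

lemma Psi_cont: "continuous_on {0..b} (Psi \<phi> \<delta> c)"
  using Psi_deriv by (intro DERIV_continuous_on) auto

lemma Psi_deriv_at:
  assumes "0 < t"
  shows "(Psi \<phi> \<delta> c has_real_derivative psi t) (at t)"
proof -
  have "(Psi \<phi> \<delta> c has_real_derivative psi t) (at t within {0<..<t+1})"
    by (rule DERIV_subset[OF Psi_deriv[of t "t+1"]]) (use assms in auto)
  then show ?thesis using assms by (simp add: at_within_open[of _ "{0<..<t+1}"])
qed

lemma Psi_strict_mono: "0 \<le> s \<Longrightarrow> s < t \<Longrightarrow> Psi \<phi> \<delta> c s < Psi \<phi> \<delta> c t"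
  by (rule DERIV_pos_imp_increasing_open)
     (auto intro!: exI[where x="psi _"] Psi_deriv_at psi_pos continuous_on_subset[OF Psi_cont[of t]])

lemma Psi_mono: "0 \<le> s \<Longrightarrow> s \<le> t \<Longrightarrow> Psi \<phi> \<delta> c s \<le> Psi \<phi> \<delta> c t"
  using Psi_strict_mono[of s t] by (cases "s = t") auto

text \<open>The linear growth of \<open>\<phi>\<close> makes \<open>psi\<close> decay at most like \<open>1 / (1 + s)\<close>.\<close>

lemma Psi_unbounded: "\<exists>t\<ge>0. Psi \<phi> \<delta> c t \<ge> y"
proof -
  define C where "C = \<delta> + sqrt (2 * c * \<phi> 1)"
  have C: "C > 0" unfolding C_def using \<delta> c nonneg[of 1] by (intro add_pos_nonneg) auto
  have lb: "1 / (C * (1 + s)) \<le> psi s" if s: "0 \<le> s" for s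
  proof -
    have "sqrt (2 * c * Phi \<phi> s) \<le> sqrt (2 * c * \<phi> 1 * (1 + s)\<^sup>2)"
      using Phi_quadratic[OF s] c by (intro real_sqrt_le_mono) (simp add: mult.assoc)
    also have "\<dots> = sqrt (2 * c * \<phi> 1) * (1 + s)" using s by (simp add: real_sqrt_mult)
    finally have "\<delta> + sqrt (2 * c * Phi \<phi> s) \<le> C * (1 + s)"
      unfolding C_def using s \<delta> by (simp add: algebra_simps add_increasing)
    then show ?thesis unfolding psi_def using psi_pos[OF s] s C
      by (intro divide_left_mono) (auto simp: psi_def zero_less_mult_iff zero_less_divide_iff)
  qed
  have "ln (1 + t) \<le> C * Psi \<phi> \<delta> c t" if t: "t \<ge> 0" for t
  proof -
    let ?g = "\<lambda>t. C * Psi \<phi> \<delta> c t - ln (1 + t)"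
    have "?g 0 \<le> ?g t"
    proof (rule DERIV_nonneg_imp_increasing_open[where f="?g"])
      fix x assume x: "0 < x" "x < t"
      have "(?g has_real_derivative (C * psi x - 1 / (1 + x))) (at x)"
        using x by (auto intro!: derivative_eq_intros Psi_deriv_at)
      moreover have "1 / (1 + x) \<le> C * psi x"
        using mult_left_mono[OF lb[of x], of C] x C by simp
      ultimately show "\<exists>y. (?g has_real_derivative y) (at x) \<and> 0 \<le> y" by force
    qed (use t in \<open>auto intro!: continuous_intros Psi_cont\<close>)
    then show ?thesis by simp
  qed
  \<comment> \<open>At this argument the logarithm equals \<open>\<bar>y\<bar> * C\<close>; the
    absolute value keeps the argument nonnegative when y is negative.\<close>
  from this[of "exp (\<bar>y\<bar> * C) - 1"] C have "Psi \<phi> \<delta> c (exp (\<bar>y\<bar> * C) - 1) \<ge> \<bar>y\<bar>"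
    by (simp add: mult.commute)
  then show ?thesis using C by (intro exI[of _ "exp (\<bar>y\<bar> * C) - 1"]) auto
qed

text \<open>\<open>Psi_inv\<close> is built with \<open>the_inv_into\<close> and means something
  only on the range of \<open>Psi\<close>. Unboundedness and the intermediate value theorem show
  that this range is the whole half-line.\<close>

lemma Psi_inv_props:
  assumes "y \<ge> 0"
  shows "Psi_inv \<phi> \<delta> c y \<ge> 0" "Psi \<phi> \<delta> c (Psi_inv \<phi> \<delta> c y) = y"
proof -
  obtain t where t: "t \<ge> 0" "Psi \<phi> \<delta> c t \<ge> y" using Psi_unbounded by blast
  obtain x where x: "0 \<le> x" "x \<le> t" "Psi \<phi> \<delta> c x = y"
    using IVT'[of "Psi \<phi> \<delta> c" 0 y t] t assms Psi_cont by auto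
  have inj: "inj_on (Psi \<phi> \<delta> c) {0..}"
  proof (rule inj_onI)
    fix u v assume "u \<in> {0..}" "v \<in> {0..}" and eq: "Psi \<phi> \<delta> c u = Psi \<phi> \<delta> c v"
    then show "u = v" using Psi_strict_mono[of u v] Psi_strict_mono[of v u] by (cases u v rule: linorder_cases) auto
  qed
  have "Psi_inv \<phi> \<delta> c y = x"
    unfolding Psi_inv_def by (rule the_inv_into_f_eq[OF inj]) (use x in auto)
  then show "Psi_inv \<phi> \<delta> c y \<ge> 0" "Psi \<phi> \<delta> c (Psi_inv \<phi> \<delta> c y) = y" using x by auto
qed

end

text \<open>
  The comparison functions solve \<open>R' = L R + L P0 + \<eta>\<close> and \<open>P0' = 2 \<phi>(W)\<close> with \<open>W \<le> R\<close>. Multiplying the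
  equation for \<open>U = exp (-L t) R'\<close> by \<open>U\<close> gives the energy inequality \<open>U\<^sup>2 \<le> \<delta>\<^sup>2 + 4 L \<Phi>(R)\<close>, which is then
  integrated through \<open>\<Psi>\<close>.
\<close>

lemma (in concave_modulus) second_order_gronwall:
  fixes T L \<eta> a b \<delta> :: real and qx qv :: "real \<Rightarrow> real"
  assumes L: "L \<ge> 1" and nn: "0 \<le> \<eta>" "0 \<le> a" "0 \<le> b" and dl: "0 < \<delta>" "L * (a + b) + \<eta> \<le> \<delta>"
    and q: "\<And>t. t \<in> {0..T} \<Longrightarrow> 0 \<le> qx t"
    and W: "continuous_on {0..T} W" "\<And>t. t \<in> {0..T} \<Longrightarrow> qx t \<le> W t"
    and W_le: "\<And>t. t \<in> {0..T} \<Longrightarrow>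
      W t \<le> a + integral {0..t} (\<lambda>s. L * W s + L * (b + integral {0..s} (\<lambda>r. 2 * \<phi> (W r))) + \<eta>)"
    and qv: "\<And>t. t \<in> {0..T} \<Longrightarrow> qv t \<le> b + integral {0..t} (\<lambda>s. 2 * \<phi> (W s))"
    and t: "t \<in> {0..T}"
  shows "\<exists>R\<ge>0. qx t \<le> R \<and> qv t \<le> exp (L * t) * (\<delta> + sqrt (4 * L * Phi \<phi> R)) \<and>
    Psi \<phi> \<delta> (2 * L) R \<le> Psi \<phi> \<delta> (2 * L) a + exp (L * t) - 1"
proof -
  interpret Psi_modulus \<phi> \<delta> "2 * L" using L dl by unfold_locales auto
  have W0: "0 \<le> W s" if "s \<in> {0..T}" for s using q[OF that] W(2)[OF that] by linarith
  have cW: "continuous_on {0..T} (\<lambda>s. 2 * \<phi> (W s))"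
    using W0 by (intro continuous_intros continuous_on_compose2[OF cont W(1)]) auto
  have oI: "at x within {0..T} = at x" if "0 < x" "x < T" for x
    using that by (intro at_within_interior) auto
  \<comment> \<open>The largest value that the hypothesis allows for \<open>qv\<close>. While
    \<open>W\<close> is only continuous, \<open>P0\<close> and \<open>W2\<close> are indefinite
    integrals and can be differentiated.\<close>
  define P0 where "P0 t = b + integral {0..t} (\<lambda>s. 2 * \<phi> (W s))" for t
  have dP0: "(P0 has_real_derivative 2 * \<phi> (W x)) (at x within {0..T})" if "x \<in> {0..T}" for x
    unfolding P0_def using DERIV_add[OF DERIV_const[of b] integral_has_real_derivative[OF cW that]] by simp
  have cP0: "continuous_on {0..T} P0" using dP0 by (intro DERIV_continuous_on)
  have P0: "0 \<le> P0 s" if "s \<in> {0..T}" for s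
  proof -
    have "0 \<le> integral {0..s} (\<lambda>s. 2 * \<phi> (W s))"
      using that W0 by (intro integral_nonneg integrable_continuous_real continuous_on_subset[OF cW])
        (auto intro!: nonneg)
    then show ?thesis using nn by (simp add: P0_def)
  qed
  define W2 where "W2 t = a + integral {0..t} (\<lambda>s. L * W s + L * P0 s + \<eta>)" for t
  have cW2i: "continuous_on {0..T} (\<lambda>s. L * W s + L * P0 s + \<eta>)"
    by (intro continuous_intros W cP0)
  have dW2: "(W2 has_real_derivative L * W x + L * P0 x + \<eta>) (at x within {0..T})" if "x \<in> {0..T}" for x
    unfolding W2_def using integral_has_real_derivative[OF cW2i that]
    by (auto intro!: derivative_eq_intros)
  have W2: "W s \<le> W2 s" if "s \<in> {0..T}" for s
    using W_le[OF that] by (simp add: W2_def P0_def)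
  \<comment> \<open>Variation of constants: \<open>R\<close> solves R' = L R + L P0 + \<eta> with
    R(0) = a, which is the equation of \<open>W2\<close> with \<open>W\<close> replaced by the
    unknown itself.\<close>
  define Ri where "Ri t = integral {0..t} (\<lambda>s. exp (- L * s) * (L * P0 s + \<eta>))" for t
  define R where "R t = exp (L * t) * (a + Ri t)" for t
  have cRi: "continuous_on {0..T} (\<lambda>s. exp (- L * s) * (L * P0 s + \<eta>))"
    by (intro continuous_intros cP0)
  have dRi: "(Ri has_real_derivative exp (- L * x) * (L * P0 x + \<eta>)) (at x within {0..T})"
    if "x \<in> {0..T}" for x
    unfolding Ri_def by (rule integral_has_real_derivative[OF cRi that])
  define S where "S t = L * R t + L * P0 t + \<eta>" for t
  have dR: "(R has_real_derivative S x) (at x within {0..T})" if "x \<in> {0..T}" for x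
  proof -
    have "(R has_real_derivative (exp (L * x) * L * (a + Ri x) +
        exp (L * x) * (exp (- L * x) * (L * P0 x + \<eta>)))) (at x within {0..T})"
      unfolding R_def by (auto intro!: derivative_eq_intros dRi that)
    moreover have "exp (L * x) * (exp (- L * x) * (L * P0 x + \<eta>)) = L * P0 x + \<eta>"
      by (simp add: exp_minus field_simps)
    ultimately show ?thesis by (simp add: S_def R_def algebra_simps)
  qed
  have Ri: "0 \<le> Ri s" if "s \<in> {0..T}" for s
    unfolding Ri_def using that P0 L nn
    by (intro integral_nonneg integrable_continuous_real continuous_on_subset[OF cRi]) auto
  have R0: "0 \<le> R s" if "s \<in> {0..T}" for s using Ri[OF that] nn by (simp add: R_def)
  have R_at_0: "R 0 = a" "P0 0 = b" "W2 0 = a" by (auto simp: R_def Ri_def P0_def W2_def)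
  have S0: "P0 s \<le> S s" "0 \<le> S s" if "s \<in> {0..T}" for s
  proof -
    \<comment> \<open>This is where L \<ge> 1 turns a bound on \<open>S\<close> into one on
      \<open>qv\<close>: qv \<le> P0 \<le> L P0 \<le> S.\<close>
    have "P0 s \<le> L * P0 s" using P0[OF that] L by (simp add: mult_le_cancel_right1)
    moreover have "0 \<le> L * R s" using R0[OF that] L by simp
    ultimately show "P0 s \<le> S s" "0 \<le> S s" using nn P0[OF that] by (auto simp: S_def)
  qed
  have cR: "continuous_on {0..T} R" using dR by (intro DERIV_continuous_on)
  have cont_s: "continuous_on {0..s} g" if "continuous_on {0..T} g" "s \<in> {0..T}" for s and g :: "real \<Rightarrow> real"
    using that continuous_on_subset by fastforce
  have cPR: "continuous_on {0..T} (\<lambda>x. G (R x))"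
    if "\<And>b. continuous_on {0..b} G" for G :: "real \<Rightarrow> real"
  proof -
    obtain B where "\<And>x. x \<in> {0..T} \<Longrightarrow> R x \<le> B"
      using continuous_attains_sup[of "{0..T}" R] cR t by (metis compact_Icc empty_iff)
    moreover have "R ` {0..T} \<subseteq> {0..}" using R0 by blast
    ultimately show ?thesis
      by (intro continuous_on_compose2[OF that[of B] cR]) (auto simp: image_subset_iff)
  qed
  have W2R: "W2 s \<le> R s" if s: "s \<in> {0..T}" for s
  proof -
    \<comment> \<open>In R' - W2' the terms in \<open>P0\<close> and \<eta> cancel, and the
      integrating factor leaves a positive multiple of W2 - W \<ge> 0: Gronwall's argument as a
      monotonicity statement.\<close>
    let ?H = "\<lambda>t. exp (- L * t) * (R t - W2 t)"
    have dH: "(?H has_real_derivative exp (- L * x) * (L * (W2 x - W x))) (at x within {0..T})"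
      if "x \<in> {0..T}" for x
      by (rule derivative_eq_intros dR dW2 that refl)+ (simp add: S_def algebra_simps)
    have "?H 0 \<le> ?H s"
    proof (rule DERIV_nonneg_imp_increasing_open[where f="?H"])
      fix x assume x: "0 < x" "x < s"
      then have x': "x \<in> {0..T}" "x < T" using s by auto
      show "\<exists>y. (?H has_real_derivative y) (at x) \<and> 0 \<le> y"
        using dH[OF x'(1)] W2[OF x'(1)] L oI[OF x(1) x'(2)] by (intro exI[of _ "exp (- L * x) * (L * (W2 x - W x))"]) auto
    qed (use s cont_s[OF DERIV_continuous_on[OF dH] s] in auto)
    then have "0 \<le> exp (- L * s) * (R s - W2 s)" by (simp add: R_at_0)
    then show ?thesis by (simp add: zero_le_mult_iff not_le[symmetric])
  qed
  have WR: "W s \<le> R s" if "s \<in> {0..T}" for s using W2[OF that] W2R[OF that] by linarith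
  \<comment> \<open>The factor exp(-L t) removes the linear term: S' = L S + 2 L \<phi>(W), so U'
    retains only the forcing by \<phi>(W).\<close>
  define U where "U t = exp (- L * t) * S t" for t
  have dU: "(U has_real_derivative exp (- L * x) * (L * (2 * \<phi> (W x)))) (at x within {0..T})"
    if "x \<in> {0..T}" for x
    unfolding U_def S_def
    by (rule derivative_eq_intros dR dP0 that refl)+ (simp add: S_def algebra_simps)
  have energy: "U s \<le> \<delta> + sqrt (4 * L * Phi \<phi> (R s))" if s: "s \<in> {0..T}" for s
  proof -
    \<comment> \<open>Its derivative 4 L S (\<phi>(R) - exp(-2 L x) \<phi>(W)) is nonnegative since
      W \<le> R and \<open>\<phi>\<close> is increasing. The initial energy is controlled by U(0) =
      L (a + b) + \<eta> \<le> \<delta>, which is the role of the \<open>\<delta>\<close> inside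
      \<open>psi\<close>.\<close>
    let ?J = "\<lambda>t. 4 * L * Phi \<phi> (R t) - (U t)\<^sup>2"
    have "?J 0 \<le> ?J s"
    proof (rule DERIV_nonneg_imp_increasing_open[where f="?J"])
      fix x assume x: "0 < x" "x < s"
      then have x': "x \<in> {0..T}" "x < T" using s by auto
      have PhiR: "((\<lambda>t. Phi \<phi> (R t)) has_real_derivative \<phi> (R x) * S x) (at x within {0..T})"
      proof -
        obtain B where B: "\<And>x. x \<in> {0..T} \<Longrightarrow> R x \<le> B"
          using continuous_attains_sup[of "{0..T}" R] cR t by (metis compact_Icc empty_iff)
        \<comment> \<open>\<open>R\<close> can take the value 0, where the derivative of
          \<open>Phi\<close> is known from the right only; the chain rule is therefore used relative
          to the range of \<open>R\<close>.\<close>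
        have "(Phi \<phi> has_real_derivative \<phi> (R x)) (at (R x) within R ` {0..T})"
          by (rule DERIV_subset[OF Phi_deriv[of "R x" B]]) (use R0 B x' in auto)
        from DERIV_image_chain[OF this dR[OF x'(1)]] show ?thesis by (simp add: o_def)
      qed
      have "(?J has_real_derivative 4 * L * (\<phi> (R x) * S x) - 2 * U x * (exp (- L * x) * (L * (2 * \<phi> (W x)))))
         (at x within {0..T})"
        by (rule derivative_eq_intros PhiR dU x' refl)+ (simp add: algebra_simps)
      moreover have "0 \<le> 4 * L * (\<phi> (R x) * S x) - 2 * U x * (exp (- L * x) * (L * (2 * \<phi> (W x))))"
      proof -
        have e: "exp (- L * x) * exp (- L * x) \<le> 1" using L x by (simp flip: exp_add)
        have "exp (- L * x) * exp (- L * x) * \<phi> (W x) \<le> 1 * \<phi> (R x)"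
          using e mono[OF W0 WR, OF x'(1) x'(1)] nonneg[OF W0[OF x'(1)]] by (intro mult_mono) auto
        then have "4 * L * S x * (exp (- L * x) * exp (- L * x) * \<phi> (W x)) \<le> 4 * L * S x * \<phi> (R x)"
          using L S0(2)[OF x'(1)] by (intro mult_left_mono) auto
        then show ?thesis by (simp add: U_def algebra_simps)
      qed
      ultimately show "\<exists>y. (?J has_real_derivative y) (at x) \<and> 0 \<le> y" using oI[OF x(1) x'(2)] by auto
    qed (use s in \<open>auto intro!: continuous_intros cont_s[OF cPR[OF Phi_cont] s]
        cont_s[OF DERIV_continuous_on[OF dU] s]\<close>)
    then have "(U s)\<^sup>2 \<le> 4 * L * Phi \<phi> (R s) + (U 0)\<^sup>2 - 4 * L * Phi \<phi> a" by (simp add: R_at_0)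
    also have "\<dots> \<le> 4 * L * Phi \<phi> (R s) + \<delta>\<^sup>2"
    proof -
      have "U 0 = L * (a + b) + \<eta>" by (simp add: U_def S_def R_at_0 algebra_simps)
      then have "(U 0)\<^sup>2 \<le> \<delta>\<^sup>2" using dl nn L by (intro power_mono) auto
      moreover have "0 \<le> 4 * L * Phi \<phi> a" using L Phi_nonneg[OF nn(2)] by simp
      ultimately show ?thesis by linarith
    qed
    also have "\<dots> \<le> (\<delta> + sqrt (4 * L * Phi \<phi> (R s)))\<^sup>2"
      using L Phi_nonneg[OF R0[OF s]] \<delta> by (simp add: power2_sum)
    finally show ?thesis using \<delta> L Phi_nonneg[OF R0[OF s]] by (intro power2_le_imp_le[of "U s"]) auto
  qed
  \<comment> \<open>The energy bound says psi(R) U \<le> 1, hence the derivative of Psi(R) is exp(L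
    x) psi(R) U \<le> exp(L x) \<le> L exp(L x). The last expression is the derivative of exp(L x)
    and produces the term exp(L t) - 1 of the theorem.\<close>
  have "exp (L * 0) - Psi \<phi> \<delta> (2 * L) (R 0) \<le> exp (L * t) - Psi \<phi> \<delta> (2 * L) (R t)"
  proof (rule DERIV_nonneg_imp_increasing_open[where f="\<lambda>t. exp (L * t) - Psi \<phi> \<delta> (2 * L) (R t)"])
    fix x assume x: "0 < x" "x < t"
    then have x': "x \<in> {0..T}" "x < T" using t by auto
    obtain B where B: "\<And>x. x \<in> {0..T} \<Longrightarrow> R x \<le> B"
      using continuous_attains_sup[of "{0..T}" R] cR t by (metis compact_Icc empty_iff)
    have "(Psi \<phi> \<delta> (2 * L) has_real_derivative psi (R x)) (at (R x) within R ` {0..T})"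
      by (rule DERIV_subset[OF Psi_deriv[of "R x" B]]) (use R0 B x' in auto)
    from DERIV_image_chain[OF this dR[OF x'(1)]]
    have PsiR: "((\<lambda>t. Psi \<phi> \<delta> (2 * L) (R t)) has_real_derivative psi (R x) * S x) (at x within {0..T})"
      by (simp add: o_def)
    have "((\<lambda>t. exp (L * t) - Psi \<phi> \<delta> (2 * L) (R t)) has_real_derivative
        exp (L * x) * L - psi (R x) * S x) (at x within {0..T})"
      by (rule derivative_eq_intros PsiR refl)+ simp
    moreover have "psi (R x) * S x \<le> exp (L * x) * L"
    proof -
      have p: "0 < psi (R x)" by (intro psi_pos R0 x')
      have "psi (R x) * U x \<le> psi (R x) * (\<delta> + sqrt (4 * L * Phi \<phi> (R x)))"
        using energy[OF x'(1)] p by (intro mult_left_mono) auto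
      also have "\<dots> = 1" using p by (auto simp: psi_def)
      finally have "exp (L * x) * (psi (R x) * U x) \<le> exp (L * x) * L" using L by (intro mult_left_mono) auto
      moreover have "exp (L * x) * (psi (R x) * U x) = psi (R x) * S x"
        by (simp add: U_def exp_minus field_simps)
      ultimately show ?thesis by simp
    qed
    ultimately show "\<exists>y. ((\<lambda>t. exp (L * t) - Psi \<phi> \<delta> (2 * L) (R t)) has_real_derivative y) (at x) \<and> 0 \<le> y"
      using oI[OF x(1) x'(2)] by auto
  qed (use t in \<open>auto intro!: continuous_intros cont_s[OF cPR[OF Psi_cont] t]\<close>)
  then have "Psi \<phi> \<delta> (2 * L) (R t) \<le> Psi \<phi> \<delta> (2 * L) a + exp (L * t) - 1" by (simp add: R_at_0)
  moreover have "qx t \<le> R t" using W(2)[OF t] WR[OF t] by linarith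
  moreover have "qv t \<le> exp (L * t) * (\<delta> + sqrt (4 * L * Phi \<phi> (R t)))"
  proof -
    have "qv t \<le> S t" using qv[OF t] S0(1)[OF t] by (simp add: P0_def)
    also have "\<dots> = exp (L * t) * U t" by (simp add: U_def exp_minus field_simps)
    also have "\<dots> \<le> exp (L * t) * (\<delta> + sqrt (4 * L * Phi \<phi> (R t)))" using energy[OF t] by simp
    finally show ?thesis .
  qed
  ultimately show ?thesis using R0[OF t] by blast
qed

section \<open>Consequences of the divergence of the integral of 1 / sqrt \<Phi>\<close>

text \<open>A value p = \<phi>(0) > 0 would give \<Phi>(t) \<ge> p t, and 1 / sqrt (p t) is
  integrable at 0. The conclusion lets the errors at nearby points vanish in
  \<open>ae_uniform_modulus\<close>.\<close>

lemma (in concave_modulus) osgood_imp_zero: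
  assumes "osgood_sqrt \<phi>"
  shows "\<phi> 0 = 0"
proof (rule ccontr)
  assume "\<phi> 0 \<noteq> 0"
  define p where "p = \<phi> 0"
  have p: "p > 0" using \<open>\<phi> 0 \<noteq> 0\<close> nonneg[of 0] by (simp add: p_def)
  have lb: "p * t \<le> Phi \<phi> t" if "0 \<le> t" for t
  proof -
    have "integral {0..t} (\<lambda>_. p) \<le> integral {0..t} \<phi>"
      by (intro integral_le integrable_sub) (auto simp: p_def intro: mono)
    then show ?thesis using that by (simp add: Phi_def mult.commute)
  qed
  let ?g = "\<lambda>t. 1 / sqrt (p * t)"
  have "(?g has_integral 2 * sqrt 1 / sqrt p - 2 * sqrt 0 / sqrt p) {0..1}"
  \<comment> \<open>Differentiability is demanded in the open interval only, as the square root has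
    no derivative at 0.\<close>
  proof (rule fundamental_theorem_of_calculus_interior)
    fix x :: real assume x: "x \<in> {0<..<1}"
    have "((\<lambda>t. 2 * sqrt t / sqrt p) has_real_derivative ?g x) (at x)"
      using x p by (auto intro!: derivative_eq_intros simp: real_sqrt_mult field_simps)
    then show "((\<lambda>t. 2 * sqrt t / sqrt p) has_vector_derivative ?g x) (at x)"
      by (simp add: has_real_derivative_iff_has_vector_derivative)
  qed (auto intro!: continuous_intros simp: p less_imp_neq[OF p, symmetric])
  then have fin: "(\<integral>\<^sup>+t. indicator {0..1} t * ennreal (?g t) \<partial>lborel) < \<infinity>"
    using nn_integral_has_integral_lebesgue[of "{0..1}" ?g] p by (auto simp: ennreal_mult'[symmetric] ennreal_indicator[symmetric])
  have "(\<integral>\<^sup>+t\<in>{0<..1}. ennreal (1 / sqrt (Phi \<phi> t)) \<partial>lebesgue) =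
      (\<integral>\<^sup>+t\<in>{0<..1}. ennreal (1 / sqrt (Phi \<phi> t)) \<partial>lborel)"
    by (rule nn_integral_completion)
  also have "\<dots> \<le> (\<integral>\<^sup>+t. indicator {0..1} t * ennreal (?g t) \<partial>lborel)"
    using lb p by (intro nn_integral_mono)
      (auto split: split_indicator intro!: ennreal_leI divide_left_mono mult_pos_pos Phi_pos)
  finally show False using fin assms unfolding osgood_sqrt_def by (metis zero_less_one leD)
qed

text \<open>As \<delta> decreases to 0 the integrands of \<open>Psi\<close> increase to 1 / sqrt (2
  c \<Phi>), whose integral near 0 diverges; monotone convergence then makes \<open>Psi\<close> at
  \<epsilon> exceed any \<open>M\<close>. In \<open>uniqueness\<close> this keeps the comparison
  function below \<epsilon>.\<close>

lemma (in concave_modulus) osgood_Psi_unbounded: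
  assumes "osgood_sqrt \<phi>" "\<epsilon> > 0" "c > 0"
  shows "\<exists>\<delta>>0. \<delta> \<le> \<epsilon> \<and> Psi \<phi> \<delta> c \<epsilon> > M"
proof (rule ccontr)
  assume not: "\<not> ?thesis"
  \<comment> \<open>A sequence decreasing to 0 that starts at \<epsilon>, so every term is an
    admissible \<delta>. If the claim failed, all the integrals below would be bounded by
    \<open>M\<close>.\<close>
  define d where "d n = \<epsilon> / real (Suc n)" for n
  have d: "d n > 0" "d n \<le> \<epsilon>" for n using assms by (auto simp: d_def field_simps)
  let ?h = "\<lambda>n s. ennreal (1 / (d n + sqrt (2 * c * Phi \<phi> s)))"
  have sq: "0 \<le> sqrt (2 * c * Phi \<phi> s)" if "0 \<le> s" for s using Phi_nonneg[OF that] assms by simp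
  have eq: "(\<integral>\<^sup>+s. indicator {0..\<epsilon>} s * ?h n s \<partial>lborel) = ennreal (Psi \<phi> (d n) c \<epsilon>)" for n
  proof -
    interpret Psi_modulus \<phi> "d n" c using d assms by unfold_locales auto
    have "(psi has_integral Psi \<phi> (d n) c \<epsilon>) {0..\<epsilon>}"
      unfolding Psi_eq by (intro integrable_integral integrable_continuous_real psi_cont)
    then show ?thesis
      using nn_integral_has_integral_lebesgue[of "{0..\<epsilon>}" psi] psi_pos
      by (simp add: psi_def[symmetric] ennreal_mult'[symmetric] ennreal_indicator[symmetric] less_imp_le)
  qed
  have meas: "(\<lambda>s. indicator {0..\<epsilon>} s * ?h n s) \<in> borel_measurable lborel" for n
  proof -
    interpret Psi_modulus \<phi> "d n" c using d assms by unfold_locales auto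
    have "(\<lambda>s. indicator {0..\<epsilon>} s *\<^sub>R psi s) \<in> borel_measurable lborel"
      using borel_measurable_continuous_on_indicator[OF _ psi_cont] by simp
    then have "(\<lambda>s. ennreal (indicator {0..\<epsilon>} s *\<^sub>R psi s)) \<in> borel_measurable lborel" by measurable
    moreover have "(\<lambda>s. ennreal (indicator {0..\<epsilon>} s *\<^sub>R psi s)) = (\<lambda>s. indicator {0..\<epsilon>} s * ?h n s)"
      by (auto simp: psi_def split: split_indicator)
    ultimately show ?thesis by simp
  qed
  have inc: "incseq (\<lambda>n s. indicator {0..\<epsilon>} s * ?h n s)"
  proof (intro incseq_SucI le_funI)
    fix n s
    have "?h n s \<le> ?h (Suc n) s" if "s \<in> {0..\<epsilon>}"
      using sq[of s] that d assms
      by (intro ennreal_leI divide_left_mono mult_pos_pos add_pos_nonneg add_right_mono)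
         (auto simp: d_def field_simps)
    then show "indicator {0..\<epsilon>} s * ?h n s \<le> indicator {0..\<epsilon>} s * ?h (Suc n) s"
      by (auto split: split_indicator)
  qed
  have "\<infinity> = ennreal (1 / sqrt (2 * c)) * (\<integral>\<^sup>+t\<in>{0<..\<epsilon>}. ennreal (1 / sqrt (Phi \<phi> t)) \<partial>lebesgue)"
    using assms unfolding osgood_sqrt_def by (simp add: ennreal_mult_top)
  also have "\<dots> = (\<integral>\<^sup>+t\<in>{0<..\<epsilon>}. ennreal (1 / sqrt (2 * c)) * ennreal (1 / sqrt (Phi \<phi> t)) \<partial>lborel)"
  proof -
    have "(\<lambda>t. indicator {0<..\<epsilon>} t *\<^sub>R (1 / sqrt (Phi \<phi> t))) \<in> borel_measurable borel"
      by (intro borel_measurable_continuous_on_indicator continuous_intros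
          continuous_on_subset[OF Phi_cont[of \<epsilon>]])
        (use Phi_pos in \<open>auto simp: less_imp_neq[symmetric]\<close>)
    then have "(\<lambda>t. ennreal (indicator {0<..\<epsilon>} t *\<^sub>R (1 / sqrt (Phi \<phi> t)))) \<in> borel_measurable lborel"
      by measurable
    moreover have "(\<lambda>t. ennreal (indicator {0<..\<epsilon>} t *\<^sub>R (1 / sqrt (Phi \<phi> t)))) =
        (\<lambda>t. ennreal (1 / sqrt (Phi \<phi> t)) * indicator {0<..\<epsilon>} t)"
      by (auto split: split_indicator)
    ultimately show ?thesis
      by (simp add: nn_integral_completion nn_integral_cmult[symmetric] mult.assoc)
  qed
  also have "\<dots> \<le> (\<integral>\<^sup>+s. (SUP n. indicator {0..\<epsilon>} s * ?h n s) \<partial>lborel)"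
  proof (intro nn_integral_mono)
    fix s
    have "ennreal (1 / sqrt (2 * c)) * ennreal (1 / sqrt (Phi \<phi> s)) \<le> (SUP n. ?h n s)" if s: "s \<in> {0<..\<epsilon>}"
    proof -
      have p: "sqrt (2 * c * Phi \<phi> s) > 0" using s Phi_pos[of s] assms by simp
      have "(\<lambda>n. d n) \<longlonglongrightarrow> 0" unfolding d_def
        using tendsto_mult[OF tendsto_const[of \<epsilon>] LIMSEQ_inverse_real_of_nat] by (simp add: divide_inverse)
      then have "(\<lambda>n. 1 / (d n + sqrt (2 * c * Phi \<phi> s))) \<longlonglongrightarrow> 1 / (0 + sqrt (2 * c * Phi \<phi> s))"
        using p by (intro tendsto_intros) auto
      then have "(\<lambda>n. ?h n s) \<longlonglongrightarrow> ennreal (1 / sqrt (2 * c * Phi \<phi> s))"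
        by (intro tendsto_ennrealI) simp
      then have "ennreal (1 / sqrt (2 * c * Phi \<phi> s)) \<le> (SUP n. ?h n s)"
        by (rule LIMSEQ_le_const2) (intro exI allI impI SUP_upper, simp)
      then show ?thesis using assms by (simp add: ennreal_mult'[symmetric] real_sqrt_mult)
    qed
    then show "ennreal (1 / sqrt (2 * c)) * ennreal (1 / sqrt (Phi \<phi> s)) * indicator {0<..\<epsilon>} s
        \<le> (SUP n. indicator {0..\<epsilon>} s * ?h n s)"
      by (auto split: split_indicator)
  qed
  also have "\<dots> = (SUP n. ennreal (Psi \<phi> (d n) c \<epsilon>))"
    using nn_integral_monotone_convergence_SUP[OF inc meas] by (simp add: eq)
  also have "\<dots> \<le> ennreal M"
  proof (rule SUP_least)
    fix n show "ennreal (Psi \<phi> (d n) c \<epsilon>) \<le> ennreal M"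
      using not d[of n] by (intro ennreal_leI) (meson not_less)
  qed
  finally show False by (simp add: top_unique)
qed

section \<open>Measurability and Jensen's inequality for the modulus\<close>

context concave_modulus
begin

text \<open>\<open>\<phi>\<close> is controlled on the half-line only; composing it with
  \<open>max 0\<close> yields a function continuous on the whole line, to which measurability and
  limit rules apply.\<close>

lemma phi_max_cont: "continuous_on UNIV (\<lambda>x. \<phi> (max 0 x))"
  by (intro continuous_on_compose2[OF cont] continuous_intros) auto

lemma phi_max_meas [measurable]: "(\<lambda>x. \<phi> (max 0 x)) \<in> borel_measurable borel"
  by (rule borel_measurable_continuous_onI[OF phi_max_cont])

lemma phi_meas [measurable (raw)]:
  assumes [measurable]: "X \<in> borel_measurable M" and "\<And>x. 0 \<le> X x"
  shows "(\<lambda>x. \<phi> (X x)) \<in> borel_measurable M"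
proof -
  have "(\<lambda>x. \<phi> (max 0 (X x))) \<in> borel_measurable M" by measurable
  then show ?thesis using assms(2) by (simp add: max_def)
qed

text \<open>The library version of Jensen's inequality needs an open interval, hence the shift by \<open>\<epsilon>\<close>.\<close>

lemma nn_jensen:
  assumes "prob_space M" and X[measurable]: "X \<in> borel_measurable M" and nn: "\<And>x. 0 \<le> X x"
    and m: "0 \<le> m" "(\<integral>\<^sup>+x. ennreal (X x) \<partial>M) \<le> ennreal m"
  shows "(\<integral>\<^sup>+x. ennreal (\<phi> (X x)) \<partial>M) \<le> ennreal (\<phi> m)"
proof -
  interpret prob_space M by fact
  have iX: "integrable M X"
    using m nn by (intro integrableI_nonneg) (auto simp: le_less_trans)
  have eX: "expectation X \<le> m"
    using nn_integral_eq_integral[OF iX] nn m by (simp add: ennreal_le_iff)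
  have eX0: "0 \<le> expectation X" using nn by simp
  have le: "(\<integral>\<^sup>+x. ennreal (\<phi> (X x)) \<partial>M) \<le> ennreal (\<phi> (m + \<epsilon>))" if e: "\<epsilon> > 0" for \<epsilon>
  proof -
    have iphi: "integrable M (\<lambda>x. \<phi> (X x + \<epsilon>))"
    proof (rule Bochner_Integration.integrable_bound)
      show "integrable M (\<lambda>x. \<phi> 1 * (1 + (X x + \<epsilon>)))" using iX by simp
      show "(\<lambda>x. \<phi> (X x + \<epsilon>)) \<in> borel_measurable M" using nn e by (intro phi_meas) auto
      show "AE x in M. norm (\<phi> (X x + \<epsilon>)) \<le> norm (\<phi> 1 * (1 + (X x + \<epsilon>)))"
        using nn e nonneg linear_bound by (intro AE_I2) (smt (verit) real_norm_def)
    qed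
    have "- \<phi> (expectation (\<lambda>x. X x + \<epsilon>)) \<le> expectation (\<lambda>x. - \<phi> (X x + \<epsilon>))"
    proof (rule jensens_inequality[where I = "{0<..}"])
      show "convex_on {0<..} (\<lambda>x. - \<phi> x)"
        using conc unfolding concave_on_def by (rule convex_on_subset) auto
    qed (use iX iphi nn e in \<open>auto intro!: AE_I2 add_nonneg_pos\<close>)
    then have "expectation (\<lambda>x. \<phi> (X x + \<epsilon>)) \<le> \<phi> (expectation X + \<epsilon>)"
      using iX by (simp add: prob_space)
    also have "\<dots> \<le> \<phi> (m + \<epsilon>)" using eX eX0 e by (intro mono) auto
    finally have 1: "expectation (\<lambda>x. \<phi> (X x + \<epsilon>)) \<le> \<phi> (m + \<epsilon>)" .
    have "(\<integral>\<^sup>+x. ennreal (\<phi> (X x)) \<partial>M) \<le> (\<integral>\<^sup>+x. ennreal (\<phi> (X x + \<epsilon>)) \<partial>M)"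
      using nn e by (intro nn_integral_mono ennreal_leI mono) auto
    also have "\<dots> = ennreal (expectation (\<lambda>x. \<phi> (X x + \<epsilon>)))"
      using nn e by (intro nn_integral_eq_integral iphi AE_I2 nonneg) (simp add: add_nonneg_nonneg)
    also have "\<dots> \<le> ennreal (\<phi> (m + \<epsilon>))" using 1 by (rule ennreal_leI)
    finally show ?thesis .
  qed
  have "(\<lambda>n. \<phi> (max 0 (m + inverse (real (Suc n))))) \<longlonglongrightarrow> \<phi> (max 0 (m + 0))"
    by (intro continuous_on_tendsto_compose[OF phi_max_cont] tendsto_intros LIMSEQ_inverse_real_of_nat)
      auto
  moreover have "max 0 (m + inverse (real (Suc n))) = m + inverse (real (Suc n))" for n
    using m by (simp add: add_nonneg_nonneg max_def)
  ultimately have "(\<lambda>n. \<phi> (m + inverse (real (Suc n)))) \<longlonglongrightarrow> \<phi> m" using m by (simp add: max_def)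
  then have "(\<lambda>n. ennreal (\<phi> (m + inverse (real (Suc n))))) \<longlonglongrightarrow> ennreal (\<phi> m)"
    by (rule tendsto_ennrealI)
  then show ?thesis by (rule LIMSEQ_le_const) (intro exI allI impI le, simp)
qed

end

section \<open>Coupled flows on a probability space\<close>

lemma fst_borel [measurable]: "(fst :: 'a::euclidean_space \<times> 'b::euclidean_space \<Rightarrow> 'a) \<in> borel_measurable borel"
  and snd_borel [measurable]: "(snd :: 'a::euclidean_space \<times> 'b::euclidean_space \<Rightarrow> 'b) \<in> borel_measurable borel"
  by (auto simp: borel_prod[symmetric])

text \<open>This is how exceptional sets of points disappear: an absolutely continuous law gives no
  mass to Lebesgue null sets, so a property of almost every point holds almost surely along
  \<open>Y\<close>.\<close>

lemma AE_law:
  assumes "absolutely_continuous lborel (distr P borel Y)" "Y \<in> borel_measurable P"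
    and "AE x in lborel. Q x"
  shows "AE \<omega> in P. Q (Y \<omega>)"
  by (rule AE_distrD[OF assms(2)], rule absolutely_continuous_AE[OF _ assms(1,3)]) simp

text \<open>A null set contains no ball, hence its complement is dense and, by separability, has a
  countable dense subset. Countability lets almost-everywhere statements indexed by \<open>D\<close>
  share one null set.\<close>

lemma countable_dense_off_null:
  fixes N :: "'a::euclidean_space set"
  assumes "N \<in> null_sets lborel"
  obtains D where "countable D" "D \<inter> N = {}" "closure D = UNIV"
proof -
  obtain D where D: "countable D" "D \<subseteq> - N" "- N \<subseteq> closure D" using separable[of "- N"] by blast
  have "x \<in> closure (- N)" for x
    unfolding closure_approachable
  proof (intro allI impI)
    fix e :: real assume e: "e > 0"
    have "\<not> ball x e \<subseteq> N"
    proof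
      assume "ball x e \<subseteq> N"
      then have "emeasure lborel (ball x e) \<le> emeasure lborel N"
        using assms by (intro emeasure_mono) auto
      then have "measure lborel (ball x e) = 0" using assms by (simp add: measure_def null_setsD1)
      then show False using content_ball_pos[OF e, of x] by simp
    qed
    then show "\<exists>y\<in>- N. dist y x < e" by (auto simp: dist_commute)
  qed
  then have "closure D = UNIV" using closure_minimal[OF D(3)] by auto
  then show ?thesis using that D by auto
qed

text \<open>
  An estimate that holds for every pair of points outside a null set, but whose exceptional set of times
  depends on that pair, holds at almost every time for all pairs in a set of full measure. This uses a
  countable dense set of intermediate points and \<open>\<phi> 0 = 0\<close>.
\<close>

lemma ae_uniform_modulus:
  fixes h :: "real \<Rightarrow> 'a::euclidean_space \<Rightarrow> 'c \<Rightarrow> 'b::euclidean_space"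
  assumes "sigma_finite_measure m"
    and h[measurable]: "(\<lambda>(t, x, \<zeta>). h t x \<zeta>) \<in> borel_measurable (borel \<Otimes>\<^sub>M borel \<Otimes>\<^sub>M m)"
    and S[measurable]: "S \<in> sets borel" and N: "N \<in> null_sets lborel"
    and \<phi>: "continuous_on {0..} \<phi>" "\<phi> 0 = 0" "\<And>s. 0 \<le> s \<Longrightarrow> 0 \<le> \<phi> s"
    and bd: "\<And>x y. x \<notin> N \<Longrightarrow> y \<notin> N \<Longrightarrow> AE t in lborel. t \<in> S \<longrightarrow>
      (\<integral>\<^sup>+\<zeta>. ennreal (norm (h t x \<zeta> - h t y \<zeta>)) \<partial>m) \<le> ennreal (\<phi> (norm (x - y)))"
  shows "AE t in lborel. t \<in> S \<longrightarrow> (\<exists>A. (AE x in lborel. x \<in> A) \<and>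
    (\<forall>x\<in>A. \<forall>y\<in>A. (\<integral>\<^sup>+\<zeta>. ennreal (norm (h t x \<zeta> - h t y \<zeta>)) \<partial>m) \<le> ennreal (\<phi> (norm (x - y)))))"
proof -
  interpret sigma_finite_measure m by fact
  obtain D where D: "countable D" "D \<inter> N = {}" "closure D = UNIV"
    using countable_dense_off_null[OF N] .
  define H where "H t x y = (\<integral>\<^sup>+\<zeta>. ennreal (norm (h t x \<zeta> - h t y \<zeta>)) \<partial>m)" for t x y
  have H_tri: "H t x y \<le> H t x z + H t y z" for t x y z
  proof -
    have [measurable]: "(\<lambda>\<zeta>. h t x \<zeta>) \<in> borel_measurable m" for t x
      using measurable_compose[OF _ h, of "\<lambda>\<zeta>. (t, x, \<zeta>)" m] by simp
    have "H t x y \<le> (\<integral>\<^sup>+\<zeta>. ennreal (norm (h t x \<zeta> - h t z \<zeta>)) + ennreal (norm (h t y \<zeta> - h t z \<zeta>)) \<partial>m)"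
      unfolding H_def
    proof (intro nn_integral_mono)
      fix \<zeta>
      show "ennreal (norm (h t x \<zeta> - h t y \<zeta>)) \<le> ennreal (norm (h t x \<zeta> - h t z \<zeta>)) + ennreal (norm (h t y \<zeta> - h t z \<zeta>))"
        using dist_triangle2[of "h t x \<zeta>" "h t y \<zeta>" "h t z \<zeta>"]
        by (simp add: dist_norm ennreal_leI flip: ennreal_plus)
    qed
    also have "\<dots> = H t x z + H t y z" unfolding H_def by (rule nn_integral_add) measurable
    finally show ?thesis .
  qed
  have \<phi>_cont: "continuous_on UNIV (\<lambda>x :: 'a. \<phi> (norm x))"
    by (intro continuous_on_compose2[OF \<phi>(1)] continuous_intros) auto
  \<comment> \<open>Only points of the countable set \<open>D\<close> serve as second point: for
    fixed x outside \<open>N\<close> the exceptional times then form a null set, and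
    \<open>Q\<close> is jointly measurable, as the exchange of quantifiers below requires.\<close>
  define Q where "Q t x \<longleftrightarrow> (t \<in> S \<longrightarrow> (\<forall>d\<in>D. H t x d \<le> ennreal (\<phi> (norm (x - d)))))" for t x
  have mH: "(\<lambda>p. H (snd p) (fst p) d) \<in> borel_measurable (borel \<Otimes>\<^sub>M borel)" for d
  proof -
    have "(\<lambda>(p, \<zeta>). ennreal (norm ((\<lambda>(t, x, \<zeta>). h t x \<zeta>) (snd p, fst p, \<zeta>) - (\<lambda>(t, x, \<zeta>). h t x \<zeta>) (snd p, d, \<zeta>))))
      \<in> borel_measurable ((borel \<Otimes>\<^sub>M borel) \<Otimes>\<^sub>M m)" by measurable
    then show ?thesis unfolding H_def
      by (intro borel_measurable_nn_integral) (simp add: case_prod_unfold)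
  qed
  have m\<phi>: "(\<lambda>p. \<phi> (norm (fst p - d))) \<in> borel_measurable (borel \<Otimes>\<^sub>M borel)" for d :: 'a
    by (rule measurable_compose[OF _ borel_measurable_continuous_onI[OF \<phi>_cont]]) measurable
  have mQ: "{p \<in> space (lborel \<Otimes>\<^sub>M lborel). Q (snd p) (fst p)} \<in> sets (lborel \<Otimes>\<^sub>M lborel)"
  proof -
    have *: "Measurable.pred (borel \<Otimes>\<^sub>M borel) (\<lambda>p. H (snd p) (fst p) d \<le> ennreal (\<phi> (norm (fst p - d))))" for d
    proof -
      note [measurable] = mH[of d] m\<phi>[of d]
      show ?thesis by measurable
    qed
    have "Measurable.pred (borel \<Otimes>\<^sub>M borel) (\<lambda>p. \<forall>d\<in>D. H (snd p) (fst p) d \<le> ennreal (\<phi> (norm (fst p - d))))"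
    proof -
      have "D \<noteq> {}" using D(3) by auto
      then have "(\<forall>d\<in>D. R d) \<longleftrightarrow> (\<forall>n. R (from_nat_into D n))" for R
        using D(1) range_from_nat_into[of D] by (metis imageE rangeI)
      then show ?thesis using * by simp
    qed
    moreover have "Measurable.pred (borel \<Otimes>\<^sub>M borel) (\<lambda>p :: 'a \<times> real. snd p \<in> S)" by measurable
    ultimately have "Measurable.pred (borel \<Otimes>\<^sub>M borel) (\<lambda>p. Q (snd p) (fst p))"
      unfolding Q_def by (rule pred_intros_logic(4)[rotated])
    then have "Measurable.pred (lborel \<Otimes>\<^sub>M lborel) (\<lambda>p. Q (snd p) (fst p))" by (simp cong: measurable_cong_sets)
    then show ?thesis by (rule predE)
  qed
  have "AE x in lborel. x \<notin> N" using N by (rule AE_not_in)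
  then have "AE x in lborel. AE t in lborel. Q t x"
  proof eventually_elim
    case (elim x)
    have "AE t in lborel. \<forall>d\<in>D. t \<in> S \<longrightarrow> H t x d \<le> ennreal (\<phi> (norm (x - d)))"
      unfolding H_def using bd[OF elim] D by (subst AE_ball_countable) auto
    then show ?case by eventually_elim (auto simp: Q_def)
  qed
  \<comment> \<open>Fubini exchanges the two quantifiers: the exceptional set of times no longer
    depends on the point.\<close>
  then have "AE t in lborel. AE x in lborel. Q t x"
    by (subst (asm) lborel_pair.AE_commute[OF mQ])
  then show ?thesis
  proof eventually_elim
    case (elim t)
    have "H t x y \<le> ennreal (\<phi> (norm (x - y)))" if t: "t \<in> S" and x: "Q t x" and y: "Q t y" for x y
    proof -
      \<comment> \<open>Intermediate points of \<open>D\<close> tending to x: the first modulus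
        tends to \<phi>(0) = 0 and the second to the modulus of y - x, so no constant is
        lost.\<close>
      obtain d where d: "\<And>n. d n \<in> D" "d \<longlonglongrightarrow> x"
        using D(3) closure_sequential[of x D] by auto
      have "H t x y \<le> ennreal (\<phi> (norm (x - d n)) + \<phi> (norm (y - d n)))" for n
      proof -
        have "H t x y \<le> H t x (d n) + H t y (d n)" by (rule H_tri)
        also have "\<dots> \<le> ennreal (\<phi> (norm (x - d n))) + ennreal (\<phi> (norm (y - d n)))"
          using t x y d unfolding Q_def by (intro add_mono) auto
        finally show ?thesis using \<phi>(3) by (simp add: ennreal_plus)
      qed
      moreover have "(\<lambda>n. ennreal (\<phi> (norm (x - d n)) + \<phi> (norm (y - d n))))
          \<longlonglongrightarrow> ennreal (\<phi> (norm (x - x)) + \<phi> (norm (y - x)))"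
        by (intro tendsto_ennrealI tendsto_add continuous_on_tendsto_compose[OF \<phi>_cont] tendsto_intros d) auto
      ultimately have "H t x y \<le> ennreal (\<phi> (norm (x - x)) + \<phi> (norm (y - x)))"
        by (intro LIMSEQ_le_const) auto
      then show ?thesis using \<phi> by (simp add: norm_minus_commute)
    qed
    then show ?case unfolding H_def using elim by (intro impI exI[of _ "{x. Q t x}"]) auto
  qed
qed

text \<open>
  The crucial use of antisymmetry: in the second term the kernel is integrated in its second argument
  against the law that generates the difference, which is exchanged with the first argument.
\<close>

lemma nn_integral_field_difference:
  fixes k :: "'a::euclidean_space \<Rightarrow> 'a \<Rightarrow> 'b::euclidean_space"
  assumes "prob_space P" and [measurable]: "Y1 \<in> borel_measurable P" "Y2 \<in> borel_measurable P"
    and k[measurable]: "(\<lambda>(x, y). k x y) \<in> borel_measurable (borel \<Otimes>\<^sub>M borel)"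
    and ac: "absolutely_continuous lborel (distr P borel Y1)" "absolutely_continuous lborel (distr P borel Y2)"
    and anti: "AE y in lborel. AE x in lborel. k x y = - k y x"
    and A: "AE x in lborel. x \<in> A"
    and A1: "\<And>x y. x \<in> A \<Longrightarrow> y \<in> A \<Longrightarrow> (\<integral>\<^sup>+\<zeta>. ennreal (norm (k x (Y1 \<zeta>) - k y (Y1 \<zeta>))) \<partial>P) \<le> ennreal (\<phi> (norm (x - y)))"
    and A2: "\<And>x y. x \<in> A \<Longrightarrow> y \<in> A \<Longrightarrow> (\<integral>\<^sup>+\<zeta>. ennreal (norm (k x (Y2 \<zeta>) - k y (Y2 \<zeta>))) \<partial>P) \<le> ennreal (\<phi> (norm (x - y)))"
    and fin1: "\<And>x. x \<in> A \<Longrightarrow> (\<integral>\<^sup>+\<zeta>. ennreal (norm (k x (Y1 \<zeta>))) \<partial>P) < \<infinity>"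
    and fin2: "\<And>x. x \<in> A \<Longrightarrow> (\<integral>\<^sup>+\<zeta>. ennreal (norm (k x (Y2 \<zeta>))) \<partial>P) < \<infinity>"
    and \<phi>[measurable]: "(\<lambda>\<omega>. \<phi> (norm (Y1 \<omega> - Y2 \<omega>))) \<in> borel_measurable P"
  shows "(\<integral>\<^sup>+\<omega>. ennreal (norm ((\<integral>\<zeta>. k (Y1 \<omega>) (Y1 \<zeta>) \<partial>P) - (\<integral>\<zeta>. k (Y2 \<omega>) (Y2 \<zeta>) \<partial>P))) \<partial>P)
    \<le> 2 * (\<integral>\<^sup>+\<omega>. ennreal (\<phi> (norm (Y1 \<omega> - Y2 \<omega>))) \<partial>P)"
proof -
  interpret prob_space P by fact
  interpret PP: pair_sigma_finite P P ..
  have km2: "(\<lambda>(\<omega>, \<zeta>). k (f \<omega>) (g \<zeta>)) \<in> borel_measurable (P \<Otimes>\<^sub>M P)"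
    if [measurable]: "f \<in> borel_measurable P" "g \<in> borel_measurable P" for f g
    using measurable_compose[OF _ k, of "\<lambda>p. (f (fst p), g (snd p))" "P \<Otimes>\<^sub>M P"] by (simp add: case_prod_unfold)
  have kP: "(\<lambda>\<zeta>. k x (Y \<zeta>)) \<in> borel_measurable P" if [measurable]: "Y \<in> borel_measurable P" for x Y
    using measurable_compose[OF _ k, of "\<lambda>\<omega>. (x, Y \<omega>)" P] by simp
  have int: "integrable P (\<lambda>\<zeta>. k x (Y \<zeta>))"
    if "(\<integral>\<^sup>+\<zeta>. ennreal (norm (k x (Y \<zeta>))) \<partial>P) < \<infinity>" "Y \<in> borel_measurable P" for x Y
    using that kP by (intro integrableI_bounded) auto
  have YA: "AE \<omega> in P. Y1 \<omega> \<in> A" "AE \<omega> in P. Y2 \<omega> \<in> A"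
    using AE_law[OF ac(1) _ A] AE_law[OF ac(2) _ A] by auto
  \<comment> \<open>The difference of the two fields at the same point Y2(\<omega>). The kernel
    values differ in the second argument here, on which the moduli give no information until the
    arguments are exchanged.\<close>
  let ?r = "\<lambda>\<omega>. (\<integral>\<^sup>+\<zeta>. ennreal (norm (k (Y2 \<omega>) (Y1 \<zeta>) - k (Y2 \<omega>) (Y2 \<zeta>))) \<partial>P)"
  let ?p = "\<lambda>\<omega>. ennreal (\<phi> (norm (Y1 \<omega> - Y2 \<omega>)))"
  have m2: "(\<lambda>(\<omega>, \<zeta>). ennreal (norm (k (Y2 \<omega>) (Y1 \<zeta>) - k (Y2 \<omega>) (Y2 \<zeta>)))) \<in> borel_measurable (P \<Otimes>\<^sub>M P)"
    using km2[of Y2 Y1] km2[of Y2 Y2] by (simp add: case_prod_unfold)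
  have "AE \<omega> in P. ennreal (norm ((\<integral>\<zeta>. k (Y1 \<omega>) (Y1 \<zeta>) \<partial>P) - (\<integral>\<zeta>. k (Y2 \<omega>) (Y2 \<zeta>) \<partial>P))) \<le> ?p \<omega> + ?r \<omega>"
    using YA
  proof eventually_elim
    case (elim \<omega>)
    note i = int[OF fin1[OF elim(1)]] int[OF fin1[OF elim(2)]] int[OF fin2[OF elim(2)]]
    have "(\<integral>\<zeta>. k (Y1 \<omega>) (Y1 \<zeta>) \<partial>P) - (\<integral>\<zeta>. k (Y2 \<omega>) (Y2 \<zeta>) \<partial>P)
      = (\<integral>\<zeta>. k (Y1 \<omega>) (Y1 \<zeta>) - k (Y2 \<omega>) (Y1 \<zeta>) \<partial>P) + (\<integral>\<zeta>. k (Y2 \<omega>) (Y1 \<zeta>) - k (Y2 \<omega>) (Y2 \<zeta>) \<partial>P)"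
      using i by simp
    then have "ennreal (norm ((\<integral>\<zeta>. k (Y1 \<omega>) (Y1 \<zeta>) \<partial>P) - (\<integral>\<zeta>. k (Y2 \<omega>) (Y2 \<zeta>) \<partial>P)))
      \<le> ennreal (norm (\<integral>\<zeta>. k (Y1 \<omega>) (Y1 \<zeta>) - k (Y2 \<omega>) (Y1 \<zeta>) \<partial>P)) +
        ennreal (norm (\<integral>\<zeta>. k (Y2 \<omega>) (Y1 \<zeta>) - k (Y2 \<omega>) (Y2 \<zeta>) \<partial>P))"
      by (simp add: norm_triangle_ineq flip: ennreal_plus)
    also have "\<dots> \<le> (\<integral>\<^sup>+\<zeta>. ennreal (norm (k (Y1 \<omega>) (Y1 \<zeta>) - k (Y2 \<omega>) (Y1 \<zeta>))) \<partial>P) + ?r \<omega>"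
      using i by (intro add_mono integral_norm_bound_ennreal Bochner_Integration.integrable_diff) auto
    also have "\<dots> \<le> ?p \<omega> + ?r \<omega>" using elim by (intro add_right_mono A1)
    finally show ?case .
  qed
  then have "(\<integral>\<^sup>+\<omega>. ennreal (norm ((\<integral>\<zeta>. k (Y1 \<omega>) (Y1 \<zeta>) \<partial>P) - (\<integral>\<zeta>. k (Y2 \<omega>) (Y2 \<zeta>) \<partial>P))) \<partial>P)
      \<le> (\<integral>\<^sup>+\<omega>. ?p \<omega> + ?r \<omega> \<partial>P)"
    by (rule nn_integral_mono_AE)
  also have "\<dots> = (\<integral>\<^sup>+\<omega>. ?p \<omega> \<partial>P) + (\<integral>\<^sup>+\<omega>. ?r \<omega> \<partial>P)"
    using borel_measurable_nn_integral[OF m2] by (intro nn_integral_add) auto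
  also have "(\<integral>\<^sup>+\<omega>. ?r \<omega> \<partial>P) =
      (\<integral>\<^sup>+\<zeta>. \<integral>\<^sup>+\<omega>. ennreal (norm (k (Y2 \<omega>) (Y1 \<zeta>) - k (Y2 \<omega>) (Y2 \<zeta>))) \<partial>P \<partial>P)"
    using PP.Fubini'[OF m2] by simp
  also have "\<dots> \<le> (\<integral>\<^sup>+\<zeta>. ?p \<zeta> \<partial>P)"
  proof (rule nn_integral_mono_AE)
    \<comment> \<open>Antisymmetry holds for almost every pair only. It is transferred in two
      stages: the laws of \<open>Y1\<close> and \<open>Y2\<close> allow the point generated by
      \<zeta> to be frozen, then the law of \<open>Y2\<close> covers the running point
      Y2(\<omega>).\<close>
    have "AE \<zeta> in P. AE x in lborel. k x (Y1 \<zeta>) = - k (Y1 \<zeta>) x"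
      "AE \<zeta> in P. AE x in lborel. k x (Y2 \<zeta>) = - k (Y2 \<zeta>) x"
      using AE_law[OF ac(1) _ anti] AE_law[OF ac(2) _ anti] by auto
    with YA show "AE \<zeta> in P. (\<integral>\<^sup>+\<omega>. ennreal (norm (k (Y2 \<omega>) (Y1 \<zeta>) - k (Y2 \<omega>) (Y2 \<zeta>))) \<partial>P) \<le> ?p \<zeta>"
    proof eventually_elim
      case (elim \<zeta>)
      have "AE \<omega> in P. k (Y2 \<omega>) (Y1 \<zeta>) = - k (Y1 \<zeta>) (Y2 \<omega>)" "AE \<omega> in P. k (Y2 \<omega>) (Y2 \<zeta>) = - k (Y2 \<zeta>) (Y2 \<omega>)"
        using AE_law[OF ac(2) _ elim(3)] AE_law[OF ac(2) _ elim(4)] by auto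
      then have "AE \<omega> in P. norm (k (Y2 \<omega>) (Y1 \<zeta>) - k (Y2 \<omega>) (Y2 \<zeta>)) = norm (k (Y1 \<zeta>) (Y2 \<omega>) - k (Y2 \<zeta>) (Y2 \<omega>))"
        by eventually_elim (simp add: norm_minus_commute)
      then have "(\<integral>\<^sup>+\<omega>. ennreal (norm (k (Y2 \<omega>) (Y1 \<zeta>) - k (Y2 \<omega>) (Y2 \<zeta>))) \<partial>P) =
          (\<integral>\<^sup>+\<omega>. ennreal (norm (k (Y1 \<zeta>) (Y2 \<omega>) - k (Y2 \<zeta>) (Y2 \<omega>))) \<partial>P)"
        by (intro nn_integral_cong_AE) auto
      also have "\<dots> \<le> ?p \<zeta>" using elim by (intro A2)
      finally show ?case .
    qed
  qed
  finally show ?thesis by (simp add: mult_2 add_mono)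
qed

text \<open>Tonelli's theorem applied to pathwise bounds: it passes from estimates along single
  trajectories to estimates of their means, which may a priori be infinite.\<close>

lemma nn_integral_trajectory:
  assumes "prob_space P" and [measurable]: "u0 \<in> borel_measurable P"
    and g[measurable]: "(\<lambda>(s, \<omega>). g s \<omega>) \<in> borel_measurable (borel \<Otimes>\<^sub>M P)"
    and le: "AE \<omega> in P. u \<omega> \<le> u0 \<omega> + (\<integral>\<^sup>+s\<in>{0..t}. g s \<omega> \<partial>lborel)"
  shows "(\<integral>\<^sup>+\<omega>. u \<omega> \<partial>P) \<le> (\<integral>\<^sup>+\<omega>. u0 \<omega> \<partial>P) + (\<integral>\<^sup>+s\<in>{0..t::real}. (\<integral>\<^sup>+\<omega>. g s \<omega> \<partial>P) \<partial>lborel)"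
proof -
  interpret prob_space P by fact
  interpret LP: pair_sigma_finite "lborel :: real measure" P ..
  have m: "(\<lambda>(s, \<omega>). g s \<omega> * indicator {0..t} s) \<in> borel_measurable (lborel \<Otimes>\<^sub>M P)" by measurable
  have gs: "(\<lambda>\<omega>. g s \<omega>) \<in> borel_measurable P" for s
    using measurable_compose[OF _ g, of "\<lambda>\<omega>. (s, \<omega>)" P] by simp
  have "(\<integral>\<^sup>+\<omega>. u \<omega> \<partial>P) \<le> (\<integral>\<^sup>+\<omega>. u0 \<omega> + (\<integral>\<^sup>+s\<in>{0..t}. g s \<omega> \<partial>lborel) \<partial>P)"
    using le by (rule nn_integral_mono_AE)
  also have "\<dots> = (\<integral>\<^sup>+\<omega>. u0 \<omega> \<partial>P) + (\<integral>\<^sup>+\<omega>. (\<integral>\<^sup>+s\<in>{0..t}. g s \<omega> \<partial>lborel) \<partial>P)"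
    using lborel.borel_measurable_nn_integral[of "\<lambda>\<omega> s. g s \<omega> * indicator {0..t} s" P] measurable_pair_swap[OF m]
    by (intro nn_integral_add) (auto simp: case_prod_unfold)
  also have "(\<integral>\<^sup>+\<omega>. (\<integral>\<^sup>+s\<in>{0..t}. g s \<omega> \<partial>lborel) \<partial>P) = (\<integral>\<^sup>+s. (\<integral>\<^sup>+\<omega>. g s \<omega> * indicator {0..t} s \<partial>P) \<partial>lborel)"
    using LP.Fubini'[OF m] by simp
  also have "\<dots> = (\<integral>\<^sup>+s\<in>{0..t}. (\<integral>\<^sup>+\<omega>. g s \<omega> \<partial>P) \<partial>lborel)"
    using gs by (simp add: nn_integral_multc)
  finally show ?thesis .
qed

text \<open>Everything lives on one probability space \<open>P\<close>, later the coupling itself: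
  the fields become expectations over a second variable \<zeta>, and densities enter through
  absolute continuity alone. \<open>c\<close> bounds the initial cost, hence both initial mean
  distances, whence 2 L c in the condition on \<delta>.\<close>

lemma (in concave_modulus) coupled_flow_estimate:
  fixes P :: "'p measure" and Z1 Z2 :: "real \<Rightarrow> 'p \<Rightarrow> 'a::euclidean_space \<times> 'a"
    and k :: "'a \<Rightarrow> 'a \<Rightarrow> 'a"
  assumes P: "prob_space P"
    and Z1[measurable]: "(\<lambda>(t, \<omega>). Z1 t \<omega>) \<in> borel_measurable (borel \<Otimes>\<^sub>M P)"
    and Z2[measurable]: "(\<lambda>(t, \<omega>). Z2 t \<omega>) \<in> borel_measurable (borel \<Otimes>\<^sub>M P)"
    and k[measurable]: "(\<lambda>(x, y). k x y) \<in> borel_measurable (borel \<Otimes>\<^sub>M borel)"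
    and anti: "AE y in lborel. AE x in lborel. k x y = - k y x"
    and zero: "\<phi> 0 = 0"
    and ac1: "\<And>t. t \<in> {0..T} \<Longrightarrow> absolutely_continuous lborel (distr P borel (\<lambda>\<omega>. fst (Z1 t \<omega>)))"
    and ac2: "\<And>t. t \<in> {0..T} \<Longrightarrow> absolutely_continuous lborel (distr P borel (\<lambda>\<omega>. fst (Z2 t \<omega>)))"
    and N: "N \<in> null_sets lborel"
    and mod1: "\<And>x y. x \<notin> N \<Longrightarrow> y \<notin> N \<Longrightarrow> AE t in lborel. t \<in> {0..T} \<longrightarrow>
      (\<integral>\<^sup>+\<omega>. ennreal (norm (k x (fst (Z1 t \<omega>)) - k y (fst (Z1 t \<omega>)))) \<partial>P) \<le> ennreal (\<phi> (norm (x - y)))"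
    and mod2: "\<And>x y. x \<notin> N \<Longrightarrow> y \<notin> N \<Longrightarrow> AE t in lborel. t \<in> {0..T} \<longrightarrow>
      (\<integral>\<^sup>+\<omega>. ennreal (norm (k x (fst (Z2 t \<omega>)) - k y (fst (Z2 t \<omega>)))) \<partial>P) \<le> ennreal (\<phi> (norm (x - y)))"
    and fin1: "AE t in lborel. t \<in> {0..T} \<longrightarrow> (AE x in lborel. (\<integral>\<^sup>+\<omega>. ennreal (norm (k x (fst (Z1 t \<omega>)))) \<partial>P) < \<infinity>)"
    and fin2: "AE t in lborel. t \<in> {0..T} \<longrightarrow> (AE x in lborel. (\<integral>\<^sup>+\<omega>. ennreal (norm (k x (fst (Z2 t \<omega>)))) \<partial>P) < \<infinity>)"
    and trajx: "AE \<omega> in P. \<forall>t\<in>{0..T}. ennreal (norm (fst (Z1 t \<omega>) - fst (Z2 t \<omega>)))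
      \<le> ennreal (norm (fst (Z1 0 \<omega>) - fst (Z2 0 \<omega>))) + (\<integral>\<^sup>+s\<in>{0..t}.
          ennreal (L * (norm (fst (Z1 s \<omega>) - fst (Z2 s \<omega>)) + norm (snd (Z1 s \<omega>) - snd (Z2 s \<omega>))) + \<eta>) \<partial>lborel)"
    and trajv: "AE \<omega> in P. \<forall>t\<in>{0..T}. ennreal (norm (snd (Z1 t \<omega>) - snd (Z2 t \<omega>)))
      \<le> ennreal (norm (snd (Z1 0 \<omega>) - snd (Z2 0 \<omega>))) + (\<integral>\<^sup>+s\<in>{0..t}.
          ennreal (norm ((\<integral>\<zeta>. k (fst (Z1 s \<omega>)) (fst (Z1 s \<zeta>)) \<partial>P) - (\<integral>\<zeta>. k (fst (Z2 s \<omega>)) (fst (Z2 s \<zeta>)) \<partial>P))) \<partial>lborel)"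
    and fin: "\<And>t. t \<in> {0..T} \<Longrightarrow> (\<integral>\<^sup>+\<omega>. ennreal (norm (Z1 t \<omega> - Z2 t \<omega>)) \<partial>P) < \<infinity>"
    and C: "AE t in lborel. t \<in> {0..T} \<longrightarrow> (\<integral>\<^sup>+\<omega>. ennreal (norm (Z1 t \<omega> - Z2 t \<omega>)) \<partial>P) \<le> ennreal C"
    and c: "0 \<le> c" "(\<integral>\<^sup>+\<omega>. ennreal (norm (Z1 0 \<omega> - Z2 0 \<omega>)) \<partial>P) \<le> ennreal c"
    and L: "1 \<le> L" and \<eta>: "0 \<le> \<eta>" and \<delta>: "0 < \<delta>" "2 * L * c + \<eta> \<le> \<delta>"
    and t: "t \<in> {0..T}"
  shows "\<exists>R\<ge>0. (\<integral>\<^sup>+\<omega>. ennreal (norm (fst (Z1 t \<omega>) - fst (Z2 t \<omega>))) \<partial>P) \<le> ennreal R \<and>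
    (\<integral>\<^sup>+\<omega>. ennreal (norm (snd (Z1 t \<omega>) - snd (Z2 t \<omega>))) \<partial>P) \<le> ennreal (exp (L * t) * (\<delta> + sqrt (4 * L * Phi \<phi> R))) \<and>
    Psi \<phi> \<delta> (2 * L) R \<le> Psi \<phi> \<delta> (2 * L) c + exp (L * t) - 1"
proof -
  interpret prob_space P by fact
  have Z1t[measurable]: "Z1 s \<in> borel_measurable P" for s
    using measurable_compose[OF _ Z1, of "\<lambda>\<omega>. (s, \<omega>)" P] by simp
  have Z2t[measurable]: "Z2 s \<in> borel_measurable P" for s
    using measurable_compose[OF _ Z2, of "\<lambda>\<omega>. (s, \<omega>)" P] by simp
  have X1[measurable]: "(\<lambda>(s, \<omega>). fst (Z1 s \<omega>)) \<in> borel_measurable (borel \<Otimes>\<^sub>M P)"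
    and X2[measurable]: "(\<lambda>(s, \<omega>). fst (Z2 s \<omega>)) \<in> borel_measurable (borel \<Otimes>\<^sub>M P)"
    and V1[measurable]: "(\<lambda>(s, \<omega>). snd (Z1 s \<omega>)) \<in> borel_measurable (borel \<Otimes>\<^sub>M P)"
    and V2[measurable]: "(\<lambda>(s, \<omega>). snd (Z2 s \<omega>)) \<in> borel_measurable (borel \<Otimes>\<^sub>M P)"
    using measurable_compose[OF Z1 fst_borel] measurable_compose[OF Z2 fst_borel]
      measurable_compose[OF Z1 snd_borel] measurable_compose[OF Z2 snd_borel] by (auto simp: case_prod_unfold)
  have X1t[measurable]: "(\<lambda>\<omega>. fst (Z1 s \<omega>)) \<in> borel_measurable P"
    and X2t[measurable]: "(\<lambda>\<omega>. fst (Z2 s \<omega>)) \<in> borel_measurable P"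
    and V1t[measurable]: "(\<lambda>\<omega>. snd (Z1 s \<omega>)) \<in> borel_measurable P"
    and V2t[measurable]: "(\<lambda>\<omega>. snd (Z2 s \<omega>)) \<in> borel_measurable P" for s
    using measurable_compose[OF Z1t fst_borel] measurable_compose[OF Z2t fst_borel]
      measurable_compose[OF Z1t snd_borel] measurable_compose[OF Z2t snd_borel] by auto
  define dx where "dx s \<omega> = norm (fst (Z1 s \<omega>) - fst (Z2 s \<omega>))" for s \<omega>
  define dv where "dv s \<omega> = norm (snd (Z1 s \<omega>) - snd (Z2 s \<omega>))" for s \<omega>
  have dxm[measurable]: "(\<lambda>(s, \<omega>). dx s \<omega>) \<in> borel_measurable (borel \<Otimes>\<^sub>M P)"
    and dvm[measurable]: "(\<lambda>(s, \<omega>). dv s \<omega>) \<in> borel_measurable (borel \<Otimes>\<^sub>M P)"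
    using X1 X2 V1 V2 unfolding dx_def dv_def by (auto simp: case_prod_unfold)
  have dxt[measurable]: "(\<lambda>\<omega>. dx s \<omega>) \<in> borel_measurable P"
    and dvt[measurable]: "(\<lambda>\<omega>. dv s \<omega>) \<in> borel_measurable P" for s
    unfolding dx_def dv_def by measurable
  have dle: "dx s \<omega> \<le> norm (Z1 s \<omega> - Z2 s \<omega>)" "dv s \<omega> \<le> norm (Z1 s \<omega> - Z2 s \<omega>)" "0 \<le> dx s \<omega>" "0 \<le> dv s \<omega>" for s \<omega>
    using norm_fst_le[of "fst (Z1 s \<omega> - Z2 s \<omega>)" "snd (Z1 s \<omega> - Z2 s \<omega>)"]
      norm_snd_le[of "snd (Z1 s \<omega> - Z2 s \<omega>)" "fst (Z1 s \<omega> - Z2 s \<omega>)"] by (simp_all add: dx_def dv_def flip: fst_diff snd_diff)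
  define Qx where "Qx s = (\<integral>\<^sup>+\<omega>. ennreal (dx s \<omega>) \<partial>P)" for s
  define Qv where "Qv s = (\<integral>\<^sup>+\<omega>. ennreal (dv s \<omega>) \<partial>P)" for s
  have Qle: "Qx s \<le> (\<integral>\<^sup>+\<omega>. ennreal (norm (Z1 s \<omega> - Z2 s \<omega>)) \<partial>P)"
    "Qv s \<le> (\<integral>\<^sup>+\<omega>. ennreal (norm (Z1 s \<omega> - Z2 s \<omega>)) \<partial>P)" for s
    unfolding Qx_def Qv_def by (auto intro!: nn_integral_mono ennreal_leI dle)
  define qx where "qx s = enn2real (Qx s)" for s
  define qv where "qv s = enn2real (Qv s)" for s
  have q: "Qx s = ennreal (qx s)" "Qv s = ennreal (qv s)" if "s \<in> {0..T}" for s
    using Qle[of s] fin[OF that] unfolding qx_def qv_def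
    by (auto simp: ennreal_enn2real_if top_unique le_less_trans)
  have q0: "0 \<le> qx s" "0 \<le> qv s" for s by (auto simp: qx_def qv_def)
  have [measurable]: "Qx \<in> borel_measurable borel" "Qv \<in> borel_measurable borel"
    unfolding Qx_def[abs_def] Qv_def[abs_def]
    by (auto intro!: borel_measurable_nn_integral simp: case_prod_unfold dxm[unfolded case_prod_unfold]
        dvm[unfolded case_prod_unfold] intro: measurable_compose[OF _ measurable_ennreal])
  have qm[measurable]: "qx \<in> borel_measurable borel" "qv \<in> borel_measurable borel"
    unfolding qx_def[abs_def] qv_def[abs_def] by measurable
  have T: "0 \<le> T" using t by auto
  then have T0: "0 \<in> {0..T}" by simp
  have qc: "qx 0 \<le> c" "qv 0 \<le> c"
  proof -
    have "ennreal (qx 0) \<le> ennreal c" "ennreal (qv 0) \<le> ennreal c"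
      using Qle[of 0] c(2) by (auto simp: q[OF T0, symmetric] intro: order_trans)
    then show "qx 0 \<le> c" "qv 0 \<le> c" using c by (auto simp: ennreal_le_iff)
  qed
  define g where "g s = L * qx s + L * qv s + \<eta>" for s
  have gm[measurable]: "g \<in> borel_measurable borel" unfolding g_def[abs_def] by measurable
  have g0: "0 \<le> g s" for s using q0 L \<eta> by (simp add: g_def)
  have qx_le: "ennreal (qx s) \<le> ennreal (qx 0) + (\<integral>\<^sup>+r\<in>{0..s}. ennreal (g r) \<partial>lborel)"
    if s: "s \<in> {0..T}" for s
  proof -
    have m: "(\<lambda>(s, \<omega>). ennreal (L * (dx s \<omega> + dv s \<omega>) + \<eta>)) \<in> borel_measurable (borel \<Otimes>\<^sub>M P)"
      using dxm dvm by (simp add: case_prod_unfold)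
    have "AE \<omega> in P. ennreal (dx s \<omega>) \<le> ennreal (dx 0 \<omega>) + (\<integral>\<^sup>+r\<in>{0..s}. ennreal (L * (dx r \<omega> + dv r \<omega>) + \<eta>) \<partial>lborel)"
      using trajx by eventually_elim (use s in \<open>auto simp: dx_def dv_def\<close>)
    from nn_integral_trajectory[OF P _ m this]
    have "Qx s \<le> Qx 0 + (\<integral>\<^sup>+r\<in>{0..s}. (\<integral>\<^sup>+\<omega>. ennreal (L * (dx r \<omega> + dv r \<omega>) + \<eta>) \<partial>P) \<partial>lborel)"
      by (simp add: Qx_def)
    also have "(\<integral>\<^sup>+r\<in>{0..s}. (\<integral>\<^sup>+\<omega>. ennreal (L * (dx r \<omega> + dv r \<omega>) + \<eta>) \<partial>P) \<partial>lborel) =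
        (\<integral>\<^sup>+r\<in>{0..s}. ennreal (g r) \<partial>lborel)"
    proof (intro nn_integral_cong)
      fix r
      have "(\<integral>\<^sup>+\<omega>. ennreal (L * (dx r \<omega> + dv r \<omega>) + \<eta>) \<partial>P) = ennreal (g r)" if r: "r \<in> {0..s}"
      proof -
        have rT: "r \<in> {0..T}" using r s by auto
        have "(\<integral>\<^sup>+\<omega>. ennreal (L * (dx r \<omega> + dv r \<omega>) + \<eta>) \<partial>P) =
          (\<integral>\<^sup>+\<omega>. ennreal L * (ennreal (dx r \<omega>) + ennreal (dv r \<omega>)) + ennreal \<eta> \<partial>P)"
          using dle L \<eta> by (intro nn_integral_cong) (simp add: ennreal_plus ennreal_mult)
        also have "\<dots> = ennreal L * (Qx r + Qv r) + ennreal \<eta>"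
          by (simp add: nn_integral_add nn_integral_cmult Qx_def Qv_def emeasure_space_1)
        also have "\<dots> = ennreal (g r)" using L \<eta> q0
          by (simp add: q[OF rT] g_def ennreal_plus ennreal_mult distrib_left flip: ennreal_mult)
        finally show ?thesis .
      qed
      then show "(\<integral>\<^sup>+\<omega>. ennreal (L * (dx r \<omega> + dv r \<omega>) + \<eta>) \<partial>P) * indicator {0..s} r = ennreal (g r) * indicator {0..s} r"
        by (auto split: split_indicator)
    qed
    finally show ?thesis by (simp add: q[OF s] q[OF T0])
  qed
  \<comment> \<open>The essential bound \<open>C\<close> on the mean distance makes \<open>g\<close>
    integrable in time, so that its indefinite integral is a continuous function.\<close>
  have g_int: "set_integrable lborel {0..T} g"
  proof (unfold set_integrable_def, rule integrableI_bounded_set_indicator)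
    show "AE x in lborel. x \<in> {0..T} \<longrightarrow> norm (g x) \<le> L * (2 * \<bar>C\<bar>) + \<eta>"
      using C
    proof eventually_elim
      case (elim s)
      show ?case
      proof
        assume s: "s \<in> {0..T}"
        have "ennreal (qx s) \<le> ennreal C" "ennreal (qv s) \<le> ennreal C"
          using Qle[of s] elim s unfolding q[OF s, symmetric] by (auto intro: order_trans)
        then have "qx s \<le> \<bar>C\<bar>" "qv s \<le> \<bar>C\<bar>" using q0[of s] by (auto simp: ennreal_le_iff2)
        then have "L * (qx s + qv s) \<le> L * (2 * \<bar>C\<bar>)" using L by (intro mult_left_mono) auto
        then show "norm (g s) \<le> L * (2 * \<bar>C\<bar>) + \<eta>" using g0[of s] by (simp add: g_def distrib_left)
      qed
    qed
  qed (auto simp: emeasure_lborel_Icc_eq)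
  then have gi: "g integrable_on {0..T}" by (rule set_borel_integral_eq_integral)
  have gis: "g integrable_on {0..s}" if "s \<in> {0..T}" for s
    by (rule integrable_subinterval_real[OF gi]) (use that in auto)
  \<comment> \<open>\<open>qx\<close> is only known to be measurable in time; \<open>W\<close> is a
    continuous majorant with the same initial value, and the modulus is evaluated at
    \<open>W\<close> from here on.\<close>
  define W where "W s = qx 0 + integral {0..s} g" for s
  have cW: "continuous_on {0..T} W"
    unfolding W_def by (intro continuous_intros indefinite_integral_continuous_1 gi)
  have qW: "qx s \<le> W s" if s: "s \<in> {0..T}" for s
  proof -
    have "(\<integral>\<^sup>+r\<in>{0..s}. ennreal (g r) \<partial>lborel) = ennreal (integral {0..s} g)"
      using gis[OF s] g0 by (intro nn_integral_has_integral_lebesgue') (auto simp: integrable_integral)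
    moreover have "0 \<le> integral {0..s} g" using gis[OF s] g0 by (intro integral_nonneg) auto
    ultimately show ?thesis
      using qx_le[OF s] q0 by (simp add: W_def ennreal_le_iff flip: ennreal_plus)
  qed
  have W0: "0 \<le> W s" if "s \<in> {0..T}" for s using qW[OF that] q0[of s] by linarith
  have c\<phi>W: "continuous_on {0..T} (\<lambda>s. 2 * \<phi> (W s))"
    using W0 by (intro continuous_intros continuous_on_compose2[OF cont cW]) auto
  have i\<phi>W: "(\<lambda>s. 2 * \<phi> (W s)) integrable_on {0..s}" if "s \<in> {0..T}" for s
    using that by (intro integrable_continuous_real continuous_on_subset[OF c\<phi>W]) auto
  have \<phi>W0: "0 \<le> 2 * \<phi> (W r)" if "s \<in> {0..T}" "r \<in> {0..s}" for s r
    using nonneg[OF W0[of r]] that by auto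
  define fd where "fd s \<omega> = ennreal (norm ((\<integral>\<zeta>. k (fst (Z1 s \<omega>)) (fst (Z1 s \<zeta>)) \<partial>P) - (\<integral>\<zeta>. k (fst (Z2 s \<omega>)) (fst (Z2 s \<zeta>)) \<partial>P)))" for s \<omega>
  have mfield: "(\<lambda>p. \<integral>\<zeta>. k (fst (Z (fst p) (snd p))) (fst (Z (fst p) \<zeta>)) \<partial>P) \<in> borel_measurable (borel \<Otimes>\<^sub>M P)"
    if X: "(\<lambda>(s, \<omega>). fst (Z s \<omega>)) \<in> borel_measurable (borel \<Otimes>\<^sub>M P)" for Z :: "real \<Rightarrow> 'p \<Rightarrow> 'a \<times> 'a"
  proof (rule borel_measurable_lebesgue_integral)
    have "(\<lambda>q. fst (Z (fst (fst q)) (snd (fst q)))) \<in> borel_measurable ((borel \<Otimes>\<^sub>M P) \<Otimes>\<^sub>M P)"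
      using measurable_compose[OF measurable_fst X] by (simp add: case_prod_unfold)
    moreover have "(\<lambda>q. fst (Z (fst (fst q)) (snd q))) \<in> borel_measurable ((borel \<Otimes>\<^sub>M P) \<Otimes>\<^sub>M P)"
      using measurable_compose[OF _ X, of "\<lambda>q. (fst (fst q), snd q)" "(borel \<Otimes>\<^sub>M P) \<Otimes>\<^sub>M P"] by (simp add: case_prod_unfold)
    ultimately show "(\<lambda>(p, \<zeta>). k (fst (Z (fst p) (snd p))) (fst (Z (fst p) \<zeta>))) \<in> borel_measurable ((borel \<Otimes>\<^sub>M P) \<Otimes>\<^sub>M P)"
      using measurable_compose[OF measurable_Pair k, of _ "(borel \<Otimes>\<^sub>M P) \<Otimes>\<^sub>M P"] by (simp add: case_prod_unfold)
  qed
  have fdm: "(\<lambda>(s, \<omega>). fd s \<omega>) \<in> borel_measurable (borel \<Otimes>\<^sub>M P)"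
    using mfield[OF X1] mfield[OF X2] unfolding fd_def by (simp add: case_prod_unfold)
  have km: "(\<lambda>(s, x, \<zeta>). k x (fst (Z s \<zeta>))) \<in> borel_measurable (borel \<Otimes>\<^sub>M borel \<Otimes>\<^sub>M P)"
    if X: "(\<lambda>(s, \<omega>). fst (Z s \<omega>)) \<in> borel_measurable (borel \<Otimes>\<^sub>M P)" for Z :: "real \<Rightarrow> 'p \<Rightarrow> 'a \<times> 'a"
  proof -
    have "(\<lambda>q. fst (Z (fst q) (snd (snd q)))) \<in> borel_measurable (borel \<Otimes>\<^sub>M (borel :: 'a measure) \<Otimes>\<^sub>M P)"
      using measurable_compose[OF _ X, of "\<lambda>q. (fst q, snd (snd q))" "borel \<Otimes>\<^sub>M (borel :: 'a measure) \<Otimes>\<^sub>M P"] by (simp add: case_prod_unfold)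
    then have "(\<lambda>q. (fst (snd q), fst (Z (fst q) (snd (snd q))))) \<in> (borel \<Otimes>\<^sub>M (borel :: 'a measure) \<Otimes>\<^sub>M P) \<rightarrow>\<^sub>M borel \<Otimes>\<^sub>M borel"
      by (intro measurable_Pair) auto
    from measurable_compose[OF this k] show ?thesis by (simp add: case_prod_unfold)
  qed
  have fd_bound: "AE s in lborel. s \<in> {0..T} \<longrightarrow> (\<integral>\<^sup>+\<omega>. fd s \<omega> \<partial>P) \<le> ennreal (2 * \<phi> (W s))"
    using ae_uniform_modulus[OF sigma_finite_measure_axioms km[OF X1] _ N cont zero nonneg mod1, simplified]
      ae_uniform_modulus[OF sigma_finite_measure_axioms km[OF X2] _ N cont zero nonneg mod2, simplified] fin1 fin2
  proof eventually_elim
    case (elim s)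
    show ?case
    proof
      assume s: "s \<in> {0..T}"
      obtain A1 where A1: "AE x in lborel. x \<in> A1" "\<And>x y. x \<in> A1 \<Longrightarrow> y \<in> A1 \<Longrightarrow>
          (\<integral>\<^sup>+\<zeta>. ennreal (norm (k x (fst (Z1 s \<zeta>)) - k y (fst (Z1 s \<zeta>)))) \<partial>P) \<le> ennreal (\<phi> (norm (x - y)))"
        using elim(1) s by auto
      obtain A2 where A2: "AE x in lborel. x \<in> A2" "\<And>x y. x \<in> A2 \<Longrightarrow> y \<in> A2 \<Longrightarrow>
          (\<integral>\<^sup>+\<zeta>. ennreal (norm (k x (fst (Z2 s \<zeta>)) - k y (fst (Z2 s \<zeta>)))) \<partial>P) \<le> ennreal (\<phi> (norm (x - y)))"
        using elim(2) s by auto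
      \<comment> \<open>At a fixed good time the full-measure sets of both solutions are intersected
        with the points where the kernel is integrable; integrability is what allows the difference
        of the fields to be split.\<close>
      define A where "A = {x \<in> A1 \<inter> A2. (\<integral>\<^sup>+\<omega>. ennreal (norm (k x (fst (Z1 s \<omega>)))) \<partial>P) < \<infinity> \<and>
          (\<integral>\<^sup>+\<omega>. ennreal (norm (k x (fst (Z2 s \<omega>)))) \<partial>P) < \<infinity>}"
      have "AE x in lborel. x \<in> A"
        using A1(1) A2(1) elim(3)[rule_format, OF s] elim(4)[rule_format, OF s]
        by eventually_elim (auto simp: A_def)
      then have "(\<integral>\<^sup>+\<omega>. fd s \<omega> \<partial>P) \<le> 2 * (\<integral>\<^sup>+\<omega>. ennreal (\<phi> (norm (fst (Z1 s \<omega>) - fst (Z2 s \<omega>)))) \<partial>P)"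
        unfolding fd_def
        by (intro nn_integral_field_difference[OF P X1t X2t k ac1[OF s] ac2[OF s] anti, where A = A])
          (auto simp: A_def intro!: A1(2) A2(2) phi_meas)
      also have "(\<integral>\<^sup>+\<omega>. ennreal (\<phi> (norm (fst (Z1 s \<omega>) - fst (Z2 s \<omega>)))) \<partial>P) \<le> ennreal (\<phi> (W s))"
        using q(1)[OF s] qW[OF s] W0[OF s] unfolding Qx_def dx_def
        by (intro nn_jensen P) (auto intro: ennreal_leI)
      finally show "(\<integral>\<^sup>+\<omega>. fd s \<omega> \<partial>P) \<le> ennreal (2 * \<phi> (W s))"
        by (simp add: ennreal_mult' mult_left_mono)
    qed
  qed
  have qv_le: "qv s \<le> qv 0 + integral {0..s} (\<lambda>r. 2 * \<phi> (W r))" if s: "s \<in> {0..T}" for s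
  proof -
    have "AE \<omega> in P. ennreal (dv s \<omega>) \<le> ennreal (dv 0 \<omega>) + (\<integral>\<^sup>+r\<in>{0..s}. fd r \<omega> \<partial>lborel)"
      using trajv by eventually_elim (use s in \<open>auto simp: dv_def fd_def\<close>)
    from nn_integral_trajectory[OF P _ fdm this]
    have "Qv s \<le> Qv 0 + (\<integral>\<^sup>+r\<in>{0..s}. (\<integral>\<^sup>+\<omega>. fd r \<omega> \<partial>P) \<partial>lborel)" by (simp add: Qv_def)
    also have "(\<integral>\<^sup>+r\<in>{0..s}. (\<integral>\<^sup>+\<omega>. fd r \<omega> \<partial>P) \<partial>lborel) \<le> (\<integral>\<^sup>+r\<in>{0..s}. ennreal (2 * \<phi> (W r)) \<partial>lborel)"
      using fd_bound s by (intro nn_integral_mono_AE) (auto split: split_indicator elim!: eventually_mono)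
    also have "\<dots> = ennreal (integral {0..s} (\<lambda>r. 2 * \<phi> (W r)))"
      using \<phi>W0[OF s] by (intro nn_integral_has_integral_lebesgue' integrable_integral i\<phi>W s)
    finally have "ennreal (qv s) \<le> ennreal (qv 0) + ennreal (integral {0..s} (\<lambda>r. 2 * \<phi> (W r)))"
      by (simp add: q[OF s] q[OF T0] add_left_mono)
    moreover have "0 \<le> integral {0..s} (\<lambda>r. 2 * \<phi> (W r))"
      using \<phi>W0[OF s] by (intro integral_nonneg i\<phi>W s)
    ultimately show ?thesis using q0 by (simp add: ennreal_le_iff flip: ennreal_plus)
  qed
  \<comment> \<open>Feeding qx \<le> W and the bound on \<open>qv\<close> back into \<open>g\<close>
    closes the system: \<open>W\<close> satisfies an integral inequality in terms of itself alone,
    as \<open>second_order_gronwall\<close> expects.\<close>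
  have W_le: "W s \<le> qx 0 + integral {0..s} (\<lambda>r. L * W r + L * (qv 0 + integral {0..r} (\<lambda>r. 2 * \<phi> (W r))) + \<eta>)"
    if s: "s \<in> {0..T}" for s
  proof -
    have "integral {0..s} g \<le> integral {0..s} (\<lambda>r. L * W r + L * (qv 0 + integral {0..r} (\<lambda>r. 2 * \<phi> (W r))) + \<eta>)"
    proof (rule integral_le[OF gis[OF s]])
      have "continuous_on {0..T} (\<lambda>r. L * W r + L * (qv 0 + integral {0..r} (\<lambda>r. 2 * \<phi> (W r))) + \<eta>)"
        using T by (intro continuous_intros cW indefinite_integral_continuous_1 i\<phi>W) auto
      then show "(\<lambda>r. L * W r + L * (qv 0 + integral {0..r} (\<lambda>r. 2 * \<phi> (W r))) + \<eta>) integrable_on {0..s}"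
        using s by (intro integrable_continuous_real) (auto elim: continuous_on_subset)
      fix r assume "r \<in> {0..s}"
      then have r: "r \<in> {0..T}" using s by auto
      show "g r \<le> L * W r + L * (qv 0 + integral {0..r} (\<lambda>r. 2 * \<phi> (W r))) + \<eta>"
        unfolding g_def using qW[OF r] qv_le[OF r] L by (intro add_mono mult_left_mono) auto
    qed
    then show ?thesis by (simp add: W_def)
  qed
  have "L * (qx 0 + qv 0) + \<eta> \<le> \<delta>"
  proof -
    have "L * (qx 0 + qv 0) \<le> L * (2 * c)" using qc L by (intro mult_left_mono) auto
    then show ?thesis using \<delta> by simp
  qed
  from second_order_gronwall[OF L \<eta> q0(1) q0(2) \<delta>(1) this q0(1) cW qW W_le qv_le t]
  obtain R where R: "R \<ge> 0" "qx t \<le> R" "qv t \<le> exp (L * t) * (\<delta> + sqrt (4 * L * Phi \<phi> R))"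
    "Psi \<phi> \<delta> (2 * L) R \<le> Psi \<phi> \<delta> (2 * L) (qx 0) + exp (L * t) - 1" by auto
  interpret Psi_modulus \<phi> \<delta> "2 * L" using L \<delta> by unfold_locales auto
  have "Psi \<phi> \<delta> (2 * L) (qx 0) \<le> Psi \<phi> \<delta> (2 * L) c" using q0 qc by (intro Psi_mono)
  then show ?thesis
    using R q[OF t] unfolding Qx_def Qv_def dx_def dv_def
    by (intro exI[of _ R]) (auto intro: ennreal_leI)
qed

section \<open>Borel versions of densities, kernels and flows\<close>

lemma lebesgue_ex_borel:
  fixes f :: "'b::euclidean_space \<Rightarrow> 'c::euclidean_space"
  assumes f: "f \<in> borel_measurable lebesgue"
  obtains g where "g \<in> borel_measurable borel" "AE x in lborel. f x = g x"
proof -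
  have "\<exists>g. g \<in> borel_measurable lborel \<and> (AE x in lborel. f x \<bullet> b = g x)" for b
    using completion_ex_borel_measurable_real[of "\<lambda>x. f x \<bullet> b" lborel] borel_measurable_inner[OF f borel_measurable_const]
    by auto
  then obtain g where g: "\<And>b. g b \<in> borel_measurable lborel" "\<And>b. AE x in lborel. f x \<bullet> b = g b x"
    by metis
  have "AE x in lborel. \<forall>b\<in>Basis. f x \<bullet> b = g b x"
    using g(2) by (simp add: AE_finite_all)
  then have "AE x in lborel. f x = (\<Sum>b\<in>Basis. g b x *\<^sub>R b)"
  proof eventually_elim
    case (elim x)
    have "f x = (\<Sum>b\<in>Basis. (f x \<bullet> b) *\<^sub>R b)" by (simp add: euclidean_representation)
    also have "\<dots> = (\<Sum>b\<in>Basis. g b x *\<^sub>R b)" using elim by (intro sum.cong) auto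
    finally show ?case .
  qed
  moreover have "(\<lambda>x. \<Sum>b\<in>Basis. g b x *\<^sub>R b) \<in> borel_measurable borel"
    using g(1) by (intro borel_measurable_sum borel_measurable_scaleR) auto
  ultimately show ?thesis using that by blast
qed

text \<open>True because Lebesgue measure is complete. It supplies measurability of functions that
  are identified only up to null sets, such as \<open>rho f t\<close> and the sections of
  \<open>f t\<close>.\<close>

lemma lebesgue_measurable_AE_cong:
  fixes f :: "'b::euclidean_space \<Rightarrow> 'c::topological_space"
  assumes g: "g \<in> borel_measurable lebesgue" and ae: "AE x in lebesgue. f x = g x"
  shows "f \<in> borel_measurable lebesgue"
proof (rule measurableI)
  fix A :: "'c set" assume A: "A \<in> sets borel"
  have "AE x in lebesgue. x \<in> g -` A \<longleftrightarrow> x \<in> f -` A" using ae by eventually_elim simp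
  then have "f -` A \<in> sets lebesgue"
    by (rule completion.in_sets_AE) (use measurable_sets[OF g A] in auto)
  then show "f -` A \<inter> space lebesgue \<in> sets lebesgue" by simp
qed simp

lemma AE_lborel_null_set:
  assumes "AE x in lborel. Q x"
  obtains N where "N \<in> null_sets lborel" "\<And>x. x \<notin> N \<Longrightarrow> Q x"
  using assms by (auto simp: eventually_ae_filter)

lemma AE_lebesgue_onD:
  assumes "AE x in lebesgue_on S. Q x" "S \<in> sets borel"
  shows "AE x in lborel. x \<in> S \<longrightarrow> Q x"
  using assms by (simp add: AE_restrict_space_iff AE_completion_iff)

text \<open>The flow is Lebesgue measurable in z for each separate time. Borel versions at the
  countably many rational times fail on a single null set; off that set, continuity in time carries
  joint measurability to all times.\<close>

lemma caratheodory_borel_version: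
  fixes \<Gamma> :: "real \<Rightarrow> 'b::euclidean_space \<Rightarrow> 'c::euclidean_space"
  assumes T: "0 \<le> T" and m: "\<And>t. t \<in> {0..T} \<Longrightarrow> \<Gamma> t \<in> borel_measurable lebesgue"
    and cont: "\<And>z. continuous_on {0..T} (\<lambda>t. \<Gamma> t z)"
  obtains G N where "N \<in> null_sets lborel" "(\<lambda>(t, z). G t z) \<in> borel_measurable (borel \<Otimes>\<^sub>M borel)"
    "\<And>t z. t \<in> {0..T} \<Longrightarrow> z \<notin> N \<Longrightarrow> G t z = \<Gamma> t z"
proof -
  \<comment> \<open>Clamping to [0, T] makes every rational time, and every rounded time used below,
    admissible.\<close>
  define cl where "cl t = max 0 (min T t)" for t
  have cl: "cl t \<in> {0..T}" for t using T by (auto simp: cl_def)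
  have cl_id: "t \<in> {0..T} \<Longrightarrow> cl t = t" for t by (auto simp: cl_def)
  have "\<exists>g. g \<in> borel_measurable borel \<and> (AE x in lborel. \<Gamma> (cl q) x = g x)" for q :: real
    using lebesgue_ex_borel[OF m[OF cl]] by metis
  then obtain g where g: "\<And>q. g q \<in> borel_measurable borel" "\<And>q::real. AE x in lborel. \<Gamma> (cl q) x = g q x"
    by metis
  have "AE x in lborel. \<forall>q\<in>\<rat>. \<Gamma> (cl q) x = g q x"
    using g(2) by (subst AE_ball_countable) (auto simp: countable_rat)
  then obtain N where N: "N \<in> null_sets lborel" "\<And>x. x \<notin> N \<Longrightarrow> \<forall>q\<in>\<rat>. \<Gamma> (cl q) x = g q x"
    using AE_lborel_null_set by blast
  define G where "G t z = (if z \<in> N then 0 else \<Gamma> (cl t) z)" for t z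
  have Nb: "N \<in> sets borel" using N(1) by auto
  have Gq: "G q \<in> borel_measurable borel" if "q \<in> \<rat>" for q
  proof -
    have "G q = (\<lambda>z. if z \<in> N then 0 else g q z)" using N(2) that by (auto simp: G_def)
    then show ?thesis using g(1)[of q] Nb by simp
  qed
  \<comment> \<open>Rounding time down to multiples of 1 / (n + 1) leaves countably many rational
    values, at which \<open>G\<close> is Borel; continuity in time gives the convergence to
    \<open>G\<close>.\<close>
  define A where "A n p = G (real_of_int \<lfloor>real (Suc n) * fst p\<rfloor> / real (Suc n)) (snd p)" for n and p :: "real \<times> 'b"
  have "A n \<in> borel_measurable (borel \<Otimes>\<^sub>M borel)" for n
    unfolding A_def
  proof (rule measurable_compose_countable[where f = "\<lambda>i p. G (real_of_int i / real (Suc n)) (snd p)"])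
    show "(\<lambda>p. \<lfloor>real (Suc n) * fst p\<rfloor>) \<in> borel \<Otimes>\<^sub>M borel \<rightarrow>\<^sub>M count_space UNIV" by measurable
    show "(\<lambda>p. G (real_of_int i / real (Suc n)) (snd p)) \<in> borel_measurable (borel \<Otimes>\<^sub>M borel)" for i
      by (rule measurable_compose[OF measurable_snd Gq]) auto
  qed
  moreover have "(\<lambda>n. A n p) \<longlonglongrightarrow> (\<lambda>(t, z). G t z) p" for p
  proof (cases "snd p \<in> N")
    case True
    then show ?thesis by (simp add: A_def G_def case_prod_unfold)
  next
    case False
    let ?a = "\<lambda>n. real_of_int \<lfloor>real (Suc n) * fst p\<rfloor> / real (Suc n)"
    have "?a \<longlonglongrightarrow> fst p"
    proof (rule tendsto_sandwich[of "\<lambda>n. fst p - inverse (real (Suc n))" _ _ "\<lambda>n. fst p"])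
      show "\<forall>\<^sub>F n in sequentially. fst p - inverse (real (Suc n)) \<le> ?a n"
      proof (intro always_eventually allI)
        fix n
        have "real (Suc n) * fst p - 1 \<le> real_of_int \<lfloor>real (Suc n) * fst p\<rfloor>" by linarith
        then have "(real (Suc n) * fst p - 1) / real (Suc n) \<le> ?a n" by (intro divide_right_mono) auto
        then show "fst p - inverse (real (Suc n)) \<le> ?a n" by (simp add: field_simps)
      qed
      show "\<forall>\<^sub>F n in sequentially. ?a n \<le> fst p"
        by (intro always_eventually allI) (simp add: divide_le_eq mult.commute)
      show "(\<lambda>n. fst p - inverse (real (Suc n))) \<longlonglongrightarrow> fst p"
        using tendsto_diff[OF tendsto_const[of "fst p"] LIMSEQ_inverse_real_of_nat] by simp
    qed simp
    then have "(\<lambda>n. cl (?a n)) \<longlonglongrightarrow> cl (fst p)" unfolding cl_def by (intro tendsto_intros)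
    then have "(\<lambda>n. \<Gamma> (cl (?a n)) (snd p)) \<longlonglongrightarrow> \<Gamma> (cl (fst p)) (snd p)"
      by (rule continuous_on_tendsto_compose[OF cont]) (use cl in auto)
    then show ?thesis using False by (simp add: A_def G_def case_prod_unfold)
  qed
  ultimately have "(\<lambda>(t, z). G t z) \<in> borel_measurable (borel \<Otimes>\<^sub>M borel)"
    by (rule borel_measurable_LIMSEQ_metric)
  then show ?thesis using that[OF N(1), of G] by (auto simp: G_def cl_id)
qed

lemma has_leb_density_borel_version:
  fixes \<mu> :: "'b::euclidean_space measure"
  assumes "has_leb_density \<mu> f"
  obtains g where "g \<in> borel_measurable borel" "\<And>x. 0 \<le> g x" "AE x in lborel. f x = g x"
    "\<mu> = density lborel (\<lambda>x. ennreal (g x))" "integrable lborel g"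
proof -
  have fin: "finite_measure \<mu>" and sets: "sets \<mu> = sets borel" and int: "integrable lebesgue f"
    and eq: "\<And>A. A \<in> sets borel \<Longrightarrow> measure \<mu> A = (LINT z:A|lebesgue. f z)"
    using assms by (auto simp: has_leb_density_def)
  interpret finite_measure \<mu> by fact
  obtain h where h[measurable]: "h \<in> borel_measurable borel" and fh: "AE x in lborel. f x = h x"
    using lebesgue_ex_borel[OF borel_measurable_integrable[OF int]] .
  have fh': "AE x in lebesgue. f x = h x" using fh by (rule AE_completion)
  have ih: "integrable lborel h"
  proof -
    have "integrable lebesgue h"
      using int fh' by (subst integrable_cong_AE[symmetric, of f]) (auto intro: measurable_completion)
    then show ?thesis by (simp add: integrable_completion)
  qed
  have eqh: "measure \<mu> A = (LINT z:A|lborel. h z)" if A: "A \<in> sets borel" for A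
  proof -
    have "measure \<mu> A = (LINT z|lebesgue. indicator A z *\<^sub>R f z)"
      using eq[OF A] by (simp add: set_lebesgue_integral_def)
    also have "\<dots> = (LINT z|lebesgue. indicator A z *\<^sub>R h z)"
    proof (rule integral_cong_AE)
      show "(\<lambda>z. indicator A z *\<^sub>R f z) \<in> borel_measurable lebesgue"
        using int A by (intro borel_measurable_scaleR borel_measurable_indicator) (auto intro: sets_completionI_sets)
      show "(\<lambda>z. indicator A z *\<^sub>R h z) \<in> borel_measurable lebesgue"
        using A by (intro measurable_completion borel_measurable_scaleR borel_measurable_indicator) auto
      show "AE x in lebesgue. indicator A x *\<^sub>R f x = indicator A x *\<^sub>R h x"
        using fh' by eventually_elim simp
    qed
    also have "\<dots> = (LINT z|lborel. indicator A z *\<^sub>R h z)"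
      using A by (intro integral_completion) auto
    finally show ?thesis by (simp add: set_lebesgue_integral_def)
  qed
  have h0: "AE x in lborel. 0 \<le> h x"
  proof -
    \<comment> \<open>Over this set the integral of \<open>h\<close> is a measure, hence
      nonnegative, while the integrand is nonpositive; so the integrand vanishes almost everywhere
      and the set is null.\<close>
    let ?B = "{x. h x < 0}"
    have B: "?B \<in> sets borel" by measurable
    have i: "integrable lborel (\<lambda>z. indicator ?B z *\<^sub>R h z)"
      using ih B by (intro integrable_mult_indicator) auto
    have "0 \<le> (LINT z|lborel. indicator ?B z *\<^sub>R h z)"
      using eqh[OF B] by (simp add: set_lebesgue_integral_def) (metis measure_nonneg)
    moreover have "0 \<le> (LINT z|lborel. - (indicator ?B z *\<^sub>R h z))"
      by (intro Bochner_Integration.integral_nonneg) (auto split: split_indicator)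
    ultimately have "(LINT z|lborel. - (indicator ?B z *\<^sub>R h z)) = 0" by simp
    then have "AE z in lborel. - (indicator ?B z *\<^sub>R h z) = 0"
      using integral_nonneg_eq_0_iff_AE[of lborel "\<lambda>z. - (indicator ?B z *\<^sub>R h z)"] i
      by (auto split: split_indicator)
    then show ?thesis by eventually_elim (auto simp: indicator_def split: if_splits)
  qed
  define g where "g x = max 0 (h x)" for x
  have gm[measurable]: "g \<in> borel_measurable borel" unfolding g_def[abs_def] by measurable
  have gh: "AE x in lborel. h x = g x" using h0 by eventually_elim (simp add: g_def)
  have ig: "integrable lborel g" using ih unfolding g_def[abs_def] by simp
  have "\<mu> = density lborel (\<lambda>x. ennreal (g x))"
  proof (rule measure_eqI)
    fix A assume "A \<in> sets \<mu>"
    then have A: "A \<in> sets borel" using sets by simp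
    have "emeasure \<mu> A = ennreal (LINT z:A|lborel. h z)" by (simp add: emeasure_eq_measure eqh[OF A])
    also have "(LINT z:A|lborel. h z) = (LINT z|lborel. indicator A z *\<^sub>R g z)"
      unfolding set_lebesgue_integral_def
      using A gh by (intro integral_cong_AE) (auto elim!: eventually_mono)
    also have "ennreal \<dots> = (\<integral>\<^sup>+z. ennreal (indicator A z *\<^sub>R g z) \<partial>lborel)"
      using A by (intro nn_integral_eq_integral[symmetric] integrable_mult_indicator ig)
        (auto simp: g_def split: split_indicator)
    also have "\<dots> = (\<integral>\<^sup>+z. ennreal (g z) * indicator A z \<partial>lborel)"
      by (intro nn_integral_cong) (auto split: split_indicator)
    finally show "emeasure \<mu> A = emeasure (density lborel (\<lambda>x. ennreal (g x))) A"
      using A by (simp add: emeasure_density)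
  qed (simp add: sets)
  moreover have "AE x in lborel. f x = g x" using fh gh by eventually_elim simp
  ultimately show ?thesis by (intro that[OF gm _ _ _ ig]) (simp_all add: g_def)
qed

lemma has_leb_density_unique:
  assumes "has_leb_density \<mu> f" "has_leb_density \<mu> g"
  shows "AE x in lebesgue. f x = g x"
proof -
  obtain f' where f': "f' \<in> borel_measurable borel" "\<And>x. 0 \<le> f' x" "AE x in lborel. f x = f' x"
    "\<mu> = density lborel (\<lambda>x. ennreal (f' x))"
    using has_leb_density_borel_version[OF assms(1)] by metis
  obtain g' where g': "g' \<in> borel_measurable borel" "\<And>x. 0 \<le> g' x" "AE x in lborel. g x = g' x"
    "\<mu> = density lborel (\<lambda>x. ennreal (g' x))"
    using has_leb_density_borel_version[OF assms(2)] by metis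
  have "finite_measure \<mu>" using assms(1) by (simp add: has_leb_density_def)
  then have "sigma_finite_measure (density lborel (\<lambda>x. ennreal (f' x)))"
    by (simp add: f'(4) finite_measure.axioms(1))
  then have "AE x in lborel. ennreal (f' x) = ennreal (g' x)"
    using sigma_finite_density_unique[of "\<lambda>x. ennreal (f' x)" lborel "\<lambda>x. ennreal (g' x)"] f' g' by auto
  with f'(3) g'(3) have "AE x in lborel. f x = g x"
    by eventually_elim (use f'(2) g'(2) in auto)
  then show ?thesis by (rule AE_completion)
qed

text \<open>\<open>rho\<close> is defined by an integral with default value 0 for non-integrable
  sections. As the total mass is finite, almost every section is integrable, so \<open>rho\<close>
  is indeed the density of the position marginal.\<close>

lemma rho_borel_version:
  fixes f :: "real \<Rightarrow> 'a::euclidean_space \<times> 'a \<Rightarrow> real"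
  assumes "has_leb_density \<mu> (f t)"
  obtains r where "r \<in> borel_measurable borel" "\<And>x. 0 \<le> r x" "AE x in lborel. rho f t x = r x"
    "distr \<mu> borel fst = density lborel (\<lambda>x. ennreal (r x))"
proof -
  obtain g where g[measurable]: "g \<in> borel_measurable borel" and g0: "\<And>x. 0 \<le> g x"
    and fg: "AE x in lborel. f t x = g x" and \<mu>: "\<mu> = density lborel (\<lambda>x. ennreal (g x))" and gi: "integrable lborel g"
    by (rule has_leb_density_borel_version[OF assms]) blast
  have gm[measurable]: "g \<in> borel_measurable (borel \<Otimes>\<^sub>M borel)" using g by (simp add: borel_prod)
  have gx: "(\<lambda>v. g (x, v)) \<in> borel_measurable borel" for x
    by (rule measurable_compose[OF _ gm]) simp
  define R where "R x = (\<integral>\<^sup>+v. ennreal (g (x, v)) \<partial>lborel)" for x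
  have gm2: "(\<lambda>p. ennreal (g p)) \<in> borel_measurable (lborel \<Otimes>\<^sub>M lborel)" using gm by simp
  have Rm[measurable]: "R \<in> borel_measurable borel"
    using lborel.borel_measurable_nn_integral_fst[OF gm2] by (simp add: R_def[abs_def])
  have "(\<integral>\<^sup>+x. R x \<partial>lborel) = (\<integral>\<^sup>+p. ennreal (g p) \<partial>lborel)"
    using lborel.nn_integral_fst[OF gm2] by (simp add: R_def lborel_prod)
  also have "\<dots> < \<infinity>" using gi g0 by (simp add: nn_integral_eq_integral)
  finally have Rfin: "AE x in lborel. R x \<noteq> \<infinity>"
    by (intro nn_integral_noteq_infinite) auto
  define r where "r x = enn2real (R x)" for x
  have rm[measurable]: "r \<in> borel_measurable borel" unfolding r_def[abs_def] by measurable
  have Rr: "AE x in lborel. R x = ennreal (r x)"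
    using Rfin by eventually_elim (simp add: r_def ennreal_enn2real_if)
  have "AE p in lborel \<Otimes>\<^sub>M lborel. f t p = g p" using fg unfolding lborel_prod .
  then have "AE x in lborel. AE v in lborel. f t (x, v) = g (x, v)" by (rule lborel_pair.AE_pair)
  with Rr have rho: "AE x in lborel. rho f t x = r x"
  proof eventually_elim
    case (elim x)
    have ae: "AE v in lebesgue. f t (x, v) = g (x, v)" using elim(2) by (rule AE_completion)
    have "rho f t x = (LINT v|lebesgue. g (x, v))"
      unfolding rho_def
    proof (rule integral_cong_AE[OF _ _ ae])
      show gL: "(\<lambda>v. g (x, v)) \<in> borel_measurable lebesgue" using gx by (intro measurable_completion) auto
      show "(\<lambda>v. f t (x, v)) \<in> borel_measurable lebesgue"
        by (rule lebesgue_measurable_AE_cong[OF gL ae])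
    qed
    also have "\<dots> = (LINT v|lborel. g (x, v))" using gx by (intro integral_completion) auto
    also have "\<dots> = enn2real (R x)" unfolding R_def using gx g0 by (intro integral_eq_nn_integral) auto
    finally show ?case by (simp add: r_def)
  qed
  have "distr \<mu> borel fst = density lborel (\<lambda>x. ennreal (r x))"
  proof (rule measure_eqI)
    fix A :: "'a set" assume "A \<in> sets (distr \<mu> borel fst)"
    then have A[measurable]: "A \<in> sets borel" by simp
    have AU: "fst -` A \<in> sets (borel :: ('a \<times> 'a) measure)" using measurable_sets[OF fst_borel A] by simp
    have m: "(\<lambda>p. ennreal (g p) * indicator (fst -` A) p) \<in> borel_measurable (lborel \<Otimes>\<^sub>M lborel)"
      using AU unfolding lborel_prod
      by (intro borel_measurable_times_ennreal gm2[unfolded lborel_prod] borel_measurable_indicator) simp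
    have "emeasure (distr \<mu> borel fst) A = (\<integral>\<^sup>+p. ennreal (g p) * indicator (fst -` A) p \<partial>lborel)"
      using fst_borel AU A by (subst emeasure_distr) (auto simp: \<mu> emeasure_density)
    also have "\<dots> = (\<integral>\<^sup>+x. \<integral>\<^sup>+v. ennreal (g (x, v)) * indicator (fst -` A) (x, v) \<partial>lborel \<partial>lborel)"
      using lborel.nn_integral_fst[OF m] by (simp add: lborel_prod)
    also have "\<dots> = (\<integral>\<^sup>+x. R x * indicator A x \<partial>lborel)"
    proof (intro nn_integral_cong)
      fix x :: 'a
      have "(\<integral>\<^sup>+v. ennreal (g (x, v)) * indicator (fst -` A) (x, v) \<partial>lborel) = (\<integral>\<^sup>+v. ennreal (g (x, v)) * indicator A x \<partial>lborel)"
        by (intro nn_integral_cong) (auto split: split_indicator)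
      also have "\<dots> = R x * indicator A x" unfolding R_def using gx by (intro nn_integral_multc) auto
      finally show "(\<integral>\<^sup>+v. ennreal (g (x, v)) * indicator (fst -` A) (x, v) \<partial>lborel) = R x * indicator A x" .
    qed
    also have "\<dots> = (\<integral>\<^sup>+x. ennreal (r x) * indicator A x \<partial>lborel)"
      using Rr by (intro nn_integral_cong_AE) (auto elim!: eventually_mono)
    finally show "emeasure (distr \<mu> borel fst) A = emeasure (density lborel (\<lambda>x. ennreal (r x))) A"
      by (simp add: emeasure_density)
  qed simp
  then show ?thesis using that[OF rm _ rho] by (simp add: r_def)
qed

lemma AE_lborel_swap:
  assumes "AE p in (lborel :: ('a::euclidean_space \<times> 'b::euclidean_space) measure). Q p"
  shows "AE p in lborel. Q (snd p, fst p)"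
proof -
  have "AE p in lborel \<Otimes>\<^sub>M lborel. Q p" using assms unfolding lborel_prod .
  then have "AE p in distr (lborel \<Otimes>\<^sub>M lborel) (lborel \<Otimes>\<^sub>M lborel) (\<lambda>(x :: 'b, y :: 'a). (y, x)). Q p"
    by (subst (asm) lborel_pair.distr_pair_swap)
  from AE_distrD[OF measurable_pair_swap' this] show ?thesis
    unfolding lborel_prod by (auto simp: case_prod_unfold)
qed

lemma AE_lborel_fubini:
  assumes "AE p in (lborel :: ('a::euclidean_space \<times> 'b::euclidean_space) measure). Q p"
  shows "AE x in lborel. AE y in lborel. Q (x, y)"
  using assms unfolding lborel_prod[symmetric] by (rule lborel_pair.AE_pair)

text \<open>The kernel will be evaluated along trajectories, which calls for a Borel version. It
  represents \<open>K x\<close> for x outside a null set \<open>N\<close> of first arguments, which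
  positions avoid by \<open>AE_law\<close>; antisymmetry is put into the iterated form used by
  \<open>nn_integral_field_difference\<close>.\<close>

lemma antisym_kernel_borel_version:
  fixes K :: "'a::euclidean_space \<Rightarrow> 'a \<Rightarrow> 'a"
  assumes "antisym_kernel K"
  obtains k N where "N \<in> null_sets lborel" "(\<lambda>(x, y). k x y) \<in> borel_measurable (borel \<Otimes>\<^sub>M borel)"
    "\<And>x. x \<notin> N \<Longrightarrow> AE y in lborel. K x y = k x y" "AE y in lborel. AE x in lborel. k x y = - k y x"
proof -
  have K: "(\<lambda>(x, y). K x y) \<in> borel_measurable lebesgue" and anti: "AE p in lborel. K (fst p) (snd p) = - K (snd p) (fst p)"
    using assms by (auto simp: antisym_kernel_def AE_completion_iff case_prod_unfold)
  obtain k' where k': "k' \<in> borel_measurable borel" "AE p in lborel. (\<lambda>(x, y). K x y) p = k' p"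
    using lebesgue_ex_borel[OF K] .
  define k where "k x y = k' (x, y)" for x y
  have km: "(\<lambda>(x, y). k x y) \<in> borel_measurable (borel \<Otimes>\<^sub>M borel)"
    using k'(1) unfolding borel_prod by (simp add: k_def case_prod_unfold)
  have kK: "AE p in lborel. K (fst p) (snd p) = k (fst p) (snd p)"
    using k'(2) by (simp add: k_def case_prod_unfold)
  have "AE x in lborel. AE y in lborel. K x y = k x y"
    using AE_lborel_fubini[OF kK] by simp
  then obtain N where N: "N \<in> null_sets lborel" "\<And>x. x \<notin> N \<Longrightarrow> AE y in lborel. K x y = k x y"
    using AE_lborel_null_set by blast
  have "AE p in lborel. k (snd p) (fst p) = - k (fst p) (snd p)"
    using anti kK AE_lborel_swap[OF kK] by eventually_elim (metis fst_conv snd_conv minus_minus)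
  from AE_lborel_fubini[OF this] have "AE y in lborel. AE x in lborel. k x y = - k y x" by simp
  then show ?thesis using that[of N k] N km by blast
qed

lemma absolutely_continuous_marginal:
  fixes \<mu> :: "('a::euclidean_space \<times> 'a) measure"
  assumes "has_leb_density \<mu> g"
  shows "absolutely_continuous lborel (distr \<mu> borel fst)"
proof -
  obtain r where "r \<in> borel_measurable borel" "distr \<mu> borel fst = density lborel (\<lambda>x. ennreal (r x))"
    using rho_borel_version[where f = "\<lambda>_. g" and t = 0, OF assms] by metis
  then show ?thesis by (simp add: absolutely_continuousI_density)
qed

text \<open>Turns the bounds in the definition of a weak solution into expectations under \<mu>. The
  absolute value disappears because the marginal density is nonnegative almost everywhere.\<close>

lemma nn_integral_rho:
  fixes \<mu> :: "('a::euclidean_space \<times> 'a) measure" and h h' :: "'a \<Rightarrow> ennreal"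
  assumes dens: "has_leb_density \<mu> (f t)"
    and h': "h' \<in> borel_measurable borel" "AE y in lborel. h y = h' y"
  shows "(\<integral>\<^sup>+y. h y * ennreal \<bar>rho f t y\<bar> \<partial>lebesgue) = (\<integral>\<^sup>+\<zeta>. h' (fst \<zeta>) \<partial>\<mu>)"
proof -
  obtain r where r: "r \<in> borel_measurable borel" "\<And>x. 0 \<le> r x" "AE x in lborel. rho f t x = r x"
    "distr \<mu> borel fst = density lborel (\<lambda>x. ennreal (r x))"
    using rho_borel_version[where f = f and t = t, OF dens] by metis
  have \<mu>b: "sets \<mu> = sets borel" using dens by (simp add: has_leb_density_def)
  have fm: "fst \<in> borel_measurable \<mu>" using measurable_cong_sets[OF \<mu>b refl] fst_borel by blast
  have "(\<integral>\<^sup>+y. h y * ennreal \<bar>rho f t y\<bar> \<partial>lebesgue) = (\<integral>\<^sup>+y. h y * ennreal \<bar>rho f t y\<bar> \<partial>lborel)"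
    by (rule nn_integral_completion)
  also have "\<dots> = (\<integral>\<^sup>+y. ennreal (r y) * h' y \<partial>lborel)"
    using r(3) h'(2) by (intro nn_integral_cong_AE, eventually_elim) (use r(2) in \<open>simp add: mult.commute\<close>)
  also have "\<dots> = (\<integral>\<^sup>+y. h' y \<partial>distr \<mu> borel fst)"
    unfolding r(4) using r(1) h'(1) by (intro nn_integral_density[symmetric]) auto
  also have "\<dots> = (\<integral>\<^sup>+\<zeta>. h' (fst \<zeta>) \<partial>\<mu>)" using h'(1) by (intro nn_integral_distr fm) auto
  finally show ?thesis .
qed

text \<open>Counterpart of \<open>nn_integral_rho\<close> for the vector-valued field. Every step is
  an identity of Bochner integrals, so points where the integral diverges are covered as
  well.\<close>

lemma field_eq_integral:
  fixes \<mu> :: "('a::euclidean_space \<times> 'a) measure" and k :: "'a \<Rightarrow> 'a"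
  assumes dens: "has_leb_density \<mu> (f t)"
    and K: "K x \<in> borel_measurable lebesgue" and k: "k \<in> borel_measurable borel" "AE y in lborel. K x y = k y"
  shows "field K f t x = (\<integral>\<zeta>. k (fst \<zeta>) \<partial>\<mu>)"
proof -
  obtain r where r: "r \<in> borel_measurable borel" "\<And>x. 0 \<le> r x" "AE x in lborel. rho f t x = r x"
    "distr \<mu> borel fst = density lborel (\<lambda>x. ennreal (r x))"
    using rho_borel_version[where f = f and t = t, OF dens] by metis
  have \<mu>b: "sets \<mu> = sets borel" using dens by (simp add: has_leb_density_def)
  have fm: "fst \<in> borel_measurable \<mu>" using measurable_cong_sets[OF \<mu>b refl] fst_borel by blast
  have rL: "r \<in> borel_measurable lebesgue" using r(1) by (intro measurable_completion) auto
  have ae: "AE y in lebesgue. rho f t y = r y" using r(3) by (rule AE_completion)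
  have rhoL: "rho f t \<in> borel_measurable lebesgue" by (rule lebesgue_measurable_AE_cong[OF rL ae])
  have "field K f t x = (LINT y|lebesgue. r y *\<^sub>R k y)"
    unfolding field_def
  proof (rule integral_cong_AE)
    show "(\<lambda>y. r y *\<^sub>R k y) \<in> borel_measurable lebesgue"
      by (intro measurable_completion borel_measurable_scaleR) (simp_all add: r(1) k(1))
    show "AE y in lebesgue. rho f t y *\<^sub>R K x y = r y *\<^sub>R k y"
      using ae AE_completion[OF k(2)] by eventually_elim (simp only:)
    show "(\<lambda>y. rho f t y *\<^sub>R K x y) \<in> borel_measurable lebesgue"
      by (rule borel_measurable_scaleR[OF rhoL K])
  qed
  also have "\<dots> = (LINT y|lborel. r y *\<^sub>R k y)"
    by (intro integral_completion borel_measurable_scaleR) (simp_all add: r(1) k(1))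
  also have "\<dots> = (\<integral>y. k y \<partial>distr \<mu> borel fst)"
    unfolding r(4) by (rule integral_density[symmetric]) (simp_all add: r(1,2) k(1))
  also have "\<dots> = (\<integral>\<zeta>. k (fst \<zeta>) \<partial>\<mu>)" using k(1) by (intro integral_distr fm) auto
  finally show ?thesis .
qed

section \<open>Flows as solutions of the integral equation\<close>

lemma is_flow_continuous:
  assumes "is_flow T F E \<Gamma>"
  shows "continuous_on {0..T} (\<lambda>t. \<Gamma> t z)"
proof -
  let ?h = "\<lambda>s. (F s (\<Gamma> s z), E s (fst (\<Gamma> s z)))"
  note flow = assms[unfolded is_flow_def, THEN spec[of _ z]]
  note i = flow[THEN conjunct1] and eq = flow[THEN conjunct2, THEN bspec]
  have "\<Gamma> t z = z + integral {0..t} ?h" if t: "t \<in> {0..T}" for t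
  proof -
    have "set_integrable lebesgue {0..t} ?h" by (rule set_integrable_subset[OF i]) (use t in auto)
    from set_lebesgue_integral_eq_integral(2)[OF this] show ?thesis using eq[OF t] by (simp only:)
  qed
  moreover have "continuous_on {0..T} (\<lambda>t. z + integral {0..t} ?h)"
    using set_lebesgue_integral_eq_integral(1)[OF i]
    by (intro continuous_intros indefinite_integral_continuous_1)
  ultimately show ?thesis by (subst continuous_on_cong[OF refl])
qed

lemma is_flow_0:
  assumes "is_flow T F E \<Gamma>" "0 \<le> T"
  shows "\<Gamma> 0 z = z"
proof -
  let ?h = "\<lambda>s. (F s (\<Gamma> s z), E s (fst (\<Gamma> s z)))"
  note flow = assms(1)[unfolded is_flow_def, THEN spec[of _ z]]
  have "\<Gamma> 0 z = z + (LINT s:{0..0}|lebesgue. ?h s)"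
    by (rule flow[THEN conjunct2, THEN bspec]) (use assms(2) in simp)
  also have "(LINT s:{0..0}|lebesgue. ?h s) = (LINT s|(lebesgue :: real measure). 0)"
    unfolding set_lebesgue_integral_def
  proof (rule integral_cong_AE)
    have ae: "AE s in lebesgue. indicator {0..0::real} s *\<^sub>R ?h s = 0"
      by (rule AE_completion, rule AE_mp[OF AE_lborel_singleton[of 0]]) (auto simp: zero_prod_def split: split_indicator)
    then show "AE s in lebesgue. indicator {0..0::real} s *\<^sub>R ?h s = 0" .
    show "(\<lambda>s. indicator {0..0::real} s *\<^sub>R ?h s) \<in> borel_measurable lebesgue"
      by (rule lebesgue_measurable_AE_cong[OF _ ae]) simp
  qed simp
  finally show ?thesis by simp
qed

lemma set_integral_difference_bound:
  fixes h1 h2 :: "real \<Rightarrow> 'b::euclidean_space"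
  assumes "set_integrable lebesgue {0..T} h1" "set_integrable lebesgue {0..T} h2" and t: "t \<in> {0..T}"
  shows "ennreal (norm ((x + (LINT s:{0..t}|lebesgue. h1 s)) - (y + (LINT s:{0..t}|lebesgue. h2 s))))
    \<le> ennreal (norm (x - y)) + (\<integral>\<^sup>+s\<in>{0..t}. ennreal (norm (h1 s - h2 s)) \<partial>lborel)"
proof -
  have i: "set_integrable lebesgue {0..t} h1" "set_integrable lebesgue {0..t} h2"
    by (rule set_integrable_subset[OF assms(1)], use t in auto) (rule set_integrable_subset[OF assms(2)], use t in auto)
  let ?I = "LINT s:{0..t}|lebesgue. h1 s - h2 s"
  have "norm ((x + (LINT s:{0..t}|lebesgue. h1 s)) - (y + (LINT s:{0..t}|lebesgue. h2 s))) = norm ((x - y) + ?I)"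
    unfolding set_integral_diff(2)[OF i] by (simp add: algebra_simps)
  also have "ennreal \<dots> \<le> ennreal (norm (x - y)) + ennreal (norm ?I)"
    by (simp add: norm_triangle_ineq flip: ennreal_plus)
  also have "ennreal (norm ?I) \<le> (\<integral>\<^sup>+s. ennreal (norm (indicator {0..t} s *\<^sub>R (h1 s - h2 s))) \<partial>lebesgue)"
    unfolding set_lebesgue_integral_def using set_integral_diff(1)[OF i]
    by (intro integral_norm_bound_ennreal) (simp add: set_integrable_def)
  also have "\<dots> = (\<integral>\<^sup>+s\<in>{0..t}. ennreal (norm (h1 s - h2 s)) \<partial>lborel)"
    unfolding nn_integral_completion by (intro nn_integral_cong) (auto split: split_indicator)
  finally show ?thesis by (simp add: add_left_mono)
qed

lemma set_integral_bounded_linear: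
  assumes T: "bounded_linear g" and f: "set_integrable M A f"
  shows "set_integrable M A (\<lambda>x. g (f x))" "(LINT x:A|M. g (f x)) = g (LINT x:A|M. f x)"
proof -
  interpret bounded_linear g by fact
  show "set_integrable M A (\<lambda>x. g (f x))"
    using integrable_bounded_linear[OF T f[unfolded set_integrable_def]] by (simp add: set_integrable_def scaleR)
  show "(LINT x:A|M. g (f x)) = g (LINT x:A|M. f x)"
    using integral_bounded_linear[OF T f[unfolded set_integrable_def]] by (simp add: set_lebesgue_integral_def scaleR)
qed

lemma is_flow_components:
  assumes "is_flow T F E \<Gamma>"
  shows "set_integrable lebesgue {0..T} (\<lambda>s. F s (\<Gamma> s z))" "set_integrable lebesgue {0..T} (\<lambda>s. E s (fst (\<Gamma> s z)))"
    "t \<in> {0..T} \<Longrightarrow> fst (\<Gamma> t z) = fst z + (LINT s:{0..t}|lebesgue. F s (\<Gamma> s z))"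
    "t \<in> {0..T} \<Longrightarrow> snd (\<Gamma> t z) = snd z + (LINT s:{0..t}|lebesgue. E s (fst (\<Gamma> s z)))"
proof -
  let ?h = "\<lambda>s. (F s (\<Gamma> s z), E s (fst (\<Gamma> s z)))"
  note flow = assms[unfolded is_flow_def, THEN spec[of _ z]]
  note i = flow[THEN conjunct1] and eq = flow[THEN conjunct2, THEN bspec]
  show "set_integrable lebesgue {0..T} (\<lambda>s. F s (\<Gamma> s z))" "set_integrable lebesgue {0..T} (\<lambda>s. E s (fst (\<Gamma> s z)))"
    using set_integral_bounded_linear(1)[OF bounded_linear_fst i] set_integral_bounded_linear(1)[OF bounded_linear_snd i] by auto
  assume t: "t \<in> {0..T}"
  have i': "set_integrable lebesgue {0..t} ?h" by (rule set_integrable_subset[OF i]) (use t in auto)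
  show "fst (\<Gamma> t z) = fst z + (LINT s:{0..t}|lebesgue. F s (\<Gamma> s z))"
    "snd (\<Gamma> t z) = snd z + (LINT s:{0..t}|lebesgue. E s (fst (\<Gamma> s z)))"
    using eq[OF t] set_integral_bounded_linear(2)[OF bounded_linear_fst i'] set_integral_bounded_linear(2)[OF bounded_linear_snd i']
    by auto
qed

section \<open>Essential bounds made valid at almost every time for all points\<close>

lemma AE_all_le_continuous:
  fixes g :: "'b::euclidean_space \<Rightarrow> real"
  assumes "AE z in lborel. g z \<le> a" "continuous_on UNIV g"
  shows "g z \<le> a"
proof -
  obtain N where N: "N \<in> null_sets lborel" "\<And>z. z \<notin> N \<Longrightarrow> g z \<le> a"
    using AE_lborel_null_set[OF assms(1)] by metis
  obtain D where D: "countable D" "D \<inter> N = {}" "closure D = UNIV" using countable_dense_off_null[OF N(1)] .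
  show ?thesis
    by (rule continuous_le_on_closure[of D g]) (use D N assms(2) in auto)
qed

lemma continuous_le_dense2:
  fixes g :: "'b::euclidean_space \<Rightarrow> 'b \<Rightarrow> real"
  assumes D: "closure D = UNIV" and le: "\<And>z w. z \<in> D \<Longrightarrow> w \<in> D \<Longrightarrow> g z w \<le> 0"
    and c: "\<And>z. continuous_on UNIV (g z)" "\<And>w. continuous_on UNIV (\<lambda>z. g z w)"
  shows "g z w \<le> 0"
proof -
  have "g z w \<le> 0" if "z \<in> D" for z w
    using continuous_le_on_closure[of D "g z" w 0] D le that c(1) by simp
  then show ?thesis
    using continuous_le_on_closure[of D "\<lambda>z. g z w" z 0] D c(2) by simp
qed

text \<open>The exceptional times in the hypothesis depend on the two points. Countably many pairs
  from a dense set share one null set of times, and continuity of F(t, .) extends the bound to all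
  pairs, hence to points moving along trajectories.\<close>

lemma ess_lipschitz_AE:
  fixes F :: "real \<Rightarrow> 'a \<times> 'a \<Rightarrow> 'a::euclidean_space"
  assumes F: "Linf_C T F" "ess_lipschitz T L F" and L: "0 \<le> L"
  shows "AE t in lborel. t \<in> {0..T} \<longrightarrow> continuous_on UNIV (F t) \<and>
    (\<forall>z w. norm (F t z - F t w) \<le> L * (norm (fst z - fst w) + norm (snd z - snd w)))"
proof -
  obtain D :: "('a \<times> 'a) set" where D: "countable D" "closure D = UNIV"
    using countable_dense_off_null[of "{}"] by auto
  have 1: "AE t in lborel. t \<in> {0..T} \<longrightarrow> norm (F t z - F t w) \<le> L * (norm (fst z - fst w) + norm (snd z - snd w))" for z w
  proof -
    have "esssup (lebesgue_on {0..T}) (\<lambda>t. ennreal (norm (F t z - F t w))) \<le> ennreal (L * (norm (fst z - fst w) + norm (snd z - snd w)))"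
      using F(2)[unfolded ess_lipschitz_def, rule_format, of "fst z" "snd z" "fst w" "snd w"] by simp
    then have "AE t in lebesgue_on {0..T}. ennreal (norm (F t z - F t w)) \<le> ennreal (L * (norm (fst z - fst w) + norm (snd z - snd w)))"
      using esssup_AE[of "\<lambda>t. ennreal (norm (F t z - F t w))" "lebesgue_on {0..T}"]
      by (auto elim!: eventually_mono intro: order_trans)
    from AE_lebesgue_onD[OF this] have "AE t in lborel. t \<in> {0..T} \<longrightarrow>
        ennreal (norm (F t z - F t w)) \<le> ennreal (L * (norm (fst z - fst w) + norm (snd z - snd w)))" by simp
    then show ?thesis by eventually_elim (use L in \<open>auto simp: ennreal_le_iff\<close>)
  qed
  have "AE t in lborel. \<forall>z\<in>D. \<forall>w\<in>D. t \<in> {0..T} \<longrightarrow> norm (F t z - F t w) \<le> L * (norm (fst z - fst w) + norm (snd z - snd w))"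
    unfolding AE_ball_countable[OF D(1)] using 1 by blast
  moreover have "AE t in lborel. t \<in> {0..T} \<longrightarrow> continuous_on UNIV (F t)"
    using F(1) AE_lebesgue_onD[where S = "{0..T}" and Q = "\<lambda>t. continuous_on UNIV (F t)"] by (simp add: Linf_C_def)
  ultimately show ?thesis
  proof eventually_elim
    case (elim t)
    show ?case
    proof (intro impI conjI allI)
      assume t: "t \<in> {0..T}"
      show c: "continuous_on UNIV (F t)" using elim t by simp
      fix z w
      have "norm (F t z - F t w) - L * (norm (fst z - fst w) + norm (snd z - snd w)) \<le> 0"
      proof (rule continuous_le_dense2[OF D(2), where g = "\<lambda>z w. norm (F t z - F t w) - L * (norm (fst z - fst w) + norm (snd z - snd w))"])
        have c': "continuous_on UNIV (\<lambda>z. F t z)" using c by simp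
        show "continuous_on UNIV (\<lambda>w. norm (F t z - F t w) - L * (norm (fst z - fst w) + norm (snd z - snd w)))" for z
          by (intro continuous_intros c')
        show "continuous_on UNIV (\<lambda>z. norm (F t z - F t w) - L * (norm (fst z - fst w) + norm (snd z - snd w)))" for w
          by (intro continuous_intros c')
      qed (use elim(1) t in auto)
      then show "norm (F t z - F t w) \<le> L * (norm (fst z - fst w) + norm (snd z - snd w))" by simp
    qed
  qed
qed

text \<open>Fubini gives, at almost every time, the bound at almost every point; continuity of both
  fields then removes the exceptional points.\<close>

lemma Linf_norm_AE:
  fixes F1 F2 :: "real \<Rightarrow> 'a \<times> 'a \<Rightarrow> 'a::euclidean_space"
  assumes F: "Linf_C T F1" "Linf_C T F2" and \<eta>: "Linf_norm T (\<lambda>t z. F1 t z - F2 t z) \<le> ennreal \<eta>" "0 \<le> \<eta>"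
  shows "AE t in lborel. t \<in> {0..T} \<longrightarrow> (\<forall>z. norm (F1 t z - F2 t z) \<le> \<eta>)"
proof -
  have "AE p in lebesgue_on ({0..T} \<times> UNIV). ennreal (norm (F1 (fst p) (snd p) - F2 (fst p) (snd p))) \<le> ennreal \<eta>"
    using esssup_AE[of "\<lambda>(t, z). ennreal (norm (F1 t z - F2 t z))" "lebesgue_on ({0..T} \<times> UNIV)"] \<eta>(1)
    unfolding Linf_norm_def by (auto elim!: eventually_mono intro: order_trans)
  from AE_lebesgue_onD[OF this]
  have "AE p in lborel. p \<in> {0..T} \<times> UNIV \<longrightarrow> norm (F1 (fst p) (snd p) - F2 (fst p) (snd p)) \<le> \<eta>"
    using \<eta>(2) by (simp add: ennreal_le_iff borel_closed closed_Times)
  from AE_lborel_fubini[OF this]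
  have "AE t in lborel. AE z in lborel. t \<in> {0..T} \<longrightarrow> norm (F1 t z - F2 t z) \<le> \<eta>" by simp
  moreover have "AE t in lborel. t \<in> {0..T} \<longrightarrow> continuous_on UNIV (F1 t)" "AE t in lborel. t \<in> {0..T} \<longrightarrow> continuous_on UNIV (F2 t)"
    using F AE_lebesgue_onD[where S = "{0..T}" and Q = "\<lambda>t. continuous_on UNIV (F1 t)"]
      AE_lebesgue_onD[where S = "{0..T}" and Q = "\<lambda>t. continuous_on UNIV (F2 t)"] by (simp_all add: Linf_C_def)
  ultimately show ?thesis
  proof eventually_elim
    case (elim t)
    show ?case
    proof (intro impI allI)
      fix z assume t: "t \<in> {0..T}"
      show "norm (F1 t z - F2 t z) \<le> \<eta>"
      proof (rule AE_all_le_continuous[where g = "\<lambda>z. norm (F1 t z - F2 t z)"])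
        have c: "continuous_on UNIV (\<lambda>z. F1 t z)" "continuous_on UNIV (\<lambda>z. F2 t z)" using elim(2,3) t by auto
        show "continuous_on UNIV (\<lambda>z. norm (F1 t z - F2 t z))" by (intro continuous_intros c)
        show "AE z in lborel. norm (F1 t z - F2 t z) \<le> \<eta>" using elim(1) t by simp
      qed
    qed
  qed
qed

text \<open>The push-forward of the a priori signed \<open>f0\<close> becomes an ordinary image
  measure under a Borel flow, because \<open>f0\<close> is the density of \<open>\<mu>0\<close> and
  does not see the null set on which the flow was modified. That \<open>\<mu>0\<close> has mass 1
  follows by testing with the whole space at time 0.\<close>

lemma lagrangian_borel_flow:
  fixes f0 :: "'a::euclidean_space \<times> 'a \<Rightarrow> real"
  assumes T: "0 \<le> T" and lag: "lagrangian_weak_phi_solution T K \<phi> F f0 f"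
    and dens: "\<And>t. t \<in> {0..T} \<Longrightarrow> has_leb_density (\<mu> t) (f t)" and dens0: "has_leb_density \<mu>0 f0"
    and P1: "\<And>t. t \<in> {0..T} \<Longrightarrow> \<mu> t \<in> P1"
  obtains \<Gamma> G N where "is_flow T F (field K f) \<Gamma>" "N \<in> null_sets lborel"
    "(\<lambda>(t, z). G t z) \<in> borel_measurable (borel \<Otimes>\<^sub>M borel)"
    "\<And>t z. t \<in> {0..T} \<Longrightarrow> z \<notin> N \<Longrightarrow> G t z = \<Gamma> t z"
    "\<And>t. t \<in> {0..T} \<Longrightarrow> distr \<mu>0 borel (G t) = \<mu> t"
    "prob_space \<mu>0" "sets \<mu>0 = sets borel" "absolutely_continuous lborel \<mu>0"
proof -
  obtain \<Gamma> where flow: "is_flow T F (field K f) \<Gamma>" and push: "\<And>t. t \<in> {0..T} \<Longrightarrow> pushes_forward (\<Gamma> t) f0 (f t)"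
    using lag by (auto simp: lagrangian_weak_phi_solution_def)
  have \<Gamma>m: "\<Gamma> t \<in> borel_measurable lebesgue" if "t \<in> {0..T}" for t
    using push[OF that] by (simp add: pushes_forward_def)
  obtain G N where N: "N \<in> null_sets lborel" and G: "(\<lambda>(t, z). G t z) \<in> borel_measurable (borel \<Otimes>\<^sub>M borel)"
    and G\<Gamma>: "\<And>t z. t \<in> {0..T} \<Longrightarrow> z \<notin> N \<Longrightarrow> G t z = \<Gamma> t z"
    using caratheodory_borel_version[OF T \<Gamma>m is_flow_continuous[OF flow]] by metis
  have s0: "sets \<mu>0 = sets borel" and fin0: "finite_measure \<mu>0" and i0: "integrable lebesgue f0"
    using dens0 by (auto simp: has_leb_density_def)
  obtain g where g: "g \<in> borel_measurable borel" "\<mu>0 = density lborel (\<lambda>x. ennreal (g x))"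
    using has_leb_density_borel_version[OF dens0] by metis
  have ac: "absolutely_continuous lborel \<mu>0"
    unfolding g(2) using g(1) by (intro absolutely_continuousI_density) auto
  have Gt: "G t \<in> borel_measurable borel" for t using measurable_compose[OF _ G, of "\<lambda>z. (t, z)" borel] by simp
  have key: "measure (\<mu> t) A = measure \<mu>0 (G t -` A)" if t: "t \<in> {0..T}" and A: "A \<in> sets borel" for t A
  proof -
    have GA: "G t -` A \<in> sets borel" using measurable_sets[OF Gt A] by simp
    then have GAL: "G t -` A \<in> sets lebesgue" by (intro sets_completionI_sets) simp
    have \<Gamma>A: "\<Gamma> t -` A \<in> sets lebesgue" using measurable_sets[OF \<Gamma>m[OF t] A] by simp
    have "measure (\<mu> t) A = (LINT z:A|lebesgue. f t z)" using dens[OF t] A by (simp add: has_leb_density_def)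
    also have "\<dots> = (LINT z:\<Gamma> t -` A|lebesgue. f0 z)" using push[OF t] A by (simp add: pushes_forward_def)
    also have "\<dots> = (LINT z:G t -` A|lebesgue. f0 z)"
      unfolding set_lebesgue_integral_def
    proof (rule integral_cong_AE)
      show "(\<lambda>z. indicator (\<Gamma> t -` A) z *\<^sub>R f0 z) \<in> borel_measurable lebesgue"
        "(\<lambda>z. indicator (G t -` A) z *\<^sub>R f0 z) \<in> borel_measurable lebesgue"
        by (rule borel_measurable_scaleR[OF borel_measurable_indicator[OF \<Gamma>A] borel_measurable_integrable[OF i0]],
            rule borel_measurable_scaleR[OF borel_measurable_indicator[OF GAL] borel_measurable_integrable[OF i0]])
      have "AE z in lebesgue. z \<notin> N" using AE_completion[OF AE_not_in[OF N]] .
      then show "AE z in lebesgue. indicator (\<Gamma> t -` A) z *\<^sub>R f0 z = indicator (G t -` A) z *\<^sub>R f0 z"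
        by eventually_elim (use G\<Gamma>[OF t] in \<open>auto simp: indicator_def\<close>)
    qed
    also have "\<dots> = measure \<mu>0 (G t -` A)" using dens0 GA by (simp add: has_leb_density_def)
    finally show ?thesis .
  qed
  have prob: "prob_space (\<mu> t)" "sets (\<mu> t) = sets borel" if "t \<in> {0..T}" for t
    using P1[OF that] by (auto simp: P1_def space_prob_algebra)
  interpret \<mu>0: finite_measure \<mu>0 by fact
  have sp0: "space \<mu>0 = UNIV" using sets_eq_imp_space_eq[OF s0] by simp
  have p0: "prob_space \<mu>0"
  proof
    have "measure (\<mu> 0) UNIV = 1"
      using prob_space.prob_space[OF prob(1)[of 0]] sets_eq_imp_space_eq[OF prob(2)[of 0]] T by simp
    then have "measure \<mu>0 UNIV = 1" using key[of 0 UNIV] T by simp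
    then show "emeasure \<mu>0 (space \<mu>0) = 1" by (simp add: \<mu>0.emeasure_eq_measure sp0)
  qed
  have "distr \<mu>0 borel (G t) = \<mu> t" if t: "t \<in> {0..T}" for t
  proof (rule measure_eqI)
    interpret \<mu>t: prob_space "\<mu> t" by (rule prob[OF t])
    fix A assume "A \<in> sets (distr \<mu>0 borel (G t))"
    then have A: "A \<in> sets borel" by simp
    have "G t \<in> \<mu>0 \<rightarrow>\<^sub>M borel" using Gt measurable_cong_sets[OF s0 refl] by blast
    then show "emeasure (distr \<mu>0 borel (G t)) A = emeasure (\<mu> t) A"
      using A key[OF t A] by (simp add: emeasure_distr \<mu>0.emeasure_eq_measure \<mu>t.emeasure_eq_measure sp0)
  qed (simp add: prob(2)[OF t])
  then show ?thesis using that[OF flow N G] G\<Gamma> p0 s0 ac by blast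
qed

section \<open>Transport of couplings by Lagrangian solutions\<close>

text \<open>One solution at a time: \<open>p\<close> is a coordinate of the coupling and the flow
  starts from p(\<omega>). The bounds on the kernel are restated as expectations under
  \<open>P\<close> with the Borel kernel \<open>k\<close>, the form required by
  \<open>coupled_flow_estimate\<close>.\<close>

lemma species_on_coupling:
  fixes K k :: "'a::euclidean_space \<Rightarrow> 'a \<Rightarrow> 'a"
  assumes T: "0 \<le> T" and K: "antisym_kernel K"
    and N: "N \<in> null_sets lborel" and k: "(\<lambda>(x, y). k x y) \<in> borel_measurable (borel \<Otimes>\<^sub>M borel)"
    and Kk: "\<And>x. x \<notin> N \<Longrightarrow> AE y in lborel. K x y = k x y"
    and lag: "lagrangian_weak_phi_solution T K \<phi> F f0 f"
    and dens: "\<And>t. t \<in> {0..T} \<Longrightarrow> has_leb_density (\<mu> t) (f t)" and dens0: "has_leb_density \<mu>0 f0"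
    and P1: "\<And>t. t \<in> {0..T} \<Longrightarrow> \<mu> t \<in> P1"
    and P: "prob_space P" and p: "p \<in> borel_measurable P" "distr P borel p = \<mu>0"
  obtains \<Gamma> Z where "is_flow T F (field K f) \<Gamma>" "(\<lambda>(t, \<omega>). Z t \<omega>) \<in> borel_measurable (borel \<Otimes>\<^sub>M P)"
    "AE \<omega> in P. \<forall>t\<in>{0..T}. Z t \<omega> = \<Gamma> t (p \<omega>)"
    "\<And>t. t \<in> {0..T} \<Longrightarrow> distr P borel (Z t) = \<mu> t"
    "\<And>t. t \<in> {0..T} \<Longrightarrow> absolutely_continuous lborel (distr P borel (\<lambda>\<omega>. fst (Z t \<omega>)))"
    "\<And>x y. x \<notin> N \<Longrightarrow> y \<notin> N \<Longrightarrow> AE t in lborel. t \<in> {0..T} \<longrightarrow>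
      (\<integral>\<^sup>+\<omega>. ennreal (norm (k x (fst (Z t \<omega>)) - k y (fst (Z t \<omega>)))) \<partial>P) \<le> ennreal (\<phi> (norm (x - y)))"
    "AE t in lborel. t \<in> {0..T} \<longrightarrow> (AE x in lborel. (\<integral>\<^sup>+\<omega>. ennreal (norm (k x (fst (Z t \<omega>)))) \<partial>P) < \<infinity>)"
    "AE \<omega> in P. AE s in lborel. s \<in> {0..T} \<longrightarrow>
      field K f s (fst (Z s \<omega>)) = (\<integral>\<zeta>. k (fst (Z s \<omega>)) (fst (Z s \<zeta>)) \<partial>P)"
proof -
  interpret prob_space P by fact
  obtain \<Gamma> G M where flow: "is_flow T F (field K f) \<Gamma>" and M: "M \<in> null_sets lborel"
    and G: "(\<lambda>(t, z). G t z) \<in> borel_measurable (borel \<Otimes>\<^sub>M borel)"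
    and G\<Gamma>: "\<And>t z. t \<in> {0..T} \<Longrightarrow> z \<notin> M \<Longrightarrow> G t z = \<Gamma> t z"
    and push: "\<And>t. t \<in> {0..T} \<Longrightarrow> distr \<mu>0 borel (G t) = \<mu> t"
    and ac0: "absolutely_continuous lborel \<mu>0"
    using lagrangian_borel_flow[OF T lag dens dens0 P1] by metis
  have Gt: "G t \<in> borel_measurable borel" for t using measurable_compose[OF _ G, of "\<lambda>z. (t, z)" borel] by simp
  define Z where "Z t \<omega> = G t (p \<omega>)" for t \<omega>
  have Z: "(\<lambda>(t, \<omega>). Z t \<omega>) \<in> borel_measurable (borel \<Otimes>\<^sub>M P)"
    using measurable_compose[OF measurable_Pair[OF measurable_fst measurable_compose[OF measurable_snd p(1)]] G]
    by (simp add: Z_def case_prod_unfold)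
  have Zt: "Z t \<in> borel_measurable P" for t
    unfolding Z_def[abs_def] by (rule measurable_compose[OF p(1) Gt])
  have ZG: "AE \<omega> in P. \<forall>t\<in>{0..T}. Z t \<omega> = \<Gamma> t (p \<omega>)"
  proof -
    have "AE \<omega> in P. p \<omega> \<notin> M"
      by (rule AE_law[OF _ p(1) AE_not_in[OF M]]) (simp add: p(2) ac0)
    then show ?thesis by eventually_elim (simp add: Z_def G\<Gamma>)
  qed
  have dZ: "distr P borel (Z t) = \<mu> t" if "t \<in> {0..T}" for t
    unfolding Z_def[abs_def] using distr_distr[OF Gt p(1), of t] push[OF that] by (simp add: p(2) o_def)
  have dX: "distr P borel (\<lambda>\<omega>. fst (Z t \<omega>)) = distr (\<mu> t) borel fst" if "t \<in> {0..T}" for t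
    using distr_distr[OF fst_borel Zt, of t] by (simp add: dZ[OF that] o_def)
  have Xt: "(\<lambda>\<omega>. fst (Z t \<omega>)) \<in> borel_measurable P" for t
    by (rule measurable_compose[OF Zt fst_borel])
  have ac: "absolutely_continuous lborel (distr P borel (\<lambda>\<omega>. fst (Z t \<omega>)))" if "t \<in> {0..T}" for t
    unfolding dX[OF that] by (rule absolutely_continuous_marginal[OF dens[OF that]])
  have kx: "k x \<in> borel_measurable borel" for x using measurable_compose[OF _ k, of "\<lambda>y. (x, y)" borel] by simp
  have nn: "(\<integral>\<^sup>+y. h y * ennreal \<bar>rho f t y\<bar> \<partial>lebesgue) = (\<integral>\<^sup>+\<omega>. h' (fst (Z t \<omega>)) \<partial>P)"
    if t: "t \<in> {0..T}" and h': "h' \<in> borel_measurable borel" "AE y in lborel. h y = h' y" for t and h h' :: "'a \<Rightarrow> ennreal"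
  proof -
    have m: "(\<lambda>\<zeta> :: 'a \<times> 'a. h' (fst \<zeta>)) \<in> borel_measurable borel" by (rule measurable_compose[OF fst_borel h'(1)])
    have "(\<integral>\<^sup>+y. h y * ennreal \<bar>rho f t y\<bar> \<partial>lebesgue) = (\<integral>\<^sup>+\<zeta>. h' (fst \<zeta>) \<partial>distr P borel (Z t))"
      unfolding dZ[OF t] by (rule nn_integral_rho[where f = f and t = t, OF dens[OF t] h'])
    also have "\<dots> = (\<integral>\<^sup>+\<omega>. h' (fst (Z t \<omega>)) \<partial>P)" by (rule nn_integral_distr[OF Zt]) (simp add: m)
    finally show ?thesis .
  qed
  have weak: "esssup (lebesgue_on ({0..T} \<times> UNIV))
       (\<lambda>(t, x). \<integral>\<^sup>+z. ennreal (norm (K x z) * \<bar>rho f t z\<bar>) \<partial>lebesgue) < \<infinity>"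
    "\<And>x y. esssup (lebesgue_on {0..T})
       (\<lambda>t. \<integral>\<^sup>+z. ennreal (norm (K x z - K y z) * \<bar>rho f t z\<bar>) \<partial>lebesgue) \<le> ennreal (\<phi> (norm (x - y)))"
    using lag by (auto simp: lagrangian_weak_phi_solution_def weak_phi_solution_def)
  have md: "AE t in lborel. t \<in> {0..T} \<longrightarrow>
      (\<integral>\<^sup>+\<omega>. ennreal (norm (k x (fst (Z t \<omega>)) - k y (fst (Z t \<omega>)))) \<partial>P) \<le> ennreal (\<phi> (norm (x - y)))"
    if x: "x \<notin> N" and y: "y \<notin> N" for x y
  proof -
    have "AE t in lebesgue_on {0..T}. (\<integral>\<^sup>+z. ennreal (norm (K x z - K y z) * \<bar>rho f t z\<bar>) \<partial>lebesgue) \<le> ennreal (\<phi> (norm (x - y)))"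
      using esssup_AE[of "\<lambda>t. \<integral>\<^sup>+z. ennreal (norm (K x z - K y z) * \<bar>rho f t z\<bar>) \<partial>lebesgue" "lebesgue_on {0..T}"] weak(2)[of x y]
      by (auto elim!: eventually_mono intro: order_trans)
    from AE_lebesgue_onD[OF this]
    have "AE t in lborel. t \<in> {0..T} \<longrightarrow> (\<integral>\<^sup>+z. ennreal (norm (K x z - K y z) * \<bar>rho f t z\<bar>) \<partial>lebesgue) \<le> ennreal (\<phi> (norm (x - y)))"
      by simp
    then show ?thesis
    proof eventually_elim
      case (elim t)
      show ?case
      proof
        assume t: "t \<in> {0..T}"
        have ae: "AE z in lborel. ennreal (norm (K x z - K y z)) = ennreal (norm (k x z - k y z))"
          using Kk[OF x] Kk[OF y] by eventually_elim simp
        have "(\<integral>\<^sup>+\<omega>. ennreal (norm (k x (fst (Z t \<omega>)) - k y (fst (Z t \<omega>)))) \<partial>P) =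
            (\<integral>\<^sup>+z. ennreal (norm (K x z - K y z)) * ennreal \<bar>rho f t z\<bar> \<partial>lebesgue)"
          by (rule nn[OF t _ ae, symmetric]) (use kx[of x] kx[of y] in simp)
        also have "\<dots> \<le> ennreal (\<phi> (norm (x - y)))" using elim t by (simp add: ennreal_mult)
        finally show "(\<integral>\<^sup>+\<omega>. ennreal (norm (k x (fst (Z t \<omega>)) - k y (fst (Z t \<omega>)))) \<partial>P) \<le> ennreal (\<phi> (norm (x - y)))" .
      qed
    qed
  qed
  have fn: "AE t in lborel. t \<in> {0..T} \<longrightarrow> (AE x in lborel. (\<integral>\<^sup>+\<omega>. ennreal (norm (k x (fst (Z t \<omega>)))) \<partial>P) < \<infinity>)"
  proof -
    let ?I = "\<lambda>(t, x). \<integral>\<^sup>+z. ennreal (norm (K x z) * \<bar>rho f t z\<bar>) \<partial>lebesgue"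
    have "AE q in lebesgue_on ({0..T} \<times> UNIV). ?I q < \<infinity>"
      using esssup_AE[of ?I "lebesgue_on ({0..T} \<times> UNIV)"] by (rule eventually_mono) (erule le_less_trans[OF _ weak(1)])
    moreover have "{0..T} \<times> (UNIV :: 'a set) \<in> sets borel" by (intro borel_closed closed_Times) auto
    ultimately
    have "AE q in lborel. q \<in> {0..T} \<times> UNIV \<longrightarrow> ?I q < \<infinity>" by (rule AE_lebesgue_onD)
    from AE_lborel_fubini[OF this]
    have "AE t in lborel. AE x in lborel. t \<in> {0..T} \<longrightarrow> (\<integral>\<^sup>+z. ennreal (norm (K x z) * \<bar>rho f t z\<bar>) \<partial>lebesgue) < \<infinity>"
      by simp
    then show ?thesis
    proof eventually_elim
      case (elim t)
      show ?case
      proof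
        assume t: "t \<in> {0..T}"
        show "AE x in lborel. (\<integral>\<^sup>+\<omega>. ennreal (norm (k x (fst (Z t \<omega>)))) \<partial>P) < \<infinity>"
          using elim AE_not_in[OF N]
        proof eventually_elim
          case (elim x)
          have ae: "AE z in lborel. ennreal (norm (K x z)) = ennreal (norm (k x z))"
            using Kk[OF elim(2)] by eventually_elim simp
          have "(\<integral>\<^sup>+\<omega>. ennreal (norm (k x (fst (Z t \<omega>)))) \<partial>P) = (\<integral>\<^sup>+z. ennreal (norm (K x z)) * ennreal \<bar>rho f t z\<bar> \<partial>lebesgue)"
            by (rule nn[OF t _ ae, symmetric]) (use kx[of x] in simp)
          also have "\<dots> < \<infinity>" using elim t by (simp add: ennreal_mult)
          finally show ?case .
        qed
      qed
    qed
  qed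
  \<comment> \<open>The field equals the expectation with \<open>k\<close> at positions outside
    \<open>N\<close>. At each time almost every trajectory is outside, hence by Fubini almost every
    trajectory is outside at almost every time, which suffices under the time integral.\<close>
  have fld: "AE \<omega> in P. AE s in lborel. s \<in> {0..T} \<longrightarrow>
      field K f s (fst (Z s \<omega>)) = (\<integral>\<zeta>. k (fst (Z s \<omega>)) (fst (Z s \<zeta>)) \<partial>P)"
  proof -
    interpret LP: pair_sigma_finite "lborel :: real measure" P ..
    have Nb: "N \<in> sets borel" using N by auto
    have X: "(\<lambda>q. fst (Z (fst q) (snd q))) \<in> borel_measurable (borel \<Otimes>\<^sub>M P)"
      using measurable_compose[OF Z fst_borel] by (simp add: case_prod_unfold)
    have "Measurable.pred (borel \<Otimes>\<^sub>M P) (\<lambda>q. fst q \<in> {0..T} \<longrightarrow> fst (Z (fst q) (snd q)) \<notin> N)"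
    proof (rule pred_intros_logic(4))
      show "Measurable.pred (borel \<Otimes>\<^sub>M P) (\<lambda>q. fst (Z (fst q) (snd q)) \<notin> N)"
        using pred_sets2[OF Nb X] by (rule pred_intros_logic(2))
    qed measurable
    then have "Measurable.pred (lborel \<Otimes>\<^sub>M P) (\<lambda>q. fst q \<in> {0..T} \<longrightarrow> fst (Z (fst q) (snd q)) \<notin> N)"
      using measurable_cong_sets[OF sets_pair_measure_cong[OF sets_lborel refl] refl] by blast
    then have ms: "{q \<in> space (lborel \<Otimes>\<^sub>M P). fst q \<in> {0..T} \<longrightarrow> fst (Z (fst q) (snd q)) \<notin> N} \<in> sets (lborel \<Otimes>\<^sub>M P)"
      by (rule predE)
    have "AE \<omega> in P. s \<in> {0..T} \<longrightarrow> fst (Z s \<omega>) \<notin> N" for s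
    proof (cases "s \<in> {0..T}")
      case True
      show ?thesis using AE_law[OF ac[OF True] Xt AE_not_in[OF N]] by eventually_elim simp
    qed (auto intro: AE_I2)
    then have "AE s in lborel. AE \<omega> in P. s \<in> {0..T} \<longrightarrow> fst (Z s \<omega>) \<notin> N" by (rule AE_I2)
    then have ae: "AE \<omega> in P. AE s in lborel. s \<in> {0..T} \<longrightarrow> fst (Z s \<omega>) \<notin> N"
      by (rule LP.AE_commute[where P = "\<lambda>s \<omega>. s \<in> {0..T} \<longrightarrow> fst (Z s \<omega>) \<notin> N", OF ms, THEN iffD1])
    have *: "field K f s x = (\<integral>\<zeta>. k x (fst (Z s \<zeta>)) \<partial>P)" if s: "s \<in> {0..T}" and x: "x \<notin> N" for s x
    proof -
      have Kx: "K x \<in> borel_measurable lebesgue" using K by (simp add: antisym_kernel_def)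
      have "field K f s x = (\<integral>\<zeta>. k x (fst \<zeta>) \<partial>distr P borel (Z s))"
        unfolding dZ[OF s] by (rule field_eq_integral[where f = f and t = s and K = K and x = x and k = "k x", OF dens[OF s] Kx kx Kk[OF x]])
      also have "\<dots> = (\<integral>\<zeta>. k x (fst (Z s \<zeta>)) \<partial>P)"
        by (rule integral_distr[OF Zt]) (rule measurable_compose[OF fst_borel kx])
      finally show ?thesis .
    qed
    from ae show ?thesis
    proof (rule eventually_mono)
      fix \<omega> assume "AE s in lborel. s \<in> {0..T} \<longrightarrow> fst (Z s \<omega>) \<notin> N"
      then show "AE s in lborel. s \<in> {0..T} \<longrightarrow> field K f s (fst (Z s \<omega>)) = (\<integral>\<zeta>. k (fst (Z s \<omega>)) (fst (Z s \<zeta>)) \<partial>P)"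
        by eventually_elim (use * in blast)
    qed
  qed
  show ?thesis by (rule that[of \<Gamma> Z]) (fact flow Z ZG dZ ac md fn fld)+
qed

section \<open>Two solutions and the transport of one coupling\<close>

locale solution_pair = concave_modulus \<phi> for \<phi> +
  fixes T L :: real and K :: "'a::euclidean_space \<Rightarrow> 'a \<Rightarrow> 'a"
    and F1 F2 :: "real \<Rightarrow> 'a \<times> 'a \<Rightarrow> 'a" and f01 f02 :: "'a \<times> 'a \<Rightarrow> real"
    and f1 f2 :: "real \<Rightarrow> 'a \<times> 'a \<Rightarrow> real"
    and \<mu>01 \<mu>02 :: "('a \<times> 'a) measure" and \<mu>1 \<mu>2 :: "real \<Rightarrow> ('a \<times> 'a) measure"
  assumes T: "0 < T" and L: "1 \<le> L" and K: "antisym_kernel K" and zero: "\<phi> 0 = 0"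
    and F: "Linf_C T F1" "Linf_C T F2" "ess_lipschitz T L F1" "ess_lipschitz T L F2"
    and lag: "lagrangian_weak_phi_solution T K \<phi> F1 f01 f1" "lagrangian_weak_phi_solution T K \<phi> F2 f02 f2"
    and lp: "Linf_P1 T \<mu>1" "Linf_P1 T \<mu>2"
    and dens: "\<And>t. t \<in> {0..T} \<Longrightarrow> has_leb_density (\<mu>1 t) (f1 t)" "\<And>t. t \<in> {0..T} \<Longrightarrow> has_leb_density (\<mu>2 t) (f2 t)"
    and dens0: "has_leb_density \<mu>01 f01" "has_leb_density \<mu>02 f02"
begin

lemma moments: "t \<in> {0..T} \<Longrightarrow> \<mu>1 t \<in> P1" "t \<in> {0..T} \<Longrightarrow> \<mu>2 t \<in> P1"
  using lp unfolding Linf_P1_def by blast+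

text \<open>The transported coupling is chosen before \<open>c\<close>, \<open>\<eta>\<close> and
  \<open>\<delta>\<close>: one and the same coupling can be estimated with \<delta> tending to 0, as
  \<open>uniqueness\<close> requires.\<close>

lemma coupling_estimate:
  assumes \<pi>: "\<pi> \<in> couplings \<mu>01 \<mu>02" and t: "t \<in> {0..T}"
  obtains \<pi>' where "\<pi>' \<in> couplings (\<mu>1 t) (\<mu>2 t)"
    "\<And>c \<eta> \<delta>. 0 \<le> c \<Longrightarrow> (\<integral>\<^sup>+(z, w). ennreal (dist z w) \<partial>\<pi>) \<le> ennreal c \<Longrightarrow> 0 \<le> \<eta> \<Longrightarrow>
      AE s in lborel. s \<in> {0..T} \<longrightarrow> (\<forall>z. norm (F1 s z - F2 s z) \<le> \<eta>) \<Longrightarrow> 0 < \<delta> \<Longrightarrow> 2 * L * c + \<eta> \<le> \<delta> \<Longrightarrow>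
      \<exists>R\<ge>0. (\<integral>\<^sup>+(z, w). ennreal (dist z w) \<partial>\<pi>') \<le> ennreal (R + exp (L * t) * (\<delta> + sqrt (4 * L * Phi \<phi> R))) \<and>
        Psi \<phi> \<delta> (2 * L) R \<le> Psi \<phi> \<delta> (2 * L) c + exp (L * t) - 1"
proof -
  have \<pi>s: "sets \<pi> = sets borel" and \<pi>d: "distr \<pi> borel fst = \<mu>01" "distr \<pi> borel snd = \<mu>02"
    using \<pi> by (auto simp: couplings_def)
  have fstm: "fst \<in> borel_measurable \<pi>" and sndm: "snd \<in> borel_measurable \<pi>"
    using measurable_cong_sets[OF \<pi>s refl] fst_borel snd_borel by blast+
  have T0: "0 \<le> T" using T by simp
  obtain k N where N: "N \<in> null_sets lborel" and k: "(\<lambda>(x, y). k x y) \<in> borel_measurable (borel \<Otimes>\<^sub>M borel)"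
    and Kk: "\<And>x. x \<notin> N \<Longrightarrow> AE y in lborel. K x y = k x y" and anti: "AE y in lborel. AE x in lborel. k x y = - k y x"
    by (rule antisym_kernel_borel_version[OF K]) blast
  have "prob_space \<mu>01" by (rule lagrangian_borel_flow[OF T0 lag(1) dens(1) dens0(1) moments(1)])
  then have P: "prob_space \<pi>" using prob_space_distrD[OF fstm] by (simp add: \<pi>d)
  obtain \<Gamma>1 Z1 where Z1: "is_flow T F1 (field K f1) \<Gamma>1" "(\<lambda>(t, \<omega>). Z1 t \<omega>) \<in> borel_measurable (borel \<Otimes>\<^sub>M \<pi>)"
    "AE \<omega> in \<pi>. \<forall>t\<in>{0..T}. Z1 t \<omega> = \<Gamma>1 t (fst \<omega>)"
    "\<And>t. t \<in> {0..T} \<Longrightarrow> distr \<pi> borel (Z1 t) = \<mu>1 t"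
    "\<And>t. t \<in> {0..T} \<Longrightarrow> absolutely_continuous lborel (distr \<pi> borel (\<lambda>\<omega>. fst (Z1 t \<omega>)))"
    "\<And>x y. x \<notin> N \<Longrightarrow> y \<notin> N \<Longrightarrow> AE t in lborel. t \<in> {0..T} \<longrightarrow>
      (\<integral>\<^sup>+\<omega>. ennreal (norm (k x (fst (Z1 t \<omega>)) - k y (fst (Z1 t \<omega>)))) \<partial>\<pi>) \<le> ennreal (\<phi> (norm (x - y)))"
    "AE t in lborel. t \<in> {0..T} \<longrightarrow> (AE x in lborel. (\<integral>\<^sup>+\<omega>. ennreal (norm (k x (fst (Z1 t \<omega>)))) \<partial>\<pi>) < \<infinity>)"
    "AE \<omega> in \<pi>. AE s in lborel. s \<in> {0..T} \<longrightarrow>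
      field K f1 s (fst (Z1 s \<omega>)) = (\<integral>\<zeta>. k (fst (Z1 s \<omega>)) (fst (Z1 s \<zeta>)) \<partial>\<pi>)"
    by (rule species_on_coupling[OF T0 K N k Kk lag(1) dens(1) dens0(1) moments(1) P fstm \<pi>d(1)]) blast+
  obtain \<Gamma>2 Z2 where Z2: "is_flow T F2 (field K f2) \<Gamma>2" "(\<lambda>(t, \<omega>). Z2 t \<omega>) \<in> borel_measurable (borel \<Otimes>\<^sub>M \<pi>)"
    "AE \<omega> in \<pi>. \<forall>t\<in>{0..T}. Z2 t \<omega> = \<Gamma>2 t (snd \<omega>)"
    "\<And>t. t \<in> {0..T} \<Longrightarrow> distr \<pi> borel (Z2 t) = \<mu>2 t"
    "\<And>t. t \<in> {0..T} \<Longrightarrow> absolutely_continuous lborel (distr \<pi> borel (\<lambda>\<omega>. fst (Z2 t \<omega>)))"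
    "\<And>x y. x \<notin> N \<Longrightarrow> y \<notin> N \<Longrightarrow> AE t in lborel. t \<in> {0..T} \<longrightarrow>
      (\<integral>\<^sup>+\<omega>. ennreal (norm (k x (fst (Z2 t \<omega>)) - k y (fst (Z2 t \<omega>)))) \<partial>\<pi>) \<le> ennreal (\<phi> (norm (x - y)))"
    "AE t in lborel. t \<in> {0..T} \<longrightarrow> (AE x in lborel. (\<integral>\<^sup>+\<omega>. ennreal (norm (k x (fst (Z2 t \<omega>)))) \<partial>\<pi>) < \<infinity>)"
    "AE \<omega> in \<pi>. AE s in lborel. s \<in> {0..T} \<longrightarrow>
      field K f2 s (fst (Z2 s \<omega>)) = (\<integral>\<zeta>. k (fst (Z2 s \<omega>)) (fst (Z2 s \<zeta>)) \<partial>\<pi>)"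
    by (rule species_on_coupling[OF T0 K N k Kk lag(2) dens(2) dens0(2) moments(2) P sndm \<pi>d(2)]) blast+
  have Z1t: "Z1 s \<in> borel_measurable \<pi>" for s using measurable_compose[OF _ Z1(2), of "\<lambda>\<omega>. (s, \<omega>)" \<pi>] by simp
  have Z2t: "Z2 s \<in> borel_measurable \<pi>" for s using measurable_compose[OF _ Z2(2), of "\<lambda>\<omega>. (s, \<omega>)" \<pi>] by simp
  define \<pi>' where "\<pi>' = distr \<pi> borel (\<lambda>\<omega>. (Z1 t \<omega>, Z2 t \<omega>))"
  have Zm: "(\<lambda>\<omega>. (Z1 t \<omega>, Z2 t \<omega>)) \<in> borel_measurable \<pi>"
    using measurable_Pair[OF Z1t[of t] Z2t[of t]] unfolding borel_prod .
  have cpl: "\<pi>' \<in> couplings (\<mu>1 t) (\<mu>2 t)"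
    unfolding couplings_def \<pi>'_def
    using distr_distr[OF fst_borel Zm] distr_distr[OF snd_borel Zm] Z1(4)[OF t] Z2(4)[OF t] by (simp add: o_def)
  \<comment> \<open>The mean distance is at most the sum of the first moments of the two marginals;
    this yields both the finiteness and the essential bound in time that
    \<open>coupled_flow_estimate\<close> demands.\<close>
  have mom: "(\<integral>\<^sup>+\<omega>. ennreal (norm (Z1 s \<omega> - Z2 s \<omega>)) \<partial>\<pi>) \<le> (\<integral>\<^sup>+z. ennreal (norm z) \<partial>\<mu>1 s) + (\<integral>\<^sup>+z. ennreal (norm z) \<partial>\<mu>2 s)"
    if s: "s \<in> {0..T}" for s
  proof -
    have "(\<integral>\<^sup>+\<omega>. ennreal (norm (Z1 s \<omega> - Z2 s \<omega>)) \<partial>\<pi>) \<le> (\<integral>\<^sup>+\<omega>. ennreal (norm (Z1 s \<omega>)) + ennreal (norm (Z2 s \<omega>)) \<partial>\<pi>)"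
      by (intro nn_integral_mono) (simp add: norm_triangle_ineq4 flip: ennreal_plus)
    also have "\<dots> = (\<integral>\<^sup>+\<omega>. ennreal (norm (Z1 s \<omega>)) \<partial>\<pi>) + (\<integral>\<^sup>+\<omega>. ennreal (norm (Z2 s \<omega>)) \<partial>\<pi>)"
      using Z1t[of s] Z2t[of s] by (intro nn_integral_add) auto
    also have "(\<integral>\<^sup>+\<omega>. ennreal (norm (Z1 s \<omega>)) \<partial>\<pi>) = (\<integral>\<^sup>+z. ennreal (norm z) \<partial>\<mu>1 s)"
      unfolding Z1(4)[OF s, symmetric] by (rule nn_integral_distr[OF Z1t, symmetric]) simp
    also have "(\<integral>\<^sup>+\<omega>. ennreal (norm (Z2 s \<omega>)) \<partial>\<pi>) = (\<integral>\<^sup>+z. ennreal (norm z) \<partial>\<mu>2 s)"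
      unfolding Z2(4)[OF s, symmetric] by (rule nn_integral_distr[OF Z2t, symmetric]) simp
    finally show ?thesis .
  qed
  have fin: "(\<integral>\<^sup>+\<omega>. ennreal (norm (Z1 s \<omega> - Z2 s \<omega>)) \<partial>\<pi>) < \<infinity>" if s: "s \<in> {0..T}" for s
    using moments[OF s] by (intro le_less_trans[OF mom[OF s]]) (simp add: P1_def)
  define e1 where "e1 = esssup (lebesgue_on {0..T}) (\<lambda>t. \<integral>\<^sup>+z. ennreal (norm z) \<partial>\<mu>1 t)"
  define e2 where "e2 = esssup (lebesgue_on {0..T}) (\<lambda>t. \<integral>\<^sup>+z. ennreal (norm z) \<partial>\<mu>2 t)"
  have e: "e1 + e2 < \<infinity>" using lp by (simp add: Linf_P1_def e1_def e2_def)
  have C: "AE s in lborel. s \<in> {0..T} \<longrightarrow> (\<integral>\<^sup>+\<omega>. ennreal (norm (Z1 s \<omega> - Z2 s \<omega>)) \<partial>\<pi>) \<le> ennreal (enn2real (e1 + e2))"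
  proof -
    have "AE s in lborel. s \<in> {0..T} \<longrightarrow> (\<integral>\<^sup>+z. ennreal (norm z) \<partial>\<mu>1 s) \<le> e1"
      "AE s in lborel. s \<in> {0..T} \<longrightarrow> (\<integral>\<^sup>+z. ennreal (norm z) \<partial>\<mu>2 s) \<le> e2"
      unfolding e1_def e2_def by (rule AE_lebesgue_onD[OF esssup_AE], simp)+
    then show ?thesis
    proof eventually_elim
      case (elim s)
      show ?case
      proof
        assume s: "s \<in> {0..T}"
        have "(\<integral>\<^sup>+\<omega>. ennreal (norm (Z1 s \<omega> - Z2 s \<omega>)) \<partial>\<pi>) \<le> e1 + e2"
          using mom[OF s] elim s by (auto intro: order_trans add_mono)
        then show "(\<integral>\<^sup>+\<omega>. ennreal (norm (Z1 s \<omega> - Z2 s \<omega>)) \<partial>\<pi>) \<le> ennreal (enn2real (e1 + e2))"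
          using e by simp
      qed
    qed
  qed
  have lip: "AE s in lborel. s \<in> {0..T} \<longrightarrow> (\<forall>z w. norm (F1 s z - F1 s w) \<le> L * (norm (fst z - fst w) + norm (snd z - snd w)))"
    using ess_lipschitz_AE[OF F(1) F(3)] L by (auto elim!: eventually_mono)
  have trajv: "AE \<omega> in \<pi>. \<forall>t\<in>{0..T}. ennreal (norm (snd (Z1 t \<omega>) - snd (Z2 t \<omega>)))
      \<le> ennreal (norm (snd (Z1 0 \<omega>) - snd (Z2 0 \<omega>))) + (\<integral>\<^sup>+s\<in>{0..t}.
          ennreal (norm ((\<integral>\<zeta>. k (fst (Z1 s \<omega>)) (fst (Z1 s \<zeta>)) \<partial>\<pi>) - (\<integral>\<zeta>. k (fst (Z2 s \<omega>)) (fst (Z2 s \<zeta>)) \<partial>\<pi>))) \<partial>lborel)"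
    using Z1(3,8) Z2(3,8)
  proof eventually_elim
    case (elim \<omega>)
    show ?case
    proof
      fix t assume t: "t \<in> {0..T}"
      have 0: "0 \<in> {0..T}" using T by simp
      have "ennreal (norm (snd (Z1 t \<omega>) - snd (Z2 t \<omega>))) \<le> ennreal (norm (snd (fst \<omega>) - snd (snd \<omega>))) +
          (\<integral>\<^sup>+s\<in>{0..t}. ennreal (norm (field K f1 s (fst (\<Gamma>1 s (fst \<omega>))) - field K f2 s (fst (\<Gamma>2 s (snd \<omega>))))) \<partial>lborel)"
        using set_integral_difference_bound[OF is_flow_components(2)[OF Z1(1), of "fst \<omega>"] is_flow_components(2)[OF Z2(1), of "snd \<omega>"] t]
          is_flow_components(4)[OF Z1(1) t, of "fst \<omega>"] is_flow_components(4)[OF Z2(1) t, of "snd \<omega>"]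
          elim(1)[rule_format, OF t] elim(3)[rule_format, OF t] by (simp only:)
      also have "\<dots> \<le> ennreal (norm (snd (Z1 0 \<omega>) - snd (Z2 0 \<omega>))) + (\<integral>\<^sup>+s\<in>{0..t}.
          ennreal (norm ((\<integral>\<zeta>. k (fst (Z1 s \<omega>)) (fst (Z1 s \<zeta>)) \<partial>\<pi>) - (\<integral>\<zeta>. k (fst (Z2 s \<omega>)) (fst (Z2 s \<zeta>)) \<partial>\<pi>))) \<partial>lborel)"
      proof (intro add_mono nn_integral_mono_AE)
        show "ennreal (norm (snd (fst \<omega>) - snd (snd \<omega>))) \<le> ennreal (norm (snd (Z1 0 \<omega>) - snd (Z2 0 \<omega>)))"
          using elim(1)[rule_format, OF 0] elim(3)[rule_format, OF 0] is_flow_0[OF Z1(1) T0] is_flow_0[OF Z2(1) T0] by simp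
        show "AE s in lborel. ennreal (norm (field K f1 s (fst (\<Gamma>1 s (fst \<omega>))) - field K f2 s (fst (\<Gamma>2 s (snd \<omega>))))) * indicator {0..t} s
          \<le> ennreal (norm ((\<integral>\<zeta>. k (fst (Z1 s \<omega>)) (fst (Z1 s \<zeta>)) \<partial>\<pi>) - (\<integral>\<zeta>. k (fst (Z2 s \<omega>)) (fst (Z2 s \<zeta>)) \<partial>\<pi>))) * indicator {0..t} s"
          using elim(2,4)
        proof eventually_elim
          case (elim s)
          show ?case
          proof (cases "s \<in> {0..t}")
            case True
            then have s: "s \<in> {0..T}" using t by auto
            have "field K f1 s (fst (\<Gamma>1 s (fst \<omega>))) = (\<integral>\<zeta>. k (fst (Z1 s \<omega>)) (fst (Z1 s \<zeta>)) \<partial>\<pi>)"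
              "field K f2 s (fst (\<Gamma>2 s (snd \<omega>))) = (\<integral>\<zeta>. k (fst (Z2 s \<omega>)) (fst (Z2 s \<zeta>)) \<partial>\<pi>)"
              using elim s \<open>\<forall>t\<in>{0..T}. Z1 t \<omega> = \<Gamma>1 t (fst \<omega>)\<close> \<open>\<forall>t\<in>{0..T}. Z2 t \<omega> = \<Gamma>2 t (snd \<omega>)\<close> by simp_all
            then show ?thesis by (simp only: order_refl)
          qed simp
        qed
      qed
      finally show "ennreal (norm (snd (Z1 t \<omega>) - snd (Z2 t \<omega>)))
      \<le> ennreal (norm (snd (Z1 0 \<omega>) - snd (Z2 0 \<omega>))) + (\<integral>\<^sup>+s\<in>{0..t}.
          ennreal (norm ((\<integral>\<zeta>. k (fst (Z1 s \<omega>)) (fst (Z1 s \<zeta>)) \<partial>\<pi>) - (\<integral>\<zeta>. k (fst (Z2 s \<omega>)) (fst (Z2 s \<zeta>)) \<partial>\<pi>))) \<partial>lborel)" .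
    qed
  qed
  have main: "\<exists>R\<ge>0. (\<integral>\<^sup>+(z, w). ennreal (dist z w) \<partial>\<pi>') \<le> ennreal (R + exp (L * t) * (\<delta> + sqrt (4 * L * Phi \<phi> R))) \<and>
        Psi \<phi> \<delta> (2 * L) R \<le> Psi \<phi> \<delta> (2 * L) c + exp (L * t) - 1"
    if c: "0 \<le> c" "(\<integral>\<^sup>+(z, w). ennreal (dist z w) \<partial>\<pi>) \<le> ennreal c" and \<eta>: "0 \<le> \<eta>"
      "AE s in lborel. s \<in> {0..T} \<longrightarrow> (\<forall>z. norm (F1 s z - F2 s z) \<le> \<eta>)" and \<delta>: "0 < \<delta>" "2 * L * c + \<eta> \<le> \<delta>"
    for c \<eta> \<delta>
  proof -
    have c': "(\<integral>\<^sup>+\<omega>. ennreal (norm (Z1 0 \<omega> - Z2 0 \<omega>)) \<partial>\<pi>) \<le> ennreal c"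
    proof -
      have "AE \<omega> in \<pi>. Z1 0 \<omega> = fst \<omega> \<and> Z2 0 \<omega> = snd \<omega>"
        using Z1(3) Z2(3) by eventually_elim (use T is_flow_0[OF Z1(1) T0] is_flow_0[OF Z2(1) T0] in simp)
      then have "(\<integral>\<^sup>+\<omega>. ennreal (norm (Z1 0 \<omega> - Z2 0 \<omega>)) \<partial>\<pi>) = (\<integral>\<^sup>+\<omega>. ennreal (norm (fst \<omega> - snd \<omega>)) \<partial>\<pi>)"
        by (intro nn_integral_cong_AE, elim eventually_mono) simp
      then show ?thesis using c(2) by (simp add: case_prod_unfold dist_norm)
    qed
    have trajx: "AE \<omega> in \<pi>. \<forall>t\<in>{0..T}. ennreal (norm (fst (Z1 t \<omega>) - fst (Z2 t \<omega>)))
      \<le> ennreal (norm (fst (Z1 0 \<omega>) - fst (Z2 0 \<omega>))) + (\<integral>\<^sup>+s\<in>{0..t}.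
          ennreal (L * (norm (fst (Z1 s \<omega>) - fst (Z2 s \<omega>)) + norm (snd (Z1 s \<omega>) - snd (Z2 s \<omega>))) + \<eta>) \<partial>lborel)"
      using Z1(3) Z2(3)
    proof eventually_elim
      case (elim \<omega>)
      show ?case
      proof
        fix t assume t: "t \<in> {0..T}"
        have 0: "0 \<in> {0..T}" using T by simp
        have "ennreal (norm (fst (Z1 t \<omega>) - fst (Z2 t \<omega>))) \<le> ennreal (norm (fst (fst \<omega>) - fst (snd \<omega>))) +
            (\<integral>\<^sup>+s\<in>{0..t}. ennreal (norm (F1 s (\<Gamma>1 s (fst \<omega>)) - F2 s (\<Gamma>2 s (snd \<omega>)))) \<partial>lborel)"
          using set_integral_difference_bound[OF is_flow_components(1)[OF Z1(1), of "fst \<omega>"] is_flow_components(1)[OF Z2(1), of "snd \<omega>"] t]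
            is_flow_components(3)[OF Z1(1) t, of "fst \<omega>"] is_flow_components(3)[OF Z2(1) t, of "snd \<omega>"]
            elim(1)[rule_format, OF t] elim(2)[rule_format, OF t] by (simp only:)
        also have "\<dots> \<le> ennreal (norm (fst (Z1 0 \<omega>) - fst (Z2 0 \<omega>))) + (\<integral>\<^sup>+s\<in>{0..t}.
          ennreal (L * (norm (fst (Z1 s \<omega>) - fst (Z2 s \<omega>)) + norm (snd (Z1 s \<omega>) - snd (Z2 s \<omega>))) + \<eta>) \<partial>lborel)"
        proof (intro add_mono nn_integral_mono_AE)
          show "ennreal (norm (fst (fst \<omega>) - fst (snd \<omega>))) \<le> ennreal (norm (fst (Z1 0 \<omega>) - fst (Z2 0 \<omega>)))"
            using elim(1)[rule_format, OF 0] elim(2)[rule_format, OF 0] is_flow_0[OF Z1(1) T0] is_flow_0[OF Z2(1) T0] by simp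
          show "AE s in lborel. ennreal (norm (F1 s (\<Gamma>1 s (fst \<omega>)) - F2 s (\<Gamma>2 s (snd \<omega>)))) * indicator {0..t} s
            \<le> ennreal (L * (norm (fst (Z1 s \<omega>) - fst (Z2 s \<omega>)) + norm (snd (Z1 s \<omega>) - snd (Z2 s \<omega>))) + \<eta>) * indicator {0..t} s"
            using lip \<eta>(2)
          proof eventually_elim
            case (elim s)
            show ?case
            proof (cases "s \<in> {0..t}")
              case True
              then have s: "s \<in> {0..T}" using t by auto
              have eq: "\<Gamma>1 s (fst \<omega>) = Z1 s \<omega>" "\<Gamma>2 s (snd \<omega>) = Z2 s \<omega>"
                using s \<open>\<forall>t\<in>{0..T}. Z1 t \<omega> = \<Gamma>1 t (fst \<omega>)\<close> \<open>\<forall>t\<in>{0..T}. Z2 t \<omega> = \<Gamma>2 t (snd \<omega>)\<close> by simp_all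
              \<comment> \<open>Inserting the value of \<open>F1\<close> at \<open>Z2\<close>
                separates the Lipschitz dependence on the point from the difference of the two
                fields at one point.\<close>
              have "norm (F1 s (Z1 s \<omega>) - F2 s (Z2 s \<omega>)) \<le> norm (F1 s (Z1 s \<omega>) - F1 s (Z2 s \<omega>)) + norm (F1 s (Z2 s \<omega>) - F2 s (Z2 s \<omega>))"
                using norm_triangle_ineq[of "F1 s (Z1 s \<omega>) - F1 s (Z2 s \<omega>)" "F1 s (Z2 s \<omega>) - F2 s (Z2 s \<omega>)"] by simp
              also have "\<dots> \<le> L * (norm (fst (Z1 s \<omega>) - fst (Z2 s \<omega>)) + norm (snd (Z1 s \<omega>) - snd (Z2 s \<omega>))) + \<eta>"
                using elim s by (intro add_mono) blast+
              finally show ?thesis unfolding eq by (intro mult_right_mono ennreal_leI) auto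
            qed simp
          qed
        qed
        finally show "ennreal (norm (fst (Z1 t \<omega>) - fst (Z2 t \<omega>)))
          \<le> ennreal (norm (fst (Z1 0 \<omega>) - fst (Z2 0 \<omega>))) + (\<integral>\<^sup>+s\<in>{0..t}.
          ennreal (L * (norm (fst (Z1 s \<omega>) - fst (Z2 s \<omega>)) + norm (snd (Z1 s \<omega>) - snd (Z2 s \<omega>))) + \<eta>) \<partial>lborel)" .
      qed
    qed
    obtain R where R: "R \<ge> 0" "(\<integral>\<^sup>+\<omega>. ennreal (norm (fst (Z1 t \<omega>) - fst (Z2 t \<omega>))) \<partial>\<pi>) \<le> ennreal R"
      "(\<integral>\<^sup>+\<omega>. ennreal (norm (snd (Z1 t \<omega>) - snd (Z2 t \<omega>))) \<partial>\<pi>) \<le> ennreal (exp (L * t) * (\<delta> + sqrt (4 * L * Phi \<phi> R)))"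
      "Psi \<phi> \<delta> (2 * L) R \<le> Psi \<phi> \<delta> (2 * L) c + exp (L * t) - 1"
      using coupled_flow_estimate[OF P Z1(2) Z2(2) k anti zero Z1(5) Z2(5) N Z1(6) Z2(6) Z1(7) Z2(7) trajx trajv fin C c(1) c' L \<eta>(1) \<delta> t]
      by blast
    have "(\<integral>\<^sup>+(z, w). ennreal (dist z w) \<partial>\<pi>') = (\<integral>\<^sup>+\<omega>. ennreal (norm (Z1 t \<omega> - Z2 t \<omega>)) \<partial>\<pi>)"
    proof -
      have "(\<lambda>p :: ('a \<times> 'a) \<times> 'a \<times> 'a. ennreal (dist (fst p) (snd p))) \<in> borel_measurable borel"
        by (intro measurable_compose[OF _ measurable_ennreal] borel_measurable_continuous_onI continuous_intros)
      then show ?thesis unfolding \<pi>'_def case_prod_unfold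
        by (subst nn_integral_distr[OF Zm]) (simp_all add: dist_norm)
    qed
    \<comment> \<open>The Euclidean norm on phase space is at most the sum of the norms of the
      components; this is why the theorem bounds the distance by a sum of two terms.\<close>
    also have "\<dots> \<le> (\<integral>\<^sup>+\<omega>. ennreal (norm (fst (Z1 t \<omega>) - fst (Z2 t \<omega>))) + ennreal (norm (snd (Z1 t \<omega>) - snd (Z2 t \<omega>))) \<partial>\<pi>)"
    proof (intro nn_integral_mono)
      fix \<omega>
      have "norm (Z1 t \<omega> - Z2 t \<omega>) \<le> norm (fst (Z1 t \<omega> - Z2 t \<omega>)) + norm (snd (Z1 t \<omega> - Z2 t \<omega>))"
        unfolding norm_prod_def by (rule sqrt_sum_squares_le_sum) auto
      then show "ennreal (norm (Z1 t \<omega> - Z2 t \<omega>)) \<le> ennreal (norm (fst (Z1 t \<omega>) - fst (Z2 t \<omega>))) + ennreal (norm (snd (Z1 t \<omega>) - snd (Z2 t \<omega>)))"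
        by (simp flip: ennreal_plus)
    qed
    also have "\<dots> = (\<integral>\<^sup>+\<omega>. ennreal (norm (fst (Z1 t \<omega>) - fst (Z2 t \<omega>))) \<partial>\<pi>) + (\<integral>\<^sup>+\<omega>. ennreal (norm (snd (Z1 t \<omega>) - snd (Z2 t \<omega>))) \<partial>\<pi>)"
      using measurable_compose[OF Z1t[of t] fst_borel] measurable_compose[OF Z2t[of t] fst_borel]
        measurable_compose[OF Z1t[of t] snd_borel] measurable_compose[OF Z2t[of t] snd_borel]
      by (intro nn_integral_add) auto
    also have "\<dots> \<le> ennreal R + ennreal (exp (L * t) * (\<delta> + sqrt (4 * L * Phi \<phi> R)))"
      using R by (intro add_mono)
    also have "\<dots> = ennreal (R + exp (L * t) * (\<delta> + sqrt (4 * L * Phi \<phi> R)))"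
      using R(1) \<delta>(1) L Phi_nonneg[OF R(1)] by (intro ennreal_plus[symmetric]) auto
    finally show ?thesis using R by blast
  qed
  show ?thesis by (rule that[OF cpl main])
qed

end

section \<open>Nearly optimal couplings\<close>

lemma W1_le:
  assumes "\<pi> \<in> couplings \<mu> \<nu>" "(\<integral>\<^sup>+(z, w). ennreal (dist z w) \<partial>\<pi>) \<le> ennreal B" "0 \<le> B"
  shows "W1 \<mu> \<nu> \<le> B"
  unfolding W1_def using assms by (intro enn2real_leI INF_lower2[of \<pi>]) auto

text \<open>The product measure has finite cost thanks to the first moments, so the infimum is
  finite and \<open>enn2real\<close> loses nothing; any \<open>c\<close> above \<open>W1\<close> is
  then undercut by some coupling.\<close>

lemma W1_approx:
  fixes \<mu> \<nu> :: "'b::euclidean_space measure"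
  assumes P: "prob_space \<mu>" "prob_space \<nu>" and s: "sets \<mu> = sets borel" "sets \<nu> = sets borel"
    and fin: "(\<integral>\<^sup>+z. ennreal (norm z) \<partial>\<mu>) < \<infinity>" "(\<integral>\<^sup>+z. ennreal (norm z) \<partial>\<nu>) < \<infinity>" and c: "W1 \<mu> \<nu> < c"
  obtains \<pi> where "\<pi> \<in> couplings \<mu> \<nu>" "(\<integral>\<^sup>+(z, w). ennreal (dist z w) \<partial>\<pi>) \<le> ennreal c"
proof -
  interpret \<mu>: prob_space \<mu> by fact
  interpret \<nu>: prob_space \<nu> by fact
  interpret \<mu>\<nu>: pair_sigma_finite \<mu> \<nu> ..
  define I where "I = (INF \<pi>\<in>couplings \<mu> \<nu>. \<integral>\<^sup>+(z, w). ennreal (dist z w) \<partial>\<pi>)"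
  have sp: "sets (\<mu> \<Otimes>\<^sub>M \<nu>) = sets borel"
    using sets_pair_measure_cong[OF s] unfolding borel_prod .
  have fst_d: "distr (\<mu> \<Otimes>\<^sub>M \<nu>) borel fst = \<mu>"
    using \<nu>.distr_pair_fst[of \<mu>] by (metis distr_cong s(1))
  have snd_d: "distr (\<mu> \<Otimes>\<^sub>M \<nu>) borel snd = \<nu>"
  proof -
    have "distr (\<mu> \<Otimes>\<^sub>M \<nu>) borel snd = distr (\<nu> \<Otimes>\<^sub>M \<mu>) borel fst"
      by (subst \<mu>\<nu>.distr_pair_swap, subst distr_distr) (auto simp: s comp_def case_prod_unfold measurable_cong_sets[OF refl s(2)[symmetric]])
    also have "\<dots> = \<nu>" using \<mu>.distr_pair_fst[of \<nu>] by (metis distr_cong s(2))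
    finally show ?thesis .
  qed
  have cp: "\<mu> \<Otimes>\<^sub>M \<nu> \<in> couplings \<mu> \<nu>"
    by (simp add: couplings_def sp fst_d snd_d)
  have nm: "(\<lambda>z. ennreal (norm z)) \<in> borel_measurable (borel :: 'b measure)" by measurable
  have fm: "fst \<in> \<mu> \<Otimes>\<^sub>M \<nu> \<rightarrow>\<^sub>M borel" "snd \<in> \<mu> \<Otimes>\<^sub>M \<nu> \<rightarrow>\<^sub>M borel"
    using measurable_cong_sets[OF sp refl] fst_borel snd_borel by blast+
  have "(\<integral>\<^sup>+(z, w). ennreal (dist z w) \<partial>(\<mu> \<Otimes>\<^sub>M \<nu>)) \<le> (\<integral>\<^sup>+p. ennreal (norm (fst p)) + ennreal (norm (snd p)) \<partial>(\<mu> \<Otimes>\<^sub>M \<nu>))"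
    by (intro nn_integral_mono) (auto simp: dist_norm norm_triangle_ineq4 simp flip: ennreal_plus)
  also have "\<dots> = (\<integral>\<^sup>+p. ennreal (norm (fst p)) \<partial>(\<mu> \<Otimes>\<^sub>M \<nu>)) + (\<integral>\<^sup>+p. ennreal (norm (snd p)) \<partial>(\<mu> \<Otimes>\<^sub>M \<nu>))"
    using measurable_compose[OF fm(1) nm] measurable_compose[OF fm(2) nm] by (intro nn_integral_add) auto
  also have "\<dots> = (\<integral>\<^sup>+z. ennreal (norm z) \<partial>\<mu>) + (\<integral>\<^sup>+z. ennreal (norm z) \<partial>\<nu>)"
  proof -
    have "(\<integral>\<^sup>+z. ennreal (norm z) \<partial>distr (\<mu> \<Otimes>\<^sub>M \<nu>) borel fst) = (\<integral>\<^sup>+p. ennreal (norm (fst p)) \<partial>(\<mu> \<Otimes>\<^sub>M \<nu>))"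
      "(\<integral>\<^sup>+z. ennreal (norm z) \<partial>distr (\<mu> \<Otimes>\<^sub>M \<nu>) borel snd) = (\<integral>\<^sup>+p. ennreal (norm (snd p)) \<partial>(\<mu> \<Otimes>\<^sub>M \<nu>))"
      by (rule nn_integral_distr[OF fm(1)], simp) (rule nn_integral_distr[OF fm(2)], simp)
    then show ?thesis by (simp only: fst_d snd_d)
  qed
  also have "\<dots> < \<infinity>" using fin by simp
  finally have "I < \<infinity>" unfolding I_def using INF_lower[OF cp] le_less_trans by metis
  then have "I = ennreal (W1 \<mu> \<nu>)" by (simp add: W1_def I_def[symmetric])
  also have "\<dots> < ennreal c" using c by (simp add: W1_def ennreal_less_iff)
  finally obtain \<pi> where "\<pi> \<in> couplings \<mu> \<nu>" "(\<integral>\<^sup>+(z, w). ennreal (dist z w) \<partial>\<pi>) < ennreal c"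
    unfolding I_def INF_less_iff by blast
  then show ?thesis using that by (simp add: less_imp_le)
qed

section \<open>Stability in the Wasserstein distance and uniqueness\<close>

context solution_pair
begin

text \<open>Moments are assumed for the solutions at times in [0, T]. The Borel flow at time 0 is
  the identity off a null set, so the initial measures inherit the moment of the solutions at time
  0.\<close>

lemma initial_moment:
  shows "prob_space \<mu>01" "prob_space \<mu>02" "sets \<mu>01 = sets borel" "sets \<mu>02 = sets borel"
    "(\<integral>\<^sup>+z. ennreal (norm z) \<partial>\<mu>01) < \<infinity>" "(\<integral>\<^sup>+z. ennreal (norm z) \<partial>\<mu>02) < \<infinity>"
proof -
  have T0: "0 \<le> T" "0 \<in> {0..T}" using T by auto
  have *: "prob_space \<mu>0 \<and> sets \<mu>0 = sets borel \<and> (\<integral>\<^sup>+z. ennreal (norm z) \<partial>\<mu>0) < \<infinity>"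
    if lag: "lagrangian_weak_phi_solution T K \<phi> F f0 f"
      and dens: "\<And>t. t \<in> {0..T} \<Longrightarrow> has_leb_density (\<mu> t) (f t)" and dens0: "has_leb_density \<mu>0 f0"
      and mom: "\<And>t. t \<in> {0..T} \<Longrightarrow> \<mu> t \<in> P1" for F f f0 \<mu> and \<mu>0 :: "('a \<times> 'a) measure"
  proof -
    obtain \<Gamma> G M where flow: "is_flow T F (field K f) \<Gamma>" and M: "M \<in> null_sets lborel"
      and G: "(\<lambda>(t, z). G t z) \<in> borel_measurable (borel \<Otimes>\<^sub>M borel)"
      and G\<Gamma>: "\<And>t z. t \<in> {0..T} \<Longrightarrow> z \<notin> M \<Longrightarrow> G t z = \<Gamma> t z"
      and push: "\<And>t. t \<in> {0..T} \<Longrightarrow> distr \<mu>0 borel (G t) = \<mu> t"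
      and p0: "prob_space \<mu>0" "sets \<mu>0 = sets borel" and ac0: "absolutely_continuous lborel \<mu>0"
      by (rule lagrangian_borel_flow[OF T0(1) lag dens dens0 mom]) blast+
    have "G 0 \<in> borel_measurable borel" using measurable_compose[OF _ G, of "\<lambda>z. (0, z)" borel] by simp
    then have G0: "G 0 \<in> borel_measurable \<mu>0" using measurable_cong_sets[OF p0(2) refl] by blast
    have "AE z in \<mu>0. z \<notin> M"
      by (rule absolutely_continuous_AE[OF _ ac0 AE_not_in[OF M]]) (simp add: p0)
    then have "AE z in \<mu>0. ennreal (norm z) = ennreal (norm (G 0 z))"
      by eventually_elim (simp add: G\<Gamma>[OF T0(2)] is_flow_0[OF flow T0(1)])
    then have "(\<integral>\<^sup>+z. ennreal (norm z) \<partial>\<mu>0) = (\<integral>\<^sup>+z. ennreal (norm (G 0 z)) \<partial>\<mu>0)"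
      by (rule nn_integral_cong_AE)
    also have "\<dots> = (\<integral>\<^sup>+z. ennreal (norm z) \<partial>\<mu> 0)"
      unfolding push[OF T0(2), symmetric] by (rule nn_integral_distr[OF G0, symmetric]) simp
    also have "\<dots> < \<infinity>" using mom[OF T0(2)] by (simp add: P1_def)
    finally show ?thesis using p0 by blast
  qed
  show "prob_space \<mu>01" "prob_space \<mu>02" "sets \<mu>01 = sets borel" "sets \<mu>02 = sets borel"
    "(\<integral>\<^sup>+z. ennreal (norm z) \<partial>\<mu>01) < \<infinity>" "(\<integral>\<^sup>+z. ennreal (norm z) \<partial>\<mu>02) < \<infinity>"
    using *[OF lag(1) dens(1) dens0(1) moments(1)] *[OF lag(2) dens(2) dens0(2) moments(2)] by blast+
qed

text \<open>The right-hand side of the theorem as a function of the comparison value; its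
  monotonicity and continuity permit the limits taken below.\<close>

definition bound :: "real \<Rightarrow> real \<Rightarrow> real \<Rightarrow> real" where
  "bound \<delta> t R = R + exp (L * t) * (\<delta> + sqrt (4 * L * Phi \<phi> R))"

lemma bound_mono: "0 \<le> R \<Longrightarrow> R \<le> R' \<Longrightarrow> \<delta> \<le> \<delta>' \<Longrightarrow> bound \<delta> t R \<le> bound \<delta>' t R'"
  unfolding bound_def using L Phi_mono[of R R']
  by (intro add_mono mult_left_mono real_sqrt_le_mono) auto

lemma bound_nonneg: "0 \<le> R \<Longrightarrow> 0 \<le> \<delta> \<Longrightarrow> 0 \<le> bound \<delta> t R"
  unfolding bound_def using L Phi_nonneg[of R] by simp

lemma tendsto_Phi:
  assumes "X \<longlonglongrightarrow> y" "\<And>n. 0 \<le> X n" "\<And>n. X n \<le> b" "0 \<le> y" "y \<le> b"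
  shows "(\<lambda>n. Phi \<phi> (X n)) \<longlonglongrightarrow> Phi \<phi> y"
  by (rule continuous_on_tendsto_compose[OF Phi_cont[of b] assms(1)]) (use assms in auto)

lemma shift_tendsto: "(\<lambda>n. y + inverse (real (Suc n))) \<longlonglongrightarrow> y" for y :: real
  using tendsto_add[OF tendsto_const[of y] LIMSEQ_inverse_real_of_nat] by simp

lemma shift_bounds: "y < y + inverse (real (Suc n))" "y + inverse (real (Suc n)) \<le> y + 1" for y :: real
  by (auto simp: field_simps)

text \<open>The strict hypothesis leaves room to replace \<open>W1\<close> by a slightly larger
  \<open>c\<close> that bounds the cost of an actual coupling; continuity of \<open>Psi\<close> and
  \<open>bound\<close> removes the error afterwards.\<close>

lemma stability:
  assumes dl: "0 < \<delta>" "ennreal (2 * L * W1 \<mu>01 \<mu>02) + Linf_norm T (\<lambda>t z. F1 t z - F2 t z) < ennreal \<delta>"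
    and t: "t \<in> {0..T}"
  shows "W1 (\<mu>1 t) (\<mu>2 t) \<le> bound \<delta> t (Psi_inv \<phi> \<delta> (2 * L) (Psi \<phi> \<delta> (2 * L) (W1 \<mu>01 \<mu>02) + exp (L * t) - 1))"
proof -
  interpret Psi_modulus \<phi> \<delta> "2 * L" using L dl by unfold_locales auto
  define w where "w = W1 \<mu>01 \<mu>02"
  have w: "0 \<le> w" by (simp add: w_def W1_def)
  define \<eta> where "\<eta> = enn2real (Linf_norm T (\<lambda>t z. F1 t z - F2 t z))"
  have nfin: "Linf_norm T (\<lambda>t z. F1 t z - F2 t z) \<noteq> \<infinity>" using dl(2) by auto
  then have \<eta>eq: "Linf_norm T (\<lambda>t z. F1 t z - F2 t z) = ennreal \<eta>" by (simp add: \<eta>_def ennreal_enn2real_if)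
  have \<eta>0: "0 \<le> \<eta>" by (simp add: \<eta>_def)
  have less: "2 * L * w + \<eta> < \<delta>"
    using dl(2) w L \<eta>0 unfolding \<eta>eq w_def[symmetric] by (simp add: ennreal_less_iff flip: ennreal_plus)
  have \<eta>: "AE s in lborel. s \<in> {0..T} \<longrightarrow> (\<forall>z. norm (F1 s z - F2 s z) \<le> \<eta>)"
    by (rule Linf_norm_AE[OF F(1,2) _ \<eta>0]) (simp add: \<eta>eq)
  define y where "y = Psi_inv \<phi> \<delta> (2 * L) (Psi \<phi> \<delta> (2 * L) w + exp (L * t) - 1)"
  have e1: "1 \<le> exp (L * t)" using L t by simp
  have "0 \<le> Psi \<phi> \<delta> (2 * L) w" using Psi_mono[of 0 w] w by simp
  then have "0 \<le> Psi \<phi> \<delta> (2 * L) w + exp (L * t) - 1" using e1 by linarith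
  note y = Psi_inv_props[OF this, folded y_def]
  \<comment> \<open>Moving from \<open>y\<close> to y + \<epsilon> opens a strict gap in
    \<open>Psi\<close>, which absorbs the excess of \<open>c\<close> over \<open>W1\<close>;
    \<epsilon> tends to 0 only after the coupling has been eliminated.\<close>
  have bd: "W1 (\<mu>1 t) (\<mu>2 t) \<le> bound \<delta> t (y + \<epsilon>)" if e: "0 < \<epsilon>" for \<epsilon>
  proof -
    have "(\<lambda>n. Psi \<phi> \<delta> (2 * L) (w + inverse (real (Suc n)))) \<longlonglongrightarrow> Psi \<phi> \<delta> (2 * L) w"
    proof (rule continuous_on_tendsto_compose[OF Psi_cont[of "w + 1"] shift_tendsto])
      show "\<forall>\<^sub>F n in sequentially. w + inverse (real (Suc n)) \<in> {0..w + 1}"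
        using w shift_bounds by (intro always_eventually allI) (simp add: add_nonneg_nonneg)
    qed (use w in auto)
    moreover have "Psi \<phi> \<delta> (2 * L) w < Psi \<phi> \<delta> (2 * L) (y + \<epsilon>) - exp (L * t) + 1"
      using Psi_strict_mono[of y "y + \<epsilon>"] y e by simp
    ultimately have ev1: "\<forall>\<^sub>F n in sequentially. Psi \<phi> \<delta> (2 * L) (w + inverse (real (Suc n))) < Psi \<phi> \<delta> (2 * L) (y + \<epsilon>) - exp (L * t) + 1"
      by (rule order_tendstoD(2))
    have "(\<lambda>n. 2 * L * (w + inverse (real (Suc n))) + \<eta>) \<longlonglongrightarrow> 2 * L * w + \<eta>"
      by (intro tendsto_intros shift_tendsto)
    then have ev2: "\<forall>\<^sub>F n in sequentially. 2 * L * (w + inverse (real (Suc n))) + \<eta> < \<delta>"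
      using less by (rule order_tendstoD(2))
    obtain n where n: "Psi \<phi> \<delta> (2 * L) (w + inverse (real (Suc n))) < Psi \<phi> \<delta> (2 * L) (y + \<epsilon>) - exp (L * t) + 1"
        "2 * L * (w + inverse (real (Suc n))) + \<eta> < \<delta>"
      using eventually_happens'[OF sequentially_bot eventually_conj[OF ev1 ev2]] by auto
    define c where "c = w + inverse (real (Suc n))"
    have c: "0 \<le> c" "w < c" using w shift_bounds(1)[of w n] by (auto simp: c_def)
    obtain \<pi> where \<pi>: "\<pi> \<in> couplings \<mu>01 \<mu>02" "(\<integral>\<^sup>+(z, w). ennreal (dist z w) \<partial>\<pi>) \<le> ennreal c"
      using W1_approx[OF initial_moment] c(2) unfolding w_def by blast
    obtain \<pi>' where \<pi>': "\<pi>' \<in> couplings (\<mu>1 t) (\<mu>2 t)" and est: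
      "\<And>c \<eta> \<delta>. 0 \<le> c \<Longrightarrow> (\<integral>\<^sup>+(z, w). ennreal (dist z w) \<partial>\<pi>) \<le> ennreal c \<Longrightarrow> 0 \<le> \<eta> \<Longrightarrow>
      AE s in lborel. s \<in> {0..T} \<longrightarrow> (\<forall>z. norm (F1 s z - F2 s z) \<le> \<eta>) \<Longrightarrow> 0 < \<delta> \<Longrightarrow> 2 * L * c + \<eta> \<le> \<delta> \<Longrightarrow>
      \<exists>R\<ge>0. (\<integral>\<^sup>+(z, w). ennreal (dist z w) \<partial>\<pi>') \<le> ennreal (R + exp (L * t) * (\<delta> + sqrt (4 * L * Phi \<phi> R))) \<and>
        Psi \<phi> \<delta> (2 * L) R \<le> Psi \<phi> \<delta> (2 * L) c + exp (L * t) - 1"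
      by (rule coupling_estimate[OF \<pi>(1) t]) blast
    obtain R where R: "0 \<le> R" "(\<integral>\<^sup>+(z, w). ennreal (dist z w) \<partial>\<pi>') \<le> ennreal (bound \<delta> t R)"
      "Psi \<phi> \<delta> (2 * L) R \<le> Psi \<phi> \<delta> (2 * L) c + exp (L * t) - 1"
      using est[OF c(1) \<pi>(2) \<eta>0 \<eta> dl(1)] n(2) unfolding bound_def c_def by (meson less_imp_le)
    have "Psi \<phi> \<delta> (2 * L) R < Psi \<phi> \<delta> (2 * L) (y + \<epsilon>)" using R(3) n(1) by (simp add: c_def)
    then have "R \<le> y + \<epsilon>" using Psi_mono[of "y + \<epsilon>" R] y(1) e by (cases "R \<le> y + \<epsilon>") auto
    then have "bound \<delta> t R \<le> bound \<delta> t (y + \<epsilon>)" using R(1) by (intro bound_mono) auto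
    moreover have "W1 (\<mu>1 t) (\<mu>2 t) \<le> bound \<delta> t R"
      using R(1) dl(1) by (intro W1_le[OF \<pi>' R(2)] bound_nonneg) auto
    ultimately show ?thesis by linarith
  qed
  have "(\<lambda>n. bound \<delta> t (y + inverse (real (Suc n)))) \<longlonglongrightarrow> bound \<delta> t y"
    unfolding bound_def
    by (intro tendsto_intros shift_tendsto tendsto_Phi[where b = "y + 1"])
       (use y(1) shift_bounds[of y] in \<open>auto intro: add_nonneg_nonneg\<close>)
  then have "W1 (\<mu>1 t) (\<mu>2 t) \<le> bound \<delta> t y"
    by (rule LIMSEQ_le_const) (use bd in auto)
  then show ?thesis by (simp add: y_def w_def)
qed

text \<open>Equal data are coupled along the diagonal at zero cost and with \<eta> = 0, so every
  \<delta> > 0 is allowed. The transported coupling then has cost zero, hence is concentrated on the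
  diagonal, and its two marginals coincide.\<close>

lemma uniqueness:
  assumes osg: "osgood_sqrt \<phi>" and f0: "AE z in lebesgue. f01 z = f02 z"
    and F_eq: "AE t in lebesgue_on {0..T}. \<forall>z. F1 t z = F2 t z" and t: "t \<in> {0..T}"
  shows "AE z in lebesgue. f1 t z = f2 t z"
proof -
  have \<eta>: "AE s in lborel. s \<in> {0..T} \<longrightarrow> (\<forall>z. norm (F1 s z - F2 s z) \<le> 0)"
  proof -
    have "AE s in lborel. s \<in> {0..T} \<longrightarrow> (\<forall>z. F1 s z = F2 s z)" by (rule AE_lebesgue_onD[OF F_eq]) simp
    then show ?thesis by eventually_elim simp
  qed
  obtain g1 where g1: "g1 \<in> borel_measurable borel" "AE x in lborel. f01 x = g1 x" "\<mu>01 = density lborel (\<lambda>x. ennreal (g1 x))"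
    by (rule has_leb_density_borel_version[OF dens0(1)]) blast
  obtain g2 where g2: "g2 \<in> borel_measurable borel" "AE x in lborel. f02 x = g2 x" "\<mu>02 = density lborel (\<lambda>x. ennreal (g2 x))"
    by (rule has_leb_density_borel_version[OF dens0(2)]) blast
  have "AE x in lborel. f01 x = f02 x" using f0 by (simp add: AE_completion_iff)
  with g1(2) g2(2) have "AE x in lborel. ennreal (g1 x) = ennreal (g2 x)" by eventually_elim simp
  then have eq0: "\<mu>01 = \<mu>02" unfolding g1(3) g2(3) using g1(1) g2(1) by (intro density_cong) auto
  define \<pi> where "\<pi> = distr \<mu>01 borel (\<lambda>z. (z, z))"
  have dm: "(\<lambda>z. (z, z)) \<in> \<mu>01 \<rightarrow>\<^sub>M borel"
    using measurable_Pair[OF measurable_ident_sets[OF initial_moment(3)] measurable_ident_sets[OF initial_moment(3)]]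
    unfolding borel_prod .
  have idd: "distr \<mu>01 borel (\<lambda>z. z) = \<mu>01" by (rule distr_id2) (simp add: initial_moment(3))
  have "distr \<pi> borel fst = \<mu>01" "distr \<pi> borel snd = \<mu>01"
    unfolding \<pi>_def using distr_distr[OF fst_borel dm] distr_distr[OF snd_borel dm] idd by (simp_all add: o_def)
  then have \<pi>c: "\<pi> \<in> couplings \<mu>01 \<mu>02" by (simp add: couplings_def eq0 \<pi>_def)
  have dmeas: "(\<lambda>(z :: 'a \<times> 'a, w). ennreal (dist z w)) \<in> borel_measurable borel"
    unfolding case_prod_unfold
    by (intro measurable_compose[OF _ measurable_ennreal] borel_measurable_continuous_onI continuous_intros)
  have cost0: "(\<integral>\<^sup>+(z, w). ennreal (dist z w) \<partial>\<pi>) \<le> ennreal 0"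
    unfolding \<pi>_def by (subst nn_integral_distr[OF dm]) (use dmeas in simp_all)
  obtain \<pi>' where \<pi>': "\<pi>' \<in> couplings (\<mu>1 t) (\<mu>2 t)" and est:
      "\<And>c \<eta> \<delta>. 0 \<le> c \<Longrightarrow> (\<integral>\<^sup>+(z, w). ennreal (dist z w) \<partial>\<pi>) \<le> ennreal c \<Longrightarrow> 0 \<le> \<eta> \<Longrightarrow>
      AE s in lborel. s \<in> {0..T} \<longrightarrow> (\<forall>z. norm (F1 s z - F2 s z) \<le> \<eta>) \<Longrightarrow> 0 < \<delta> \<Longrightarrow> 2 * L * c + \<eta> \<le> \<delta> \<Longrightarrow>
      \<exists>R\<ge>0. (\<integral>\<^sup>+(z, w). ennreal (dist z w) \<partial>\<pi>') \<le> ennreal (R + exp (L * t) * (\<delta> + sqrt (4 * L * Phi \<phi> R))) \<and>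
        Psi \<phi> \<delta> (2 * L) R \<le> Psi \<phi> \<delta> (2 * L) c + exp (L * t) - 1"
    by (rule coupling_estimate[OF \<pi>c t]) blast
  have small: "(\<integral>\<^sup>+(z, w). ennreal (dist z w) \<partial>\<pi>') \<le> ennreal (bound \<epsilon> t \<epsilon>)" if e: "0 < \<epsilon>" for \<epsilon>
  proof -
    \<comment> \<open>The divergence of the integral acts here: Psi(R) \<le> exp(L t) - 1 <
      Psi(\<epsilon>) forces R \<le> \<epsilon>.\<close>
    obtain \<delta> where dl: "0 < \<delta>" "\<delta> \<le> \<epsilon>" "exp (L * t) - 1 < Psi \<phi> \<delta> (2 * L) \<epsilon>"
      using osgood_Psi_unbounded[OF osg e, of "2 * L" "exp (L * t) - 1"] L by auto
    interpret Psi_modulus \<phi> \<delta> "2 * L" using L dl by unfold_locales auto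
    obtain R where R: "0 \<le> R" "(\<integral>\<^sup>+(z, w). ennreal (dist z w) \<partial>\<pi>') \<le> ennreal (bound \<delta> t R)"
      "Psi \<phi> \<delta> (2 * L) R \<le> exp (L * t) - 1"
      using est[OF order_refl cost0 order_refl \<eta> dl(1)] dl(1) unfolding bound_def by auto
    have "R \<le> \<epsilon>" using Psi_mono[of \<epsilon> R] e R(3) dl(3) by (cases "R \<le> \<epsilon>") auto
    then have "bound \<delta> t R \<le> bound \<epsilon> t \<epsilon>" using R(1) dl(2) by (intro bound_mono)
    then show ?thesis using R(2) by (meson ennreal_leI order_trans)
  qed
  have "(\<lambda>n. bound (0 + inverse (real (Suc n))) t (0 + inverse (real (Suc n)))) \<longlonglongrightarrow> bound 0 t 0"
    unfolding bound_def
    by (intro tendsto_intros shift_tendsto tendsto_Phi[where b = 1])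
       (use shift_bounds[of 0] in \<open>auto intro: less_imp_le\<close>)
  then have "(\<lambda>n. ennreal (bound (0 + inverse (real (Suc n))) t (0 + inverse (real (Suc n))))) \<longlonglongrightarrow> ennreal (bound 0 t 0)"
    by (rule tendsto_ennrealI)
  then have "(\<integral>\<^sup>+(z, w). ennreal (dist z w) \<partial>\<pi>') \<le> ennreal (bound 0 t 0)"
    by (rule LIMSEQ_le_const) (intro exI allI impI small, simp)
  then have "(\<integral>\<^sup>+(z, w). ennreal (dist z w) \<partial>\<pi>') = 0" by (simp add: bound_def)
  moreover have \<pi>'s: "sets \<pi>' = sets borel" and \<pi>'d: "distr \<pi>' borel fst = \<mu>1 t" "distr \<pi>' borel snd = \<mu>2 t"
    using \<pi>' by (auto simp: couplings_def)
  moreover have dmeas': "(\<lambda>(z :: 'a \<times> 'a, w). ennreal (dist z w)) \<in> borel_measurable \<pi>'"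
    using dmeas measurable_cong_sets[OF \<pi>'s refl] by blast
  ultimately have "AE p in \<pi>'. (\<lambda>(z, w). ennreal (dist z w)) p = 0"
    by (simp add: nn_integral_0_iff_AE)
  then have eq: "AE p in \<pi>'. fst p = snd p" by eventually_elim (auto simp: case_prod_unfold)
  have fm: "fst \<in> borel_measurable \<pi>'" "snd \<in> borel_measurable \<pi>'"
    using measurable_cong_sets[OF \<pi>'s refl] fst_borel snd_borel by blast+
  have "distr \<pi>' borel fst = distr \<pi>' borel snd"
    by (rule distr_cong_AE[OF refl refl]) (use eq fm in auto)
  then have "\<mu>1 t = \<mu>2 t" by (simp add: \<pi>'d)
  then show ?thesis using has_leb_density_unique[of "\<mu>1 t" "f1 t" "f2 t"] dens[OF t] by simp
qed

end

theorem theorem2p8: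
  fixes T L :: real
    and \<phi> :: "real \<Rightarrow> real"
    and K :: "'a::euclidean_space \<Rightarrow> 'a \<Rightarrow> 'a"
    and F :: "nat \<Rightarrow> real \<Rightarrow> 'a \<times> 'a \<Rightarrow> 'a"
    and f0 :: "nat \<Rightarrow> 'a \<times> 'a \<Rightarrow> real"
    and f :: "nat \<Rightarrow> real \<Rightarrow> 'a \<times> 'a \<Rightarrow> real"
    and \<mu>0 :: "nat \<Rightarrow> ('a \<times> 'a) measure"
    and \<mu> :: "nat \<Rightarrow> real \<Rightarrow> ('a \<times> 'a) measure"
  assumes "T > 0"
    and "continuous_on {0..} \<phi>" and "\<And>t. t \<ge> 0 \<Longrightarrow> \<phi> t \<ge> 0" and "\<And>t. t > 0 \<Longrightarrow> \<phi> t > 0"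
    and "antisym_kernel K"
    and "L \<ge> 1"
    and "\<And>i. i \<in> {1, 2} \<Longrightarrow> Linf_C T (F i)"
    and "\<And>i. i \<in> {1, 2} \<Longrightarrow> ess_lipschitz T L (F i)"
    and "\<And>i. i \<in> {1, 2} \<Longrightarrow> divx_free T (F i)"
    and "\<And>i. i \<in> {1, 2} \<Longrightarrow> lagrangian_weak_phi_solution T K \<phi> (F i) (f0 i) (f i)"
    and "\<And>i. i \<in> {1, 2} \<Longrightarrow> Linf_P1 T (\<mu> i)"
    and "\<And>i t. i \<in> {1, 2} \<Longrightarrow> t \<in> {0..T} \<Longrightarrow> has_leb_density (\<mu> i t) (f i t)"
    and "\<And>i. i \<in> {1, 2} \<Longrightarrow> has_leb_density (\<mu>0 i) (f0 i)"
    and "concave_on {0..} \<phi>"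
    and "osgood_sqrt \<phi>"
  shows "(\<forall>\<delta>>0. ennreal (2 * L * W1 (\<mu>0 1) (\<mu>0 2)) + Linf_norm T (\<lambda>t z. F 1 t z - F 2 t z) < ennreal \<delta> \<longrightarrow>
            (\<forall>t\<in>{0..T}.
               W1 (\<mu> 1 t) (\<mu> 2 t)
                 \<le> Psi_inv \<phi> \<delta> (2 * L) (Psi \<phi> \<delta> (2 * L) (W1 (\<mu>0 1) (\<mu>0 2)) + exp (L * t) - 1)
                   + exp (L * t) * (\<delta> + sqrt (4 * L * Phi \<phi>
                       (Psi_inv \<phi> \<delta> (2 * L) (Psi \<phi> \<delta> (2 * L) (W1 (\<mu>0 1) (\<mu>0 2)) + exp (L * t) - 1))))))
       \<and> ((AE z in lebesgue. f0 1 z = f0 2 z) \<and>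
          (AE t in lebesgue_on {0..T}. \<forall>z. F 1 t z = F 2 t z) \<longrightarrow>
          (\<forall>t\<in>{0..T}. AE z in lebesgue. f 1 t z = f 2 t z))"
proof -
  interpret concave_modulus \<phi> by unfold_locales (fact assms)+
  interpret solution_pair \<phi> T L K "F 1" "F 2" "f0 1" "f0 2" "f 1" "f 2" "\<mu>0 1" "\<mu>0 2" "\<mu> 1" "\<mu> 2"
    by unfold_locales (use assms osgood_imp_zero in auto)
  show ?thesis using stability[unfolded bound_def] uniqueness[OF assms(15)] by blast
qed

end
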